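(* Let $K$ be a continuous, positive definite and zonal kernel on a compact two-point homogeneous space $\mathbb{M}^d$ and let $K_r^d$ be its radial part. The following differentiability properties hold on $(-1,1)$: (i) if $\mathbb{M}^d=S^d$, then $K_r^d$ is of class $C^{\lfloor (d-1)/2\rfloor}$; (ii) if $\mathbb{M}^d=\mathbb{P}^d(\mathbb{R})$, then $K_r^d$ is of class $C^{\lfloor (d-1)/2\rfloor}$; (iii) if $\mathbb{M}^d=\mathbb{P}^d(\mathbb{C})$, then $K_r^d$ is of class $C^{(d-2)/2}$; (iv) if $\mathbb{M}^d=\mathbb{P}^d(\mathbb{H})$, then $K_r^d$ is of class $C^{(d-4)/4}$ if $d\in 8\mathbb{Z}_++8$, and of class $C^{d/4}$ if $d\in 8\mathbb{Z}_++12$; (v) if $\mathbb{M}^d=\mathbb{P}^{16}(Cay)$ ($d=16$), then $K_r^{16}$ is of class $C^1$.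
   Context: $\mathbb{Z}_+=\{0,1,2,\ldots\}$ and $\lfloor\cdot\rfloor$ is the integer part. Superscripts denote real dimension. The compact two-point homogeneous spaces are the unit spheres $S^d$ ($d=1,2,\ldots$), the real projective spaces $\mathbb{P}^d(\mathbb{R})$ ($d=2,3,\ldots$), the complex projective spaces $\mathbb{P}^d(\mathbb{C})$ ($d=4,6,\ldots$), the quaternionic projective spaces $\mathbb{P}^d(\mathbb{H})$ ($d=8,12,\ldots$) and the Cayley projective plane $\mathbb{P}^{16}(Cay)$. Each such space $\mathbb{M}^d$ carries its geodesic distance $|xy|$, rescaled so that the maximal distance between two points is $2\pi$ (so $\cos(|xy|/2)$ ranges over $[-1,1]$), and a group of motions (isometries) $G_d$ which takes any pair of points $(x,y)$ to $(z,w)$ whenever $|xy|=|zw|$. A kernel is a function $K:\mathbb{M}^d\times\mathbb{M}^d\to\mathbb{R}$. It is positive definite if $\sum_{\mu,\nu=1}^n c_\mu c_\nu K(x_\mu,x_\nu)\geq 0$ for every positive integer $n$, all distinct points $x_1,\ldots,x_n\in\mathbb{M}^d$ and all real scalars $c_1,\ldots,c_n$. It is zonal (isotropic) if $K(x,y)=K(Ax,Ay)$ for all $x,y\in\mathbb{M}^d$ and $A\in G_d$. A zonal kernel can be written as $K(x,y)=K_r^d(\cos(|xy|/2))$ for a unique function $K_r^d:[-1,1]\to\mathbb{R}$, called the radial (or isotropic) part of $K$. By Gangolli's theorem, a continuous zonal kernel $K$ on $\mathbb{M}^d$ is positive definite if and only if $K_r^d(t)=\sum_{k=0}^\infty a_k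 P_k^{(d-2)/2,\beta}(t)$ for $t\in[-1,1]$, with all $a_k\geq 0$ and $\sum_k a_kP_k^{(d-2)/2,\beta}(1)<\infty$, where $P_k^{\alpha,\beta}$ is the Jacobi polynomial of degree $k$ and $\beta=(d-2)/2,\,-1/2,\,0,\,1,\,3$ for spheres, real, complex, quaternionic projective spaces and the Cayley plane, respectively. *)

theory Defs
  imports "HOL-Analysis.Analysis"
begin

text \<open>
  Spaces and kernels. A space is given by its set of points M and its geodesic distance \<open>\<delta>\<close>,
  rescaled so that the maximal distance is \<open>2 * pi\<close>.
\<close>

text \<open>The group of motions is the full isometry group.\<close>

definition motions :: "'p set \<Rightarrow> ('p \<Rightarrow> 'p \<Rightarrow> real) \<Rightarrow> ('p \<Rightarrow> 'p) set" where
  "motions M \<delta> = {A. bij_betw A M M \<and> (\<forall>x\<in>M. \<forall>y\<in>M. \<delta> (A x) (A y) = \<delta> x y)}"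

definition zonal :: "'p set \<Rightarrow> ('p \<Rightarrow> 'p \<Rightarrow> real) \<Rightarrow> ('p \<Rightarrow> 'p \<Rightarrow> real) \<Rightarrow> bool" where
  "zonal M \<delta> K \<longleftrightarrow> (\<forall>A\<in>motions M \<delta>. \<forall>x\<in>M. \<forall>y\<in>M. K x y = K (A x) (A y))"

definition radial_part ::
  "'p set \<Rightarrow> ('p \<Rightarrow> 'p \<Rightarrow> real) \<Rightarrow> ('p \<Rightarrow> 'p \<Rightarrow> real) \<Rightarrow> (real \<Rightarrow> real) \<Rightarrow> bool" where
  "radial_part M \<delta> K f \<longleftrightarrow> (\<forall>x\<in>M. \<forall>y\<in>M. K x y = f (cos (\<delta> x y / 2)))"

definition positive_definite :: "'p set \<Rightarrow> ('p \<Rightarrow> 'p \<Rightarrow> real) \<Rightarrow> bool" where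
  "positive_definite M K \<longleftrightarrow>
     (\<forall>(n::nat) (x::nat \<Rightarrow> 'p) (c::nat \<Rightarrow> real).
        0 < n \<and> inj_on x {..<n} \<and> x ` {..<n} \<subseteq> M \<longrightarrow>
        0 \<le> (\<Sum>\<mu><n. \<Sum>\<nu><n. c \<mu> * c \<nu> * K (x \<mu>) (x \<nu>)))"

text \<open>
  Joint continuity on \<open>M \<times> M\<close> for the topology of \<open>\<delta>\<close>. It is spelled out because the points of a
  projective space are sets of vectors, which carry no topology as a type.
\<close>

definition continuous_kernel :: "'p set \<Rightarrow> ('p \<Rightarrow> 'p \<Rightarrow> real) \<Rightarrow> ('p \<Rightarrow> 'p \<Rightarrow> real) \<Rightarrow> bool" where
  "continuous_kernel M \<delta> K \<longleftrightarrow>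
     (\<forall>x\<in>M. \<forall>y\<in>M. \<forall>e>0. \<exists>r>0. \<forall>x'\<in>M. \<forall>y'\<in>M.
        \<delta> x x' < r \<and> \<delta> y y' < r \<longrightarrow> \<bar>K x' y' - K x y\<bar> < e)"

text \<open>Functions of class \<open>C\<^sup>m\<close> on an open set of reals.\<close>

definition class_C :: "nat \<Rightarrow> (real \<Rightarrow> real) \<Rightarrow> real set \<Rightarrow> bool" where
  "class_C m f S \<longleftrightarrow>
     (\<forall>j<m. \<forall>t\<in>S. ((deriv ^^ j) f) differentiable (at t)) \<and> continuous_on S ((deriv ^^ m) f)"

text \<open>
  Quaternions and octonions, by Cayley-Dickson doubling from the complex numbers. Addition, scalar
  multiplication, inner product and norm are those of the product type, which are the
  standard ones.
\<close>

definition cd_mult ::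
  "('f \<Rightarrow> 'f \<Rightarrow> 'f) \<Rightarrow> ('f \<Rightarrow> 'f) \<Rightarrow> 'f \<times> 'f \<Rightarrow> 'f \<times> 'f \<Rightarrow> ('f::ab_group_add) \<times> 'f" where
  "cd_mult mul cj p q =
     (mul (fst p) (fst q) - mul (cj (snd q)) (snd p), mul (snd q) (fst p) + mul (snd p) (cj (fst q)))"

definition cd_cnj :: "('f \<Rightarrow> 'f) \<Rightarrow> 'f \<times> 'f \<Rightarrow> ('f::ab_group_add) \<times> 'f" where
  "cd_cnj cj p = (cj (fst p), - snd p)"

type_synonym quat = "complex \<times> complex"
type_synonym oct = "quat \<times> quat"

definition quat_mult :: "quat \<Rightarrow> quat \<Rightarrow> quat" where "quat_mult = cd_mult (*) cnj"
definition quat_cnj :: "quat \<Rightarrow> quat" where "quat_cnj = cd_cnj cnj"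
definition oct_mult :: "oct \<Rightarrow> oct \<Rightarrow> oct" where "oct_mult = cd_mult quat_mult quat_cnj"
definition oct_cnj :: "oct \<Rightarrow> oct" where "oct_cnj = cd_cnj quat_cnj"
definition oct_one :: oct where "oct_one = ((1, 0), (0, 0))"

definition sphere_dist :: "real ^ 'n \<Rightarrow> real ^ 'n \<Rightarrow> real" where
  "sphere_dist x y = 2 * arccos (x \<bullet> y)"

text \<open>
  Projective spaces over a division algebra with multiplication \<open>mul\<close> and conjugation \<open>cj\<close>: the
  points are the one-dimensional right subspaces of \<open>'f ^ 'n\<close>. The distance is the Fubini-Study
  distance \<open>arccos \<bar>\<langle>u, v\<rangle>\<bar>\<close>, whose maximum is \<open>pi / 2\<close>, scaled by 4; its value does not depend on
  the chosen unit representatives, since they differ by right multiplication with unit scalars.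
\<close>

definition scalar_line :: "('f \<Rightarrow> 'f \<Rightarrow> 'f) \<Rightarrow> 'f ^ 'n \<Rightarrow> ('f ^ 'n) set" where
  "scalar_line mul v = range (\<lambda>a. \<chi> i. mul (v $ i) a)"

definition proj_space :: "('f \<Rightarrow> 'f \<Rightarrow> 'f) \<Rightarrow> (('f::zero) ^ 'n) set set" where
  "proj_space mul = {scalar_line mul v | v. v \<noteq> 0}"

definition unit_rep :: "(('f::real_normed_vector) ^ 'n) set \<Rightarrow> 'f ^ 'n" where
  "unit_rep L = (SOME u. u \<in> L \<and> norm u = 1)"

definition herm_form ::
  "('f \<Rightarrow> 'f \<Rightarrow> 'f) \<Rightarrow> ('f \<Rightarrow> 'f) \<Rightarrow> ('f::real_normed_vector) ^ 'n \<Rightarrow> 'f ^ 'n \<Rightarrow> 'f" where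
  "herm_form mul cj u v = (\<Sum>i\<in>UNIV. mul (cj (u $ i)) (v $ i))"

definition proj_dist ::
  "('f \<Rightarrow> 'f \<Rightarrow> 'f) \<Rightarrow> ('f \<Rightarrow> 'f) \<Rightarrow> (('f::real_normed_vector) ^ 'n) set \<Rightarrow> ('f ^ 'n) set \<Rightarrow> real" where
  "proj_dist mul cj L L' = 4 * arccos (norm (herm_form mul cj (unit_rep L) (unit_rep L')))"

text \<open>
  The Cayley plane, as the Hermitian idempotent 3 by 3 octonionic matrices of trace one. For
  Hermitian matrices \<open>p \<bullet> q\<close> is the trace form \<open>tr (p \<circ> q)\<close> of the Albert algebra, equal to the
  squared cosine of the unscaled distance (again with maximum \<open>pi / 2\<close>).
\<close>

definition cayley_plane :: "(oct ^ 3 ^ 3) set" where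
  "cayley_plane = {p.
     (\<forall>i j. p $ j $ i = oct_cnj (p $ i $ j)) \<and>
     (\<forall>i j. (\<Sum>k\<in>UNIV. oct_mult (p $ i $ k) (p $ k $ j)) = p $ i $ j) \<and>
     (\<Sum>i\<in>UNIV. p $ i $ i) = oct_one}"

definition cayley_dist :: "oct ^ 3 ^ 3 \<Rightarrow> oct ^ 3 ^ 3 \<Rightarrow> real" where
  "cayley_dist p q = 4 * arccos (sqrt (p \<bullet> q))"

end

theory Submission
  imports Defs "HOL-Computational_Algebra.Polynomial" "HOL-Real_Asymp.Real_Asymp"
    "HOL-Probability.Probability"
begin

text \<open>
Write \<open>t\<close> for the argument of the radial part and \<open>u = (1 - t) / 2\<close>, which runs over the unit
interval. Each of the spaces but the Cayley plane is covered by a unit sphere \<open>S\<close> of a Euclidean space on which \<open>u\<close> becomes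
a polynomial function \<open>U x y\<close>: \<open>(1 - x \<bullet> y) / 2\<close> for the sphere itself, and one minus the squared
modulus of the Hermitian product for a projective space. The kernel becomes \<open>F (U x y)\<close>, and the
claim concerns the derivatives of \<open>F\<close> inside the unit interval. One argument covers all these spaces; it gives
\<open>C\<^sup>m\<close> for every \<open>m \<le> (d - 1) / 2\<close>, which is at least what is asked.

The law of \<open>U x y\<close>, for fixed \<open>x\<close> and \<open>y\<close> uniform on \<open>S\<close>, is the Beta law with parameters \<open>A = d / 2\<close>
and \<open>C - A\<close>. It enters through its integration by parts formula only (\<open>jacobi_functional\<close>), and this
formula is the statement that the mean over \<open>S\<close> of a derivative along a rotation vanishes
(\<open>pearson_linear\<close>, \<open>pearson_squares\<close>). It makes the hypergeometric operator symmetric, and so yields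
the orthogonality and the norms of its polynomial eigenfunctions \<open>jac A C k\<close>, the Jacobi polynomials
with value 1 at \<open>u = 0\<close>. The squared norm of \<open>jac A C k\<close> decays like \<open>k\<close> to the power \<open>1 - 2 * A\<close>
(\<open>jac_norm_bound\<close>).

Positive definiteness makes the Jacobi coefficients of \<open>F\<close> nonnegative (\<open>jac_coeff_nonneg\<close>). Indeed
the mean over \<open>y\<close> of a function of \<open>U x y\<close> times \<open>U e y ^ k\<close> is a polynomial of degree at most \<open>k\<close> in
\<open>U x e\<close>: in an orthonormal frame adapted to the pair \<open>x, e\<close> the square root in the coordinates of \<open>e\<close>
occurs to even powers only. Hence convolution with \<open>F\<close> multiplies \<open>jac A C k\<close> by a number
(\<open>Funk_Hecke\<close>), and this number has the sign of a double integral of the kernel. Testing \<open>F\<close> against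
powers of \<open>1 - u\<close>, which concentrate at \<open>u = 0\<close>, shows that the coefficients are summable
(\<open>summable_jac_coeff\<close>).

It remains to differentiate the series term by term. Away from the end points the Jacobi polynomial
oscillates with an energy that is comparable at any two points, so its square and, up to powers of
\<open>k\<close>, the squares of its derivatives are bounded by its squared norm: the \<open>i\<close>-th derivative is
\<open>O(k\<^sup>i)\<close> times the norm (\<open>jac_derivative_bound\<close>). For \<open>i \<le> m \<le> A - 1 / 2\<close> this is bounded in \<open>k\<close>, and
the differentiated series converges uniformly on compact parts of the open interval. That the sum is
\<open>F\<close> follows from convergence in mean square.

The Cayley plane contains a projective line, which is a round sphere of dimension 8 with the same
maximal distance; already a three-dimensional subsphere of it gives \<open>C\<^sup>1\<close>.
\<close>

section \<open>Jacobi polynomials and their orthogonality functionals\<close>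

abbreviation pX :: "real poly" where "pX \<equiv> [:0, 1, -1:]"

text \<open>
The terminating Gauss hypergeometric series with parameters \<open>- k\<close>, \<open>k + C - 1\<close> and \<open>A\<close>. It is the Jacobi polynomial of degree \<open>k\<close>
with parameters \<open>\<alpha> = A - 1\<close> and \<open>\<beta> = C - A - 1\<close> at \<open>1 - 2 * u\<close>, divided by its value at 1.
\<close>

definition jac :: "real \<Rightarrow> real \<Rightarrow> nat \<Rightarrow> real poly" where
  "jac A C k = (\<Sum>j\<le>k. monom (pochhammer (- real k) j * pochhammer (real k + C - 1) j
      / (pochhammer A j * fact j)) j)"

definition jac_eigenvalue :: "real \<Rightarrow> nat \<Rightarrow> real" where
  "jac_eigenvalue C k = real k * (real k + C - 1)"

text \<open>
The squared norm of \<open>jac A C k\<close> for the Beta law with parameters \<open>A\<close> and \<open>C - A\<close>; see \<open>L_jac_square\<close>.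
\<close>

definition jac_norm :: "real \<Rightarrow> real \<Rightarrow> nat \<Rightarrow> real" where
  "jac_norm A C k = fact k * pochhammer (real k + C - 1) k * pochhammer (C - A) k
      / (pochhammer A k * pochhammer C (2 * k))"

lemma coeff_jac:
  "coeff (jac A C k) j = pochhammer (- real k) j * pochhammer (real k + C - 1) j
      / (pochhammer A j * fact j)"
proof (cases "j \<le> k")
  case True
  then show ?thesis
    by (simp add: jac_def coeff_sum coeff_monom sum.delta' if_distrib cong: if_cong)
next
  case False
  then have "pochhammer (- real k) j = 0"
    by (simp add: pochhammer_of_nat_eq_0_iff)
  with False show ?thesis
    by (auto simp add: jac_def coeff_sum coeff_monom intro!: sum.neutral)
qed

lemma coeff_jac_Suc:
  assumes "A > 0"
  shows "(real j + 1) * (A + real j) * coeff (jac A C k) (Suc j)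
     = (real j * (real j + C - 1) - jac_eigenvalue C k) * coeff (jac A C k) j"
proof -
  have "pochhammer A j > 0" "A + real j > 0" using assms by (auto intro: pochhammer_pos)
  then show ?thesis
    unfolding coeff_jac jac_eigenvalue_def pochhammer_Suc fact_Suc
    by (simp add: divide_simps) (simp add: algebra_simps)
qed

lemma degree_jac_le: "degree (jac A C k) \<le> k"
  by (rule degree_le) (auto simp: coeff_jac pochhammer_of_nat_eq_0_iff)

lemma jac_0 [simp]: "jac A C 0 = 1"
  by (simp add: jac_def monom_0)

lemma poly_jac_0 [simp]: "poly (jac A C k) 0 = 1"
  by (simp add: poly_0_coeff_0 coeff_jac)

text \<open>
Comparing coefficients, the hypergeometric equation is the recursion \<open>coeff_jac_Suc\<close>.
\<close>

lemma jac_ode: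
  assumes "A > 0"
  shows "pX * pderiv (pderiv (jac A C k)) + [:A, -C:] * pderiv (jac A C k)
     + smult (jac_eigenvalue C k) (jac A C k) = 0"
proof (rule poly_eqI)
  fix j
  let ?c = "coeff (jac A C k)"
  have rec: "(real j + 1) * (A + real j) * ?c (Suc j)
     = (real j * (real j + C - 1) - jac_eigenvalue C k) * ?c j"
    by (rule coeff_jac_Suc[OF assms])
  show "coeff (pX * pderiv (pderiv (jac A C k)) + [:A, -C:] * pderiv (jac A C k)
     + smult (jac_eigenvalue C k) (jac A C k)) j = coeff 0 j"
  proof (cases j)
    case 0
    then show ?thesis using rec by (simp add: coeff_pderiv)
  next
    case (Suc i)
    then show ?thesis using rec
      by (cases i) (simp_all add: coeff_pderiv coeff_pCons algebra_simps)
  qed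
qed

lemma pderiv_jac:
  assumes "A > 0"
  shows "pderiv (jac A C (Suc k))
    = smult (- jac_eigenvalue C (Suc k) / A) (jac (A + 1) (C + 2) k)"
proof (rule poly_eqI)
  fix j
  have p: "pochhammer (A + 1) j > 0" using assms by (auto intro: pochhammer_pos)
  have e1: "- real (Suc k) + 1 = - real k" by simp
  have e2: "real (Suc k) + C - 1 + 1 = real k + (C + 2) - 1" by simp
  have "coeff (pderiv (jac A C (Suc k))) j = (real j + 1) *
     (- real (Suc k) * pochhammer (- real k) j
      * ((real (Suc k) + C - 1) * pochhammer (real k + (C + 2) - 1) j)
      / (A * pochhammer (A + 1) j * ((real j + 1) * fact j)))"
    unfolding coeff_pderiv coeff_jac pochhammer_rec e1 e2 by (simp add: algebra_simps)
  also have "\<dots> = coeff (smult (- jac_eigenvalue C (Suc k) / A) (jac (A + 1) (C + 2) k)) j"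
    unfolding coeff_smult coeff_jac jac_eigenvalue_def using p assms
    by (simp add: divide_simps) (simp add: algebra_simps)
  finally show "coeff (pderiv (jac A C (Suc k))) j
    = coeff (smult (- jac_eigenvalue C (Suc k) / A) (jac (A + 1) (C + 2) k)) j" .
qed

text \<open>
Expectation under the Beta law with density proportional to \<open>u powr (A - 1) * (1 - u) powr (C - A - 1)\<close>,
described by its effect on polynomials. The last assumption is integration by parts: the derivative
of \<open>u * (1 - u)\<close> times the density is \<open>A - C * u\<close> times the density. The density itself never appears,
because for the laws below this formula is easier to reach than the density.
\<close>

locale jacobi_functional =
  fixes L :: "real poly \<Rightarrow> real" and A C :: real
  assumes A_pos: "0 < A" and A_less_C: "A < C" and C_ge_1: "1 \<le> C"
    and L_add: "L (p + q) = L p + L q"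
    and L_smult: "L (smult c p) = c * L p"
    and L_1: "L 1 = 1"
    and pearson: "L (pX * pderiv p + [:A, -C:] * p) = 0"
begin

lemma L_0 [simp]: "L 0 = 0"
  using L_smult[of 0 0] by simp

lemma L_minus: "L (- p) = - L p"
  using L_smult[of "-1" p] by simp

lemma L_diff: "L (p - q) = L p - L q"
  using L_add[of p "- q"] L_minus[of q] by simp

lemma L_sum: "L (sum f S) = (\<Sum>i\<in>S. L (f i))"
  by (induction S rule: infinite_finite_induct) (auto simp: L_add)

lemma L_linear_factor: "L [:0, 1:] = A / C"
proof -
  have "pX * pderiv 1 + [:A, -C:] * 1 = smult A 1 - smult C [:0, 1:]"
    by simp
  then have "A - C * L [:0, 1:] = 0"
    using pearson[of 1] L_diff L_smult L_1 by (metis mult.right_neutral)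
  then show ?thesis using A_pos A_less_C by (simp add: field_simps)
qed

lemma L_pX: "L pX = A * (C - A) / (C * (C + 1))"
proof -
  have e: "pX * pderiv [:0, 1:] + [:A, -C:] * [:0, 1:] = smult (C + 1) pX - smult (C - A) [:0, 1:]"
    by (simp add: pderiv_pCons algebra_simps)
  have "L (smult (C + 1) pX - smult (C - A) [:0, 1:]) = 0"
    using pearson[of "[:0, 1:]"] unfolding e .
  then have "(C + 1) * L pX - (C - A) * (A / C) = 0"
    by (simp only: L_diff L_smult L_linear_factor)
  then have "(C + 1) * L pX = A * (C - A) / C"
    by (simp add: mult.commute)
  then show ?thesis using A_pos A_less_C by (simp add: nonzero_eq_divide_eq mult_ac)
qed

lemma L_pX_pos: "L pX > 0"
  unfolding L_pX using A_pos A_less_C by simp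

text \<open>
The integration by parts formula applied to the product of \<open>pderiv p\<close> and \<open>q\<close>.
\<close>

lemma hypergeometric_operator_symmetric:
  "L ((pX * pderiv (pderiv p) + [:A, -C:] * pderiv p) * q) = - L (pX * pderiv p * pderiv q)"
proof -
  have "(pX * pderiv (pderiv p) + [:A, -C:] * pderiv p) * q
     = (pX * pderiv (pderiv p * q) + [:A, -C:] * (pderiv p * q)) - pX * pderiv p * pderiv q"
    by (simp only: pderiv_mult algebra_simps)
  then show ?thesis using pearson[of "pderiv p * q"] by (simp only: L_diff)
qed

lemma jac_weak_ode:
  "jac_eigenvalue C k * L (jac A C k * q) = L (pX * pderiv (jac A C k) * pderiv q)"
proof -
  have "pX * pderiv (pderiv (jac A C k)) + [:A, -C:] * pderiv (jac A C k)
     = smult (- jac_eigenvalue C k) (jac A C k)"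
    using jac_ode[OF A_pos, of C k] by (simp add: eq_neg_iff_add_eq_0)
  then show ?thesis using hypergeometric_operator_symmetric[of "jac A C k" q]
    by (simp add: L_smult L_minus)
qed

lemma jac_eigenvalue_strict_mono: "strict_mono (jac_eigenvalue C)"
proof (rule strict_monoI_Suc)
  fix n show "jac_eigenvalue C n < jac_eigenvalue C (Suc n)"
    using C_ge_1 by (simp add: jac_eigenvalue_def algebra_simps add_pos_nonneg)
qed

text \<open>
Eigenvectors of a symmetric operator for different eigenvalues.
\<close>

lemma jac_orthogonal:
  assumes "j \<noteq> k"
  shows "L (jac A C j * jac A C k) = 0"
proof -
  have "jac_eigenvalue C j * L (jac A C j * jac A C k) = L (pX * pderiv (jac A C j) * pderiv (jac A C k))"
    by (rule jac_weak_ode)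
  also have "\<dots> = L (pX * pderiv (jac A C k) * pderiv (jac A C j))"
    by (simp only: mult_ac)
  also have "\<dots> = jac_eigenvalue C k * L (jac A C j * jac A C k)"
    using jac_weak_ode[of k "jac A C j"] by (simp only: mult.commute[of "jac A C k"])
  finally show ?thesis
    using assms strict_mono_eq[OF jac_eigenvalue_strict_mono] by auto
qed

text \<open>
Multiplying the Beta density by \<open>u * (1 - u)\<close> raises both of its parameters by one. The derivatives
of the Jacobi polynomials are orthogonal for the new functional, by \<open>pderiv_jac\<close>.
\<close>

lemma weighted_functional:
  "jacobi_functional (\<lambda>p. L (pX * p) / L pX) (A + 1) (C + 2)"
proof
  show "0 < A + 1" "A + 1 < C + 2" "1 \<le> C + 2"
    using A_pos A_less_C C_ge_1 by auto
  show "L (pX * (p + q)) / L pX = L (pX * p) / L pX + L (pX * q) / L pX" for p q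
    by (simp only: ring_distribs L_add add_divide_distrib)
  show "L (pX * smult c p) / L pX = c * (L (pX * p) / L pX)" for c p
    by (simp only: mult_smult_right L_smult times_divide_eq_right)
  show "L (pX * 1) / L pX = 1"
    using L_pX_pos by simp
  show "L (pX * (pX * pderiv p + [:A + 1, - (C + 2):] * p)) / L pX = 0" for p
  proof -
    have d: "pderiv pX = [:1, -2:]" by (simp add: pderiv_pCons)
    have s: "[:A + 1, - (C + 2):] = [:1, -2:] + [:A, -C:]" by simp
    have "pX * (pX * pderiv p + [:A + 1, - (C + 2):] * p)
       = pX * pderiv (pX * p) + [:A, -C:] * (pX * p)"
      unfolding pderiv_mult d s by (simp only: algebra_simps)
    then show ?thesis using pearson[of "pX * p"] by simp
  qed
qed

end

text \<open>
The eigenvalue times the squared norm of a Jacobi polynomial is the norm of its derivative for the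
weighted functional, and this derivative is a multiple of a Jacobi polynomial of smaller degree. The
induction therefore has to run over all functionals at once.
\<close>

lemma (in jacobi_functional) L_jac_square: "L (jac A C k * jac A C k) = jac_norm A C k"
  using jacobi_functional_axioms
proof (induction k arbitrary: L A C)
  case 0
  then interpret jacobi_functional L A C by simp
  show ?case by (simp add: jac_norm_def L_1)
next
  case (Suc k)
  interpret jacobi_functional L A C by (rule Suc.prems)
  let ?l = "jac_eigenvalue C (Suc k)"
  have lam: "?l > 0" using C_ge_1 by (auto simp: jac_eigenvalue_def)
  have IH: "L (pX * (jac (A + 1) (C + 2) k * jac (A + 1) (C + 2) k)) / L pX
      = jac_norm (A + 1) (C + 2) k"
    by (rule Suc.IH[OF weighted_functional])
  have gen: "P * smult (- c / a) q * smult (- c / a) q = smult ((c / a)\<^sup>2) (P * (q * q))"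
    for P q :: "real poly" and c a
    by (simp add: power2_eq_square mult.assoc)
  have "?l * L (jac A C (Suc k) * jac A C (Suc k))
     = L (smult ((?l / A)\<^sup>2) (pX * (jac (A + 1) (C + 2) k * jac (A + 1) (C + 2) k)))"
    unfolding jac_weak_ode pderiv_jac[OF A_pos] by (simp only: gen)
  also have "\<dots> = (?l / A)\<^sup>2 * (L pX * jac_norm (A + 1) (C + 2) k)"
    using IH L_pX_pos by (simp only: L_smult) (simp add: field_simps)
  finally have "L (jac A C (Suc k) * jac A C (Suc k))
     = ?l / A\<^sup>2 * (A * (C - A) / (C * (C + 1)) * jac_norm (A + 1) (C + 2) k)"
    using lam unfolding L_pX power_divide power2_eq_square[of ?l]
    by (simp only: mult.assoc times_divide_eq_left mult_cancel_left times_divide_eq_right[symmetric]) simp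
  also have "\<dots> = jac_norm A C (Suc k)"
  proof -
    have c: "pochhammer C (2 * Suc k) = C * ((C + 1) * pochhammer (C + 2) (2 * k))"
      using pochhammer_rec[of C "Suc (2 * k)"] pochhammer_rec[of "C + 1" "2 * k"]
      by (simp add: add.commute)
    have a: "pochhammer A (Suc k) = A * pochhammer (A + 1) k"
      "pochhammer (C - A) (Suc k) = (C - A) * pochhammer (C + 2 - (A + 1)) k"
      by (simp_all add: pochhammer_rec algebra_simps)
    have l: "pochhammer (real (Suc k) + C - 1) (Suc k)
       = (real (Suc k) + C - 1) * pochhammer (real k + (C + 2) - 1) k"
      by (simp add: pochhammer_rec algebra_simps)
    have pos: "pochhammer (A + 1) k > 0" "pochhammer (C + 2) (2 * k) > 0" "C > 0" "A > 0"
      using A_pos A_less_C by (auto intro!: pochhammer_pos)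
    show ?thesis
      unfolding jac_norm_def a l c jac_eigenvalue_def fact_Suc using pos
      by (simp add: divide_simps power2_eq_square)
  qed
  finally show ?case .
qed

abbreviation pY :: "real poly" where "pY \<equiv> [:1, -1:]"

lemma jac_norm_pos:
  assumes "0 < A" "A < C" "1 \<le> C"
  shows "jac_norm A C k > 0"
proof (cases k)
  case (Suc i)
  have "real k + C - 1 > 0" using Suc assms by simp
  then show ?thesis using assms
    by (auto simp: jac_norm_def intro!: mult_pos_pos divide_pos_pos pochhammer_pos)
qed (simp add: jac_norm_def)

context jacobi_functional
begin

lemma jac_norm_pos': "jac_norm A C k > 0"
  using jac_norm_pos A_pos A_less_C C_ge_1 by auto

lemma lead_coeff_jac_pos: "(- 1) ^ k * coeff (jac A C k) k > 0"
proof (cases k)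
  case (Suc i)
  have "real k + C - 1 > 0" using Suc C_ge_1 by simp
  then have "pochhammer (real k + C - 1) k > 0" "pochhammer A k > 0"
    using A_pos by (auto intro: pochhammer_pos)
  moreover have "(-1) ^ k * ((-1) ^ k * (fact k :: real)) = fact k"
    by (simp add: mult.assoc[symmetric] power_mult_distrib[symmetric])
  ultimately show ?thesis
    by (simp add: coeff_jac pochhammer_same mult.assoc[symmetric] power_mult_distrib[symmetric])
qed simp

lemma jac_expansion_exists:
  assumes "degree p \<le> n"
  shows "\<exists>b. p = (\<Sum>j\<le>n. smult (b j) (jac A C j))"
  using assms
proof (induction n arbitrary: p)
  case 0
  then obtain c where "p = [:c:]" by (metis le_zero_eq degree_eq_zeroE)
  then show ?case by (intro exI[of _ "\<lambda>_. c"]) simp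
next
  case (Suc n)
  let ?r = "jac A C (Suc n)"
  define c where "c = coeff p (Suc n) / coeff ?r (Suc n)"
  have nz: "coeff ?r (Suc n) \<noteq> 0" using lead_coeff_jac_pos[of "Suc n"] by auto
  have "degree (p - smult c ?r) \<le> n"
  proof (rule degree_le, intro allI impI)
    fix i assume "n < i"
    show "coeff (p - smult c ?r) i = 0"
    proof (cases "i = Suc n")
      case True
      then show ?thesis using nz by (simp add: c_def)
    next
      case False
      with \<open>n < i\<close> have "Suc n < i" by simp
      then show ?thesis using Suc.prems degree_jac_le[of A C "Suc n"]
        by (simp add: coeff_eq_0)
    qed
  qed
  from Suc.IH[OF this] obtain b where b: "p - smult c ?r = (\<Sum>j\<le>n. smult (b j) (jac A C j))" by auto
  have "p = (\<Sum>j\<le>Suc n. smult ((b(Suc n := c)) j) (jac A C j))"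
    using b by (simp add: algebra_simps)
  then show ?case by blast
qed

text \<open>
The Jacobi polynomials have exact degrees, so they span; orthogonality identifies the coefficients.
\<close>

lemma jac_expansion:
  assumes "degree p \<le> n"
  shows "p = (\<Sum>j\<le>n. smult (L (p * jac A C j) / jac_norm A C j) (jac A C j))"
proof -
  obtain b where b: "p = (\<Sum>j\<le>n. smult (b j) (jac A C j))"
    using jac_expansion_exists[OF assms] by blast
  have "L (p * jac A C i) / jac_norm A C i = b i" if "i \<le> n" for i
  proof -
    have "L (p * jac A C i) = (\<Sum>j\<le>n. b j * L (jac A C j * jac A C i))"
      by (subst b) (simp add: sum_distrib_right L_sum L_smult)
    also have "\<dots> = (\<Sum>j\<le>n. if j = i then b j * jac_norm A C i else 0)"
      by (intro sum.cong) (auto simp: L_jac_square jac_orthogonal)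
    also have "\<dots> = b i * jac_norm A C i" using that by simp
    finally show ?thesis using jac_norm_pos'[of i] by simp
  qed
  then show ?thesis by (subst (1) b) (auto intro: sum.cong)
qed

lemma jac_orthogonal_lower_degree:
  assumes "degree p < k"
  shows "L (p * jac A C k) = 0"
proof -
  obtain n where k: "k = Suc n" using assms by (cases k) auto
  then have "degree p \<le> n" using assms by simp
  from jac_expansion[OF this]
  have "L (p * jac A C k) = L ((\<Sum>j\<le>n. smult (L (p * jac A C j) / jac_norm A C j) (jac A C j)) * jac A C k)"
    by simp
  also have "\<dots> = 0"
    using k by (auto simp: sum_distrib_right L_sum L_smult jac_orthogonal intro!: sum.neutral)
  finally show ?thesis .
qed

text \<open>
The hypergeometric operator maps \<open>(1 - u) ^ Suc j\<close> to a combination of itself and \<open>(1 - u) ^ j\<close>;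
symmetry moves the operator to the Jacobi polynomial, where it is a multiplication.
\<close>

lemma moment_recursion:
  "(jac_eigenvalue C (Suc j) - jac_eigenvalue C k) * L (pY ^ Suc j * jac A C k)
     = (real j + 1) * (real j + C - A) * L (pY ^ j * jac A C k)"
proof -
  let ?q = "pY ^ Suc j" and ?R = "jac A C k"
  have dY: "pderiv pY = [:-1:]" by (simp add: pderiv_pCons)
  have "pX * pderiv (pderiv ?q) + [:A, -C:] * pderiv ?q
      = smult ((real j + 1) * (real j + C - A)) (pY ^ j) - smult (jac_eigenvalue C (Suc j)) ?q"
  proof (cases j)
    case 0
    show ?thesis unfolding 0 by (simp add: pderiv_pCons jac_eigenvalue_def)
  next
    case (Suc i)
    have d0: "pderiv (pY ^ Suc n) = smult (- (real n + 1)) (pY ^ n)" for n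
      by (simp only: pderiv_power_Suc dY) (simp flip: smult_minus_left add: add.commute)
    have d1: "pderiv ?q = smult (- (real j + 1)) (pY ^ j)"
      by (rule d0)
    have d2: "pderiv (pderiv ?q) = smult ((real j + 1) * real j) (pY ^ i)"
      unfolding d1 pderiv_smult Suc d0 by (simp add: algebra_simps)
    show ?thesis unfolding d2 unfolding d1 unfolding Suc
    proof (rule poly_ext)
      fix x
      show "poly (pX * smult ((real (Suc i) + 1) * real (Suc i)) (pY ^ i)
              + [:A, - C:] * smult (- (real (Suc i) + 1)) (pY ^ Suc i)) x
          = poly (smult ((real (Suc i) + 1) * (real (Suc i) + C - A)) (pY ^ Suc i)
              - smult (jac_eigenvalue C (Suc (Suc i))) (pY ^ Suc (Suc i))) x"
        by (simp add: jac_eigenvalue_def algebra_simps)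
    qed
  qed
  then have "L ((smult ((real j + 1) * (real j + C - A)) (pY ^ j) - smult (jac_eigenvalue C (Suc j)) ?q) * ?R)
      = - L (pX * pderiv ?q * pderiv ?R)"
    using hypergeometric_operator_symmetric[of ?q ?R] by simp
  also have "L (pX * pderiv ?q * pderiv ?R) = jac_eigenvalue C k * L (?q * ?R)"
    using jac_weak_ode[of k ?q] by (simp only: mult_ac)
  finally show ?thesis
    by (simp only: left_diff_distrib L_diff L_smult mult_smult_left)
qed

text \<open>
Below the degree the moment vanishes by orthogonality, at the degree it has the sign of the leading
coefficient in powers of \<open>1 - u\<close>, and above it the recursion propagates the sign.
\<close>

lemma moment_jac_nonneg: "L (pY ^ j * jac A C k) \<ge> 0"
proof (induction j)
  case 0
  show ?case
    using jac_orthogonal[of 0 k] L_1 by (cases "k = 0") auto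
next
  case (Suc j)
  consider "Suc j < k" | "Suc j = k" | "k < Suc j" by linarith
  then show ?case
  proof cases
    case 1
    moreover have "degree (pY ^ Suc j) \<le> Suc j"
      using degree_power_le[of pY "Suc j"] by simp
    ultimately have "L (pY ^ Suc j * jac A C k) = 0"
      by (intro jac_orthogonal_lower_degree) linarith
    then show ?thesis by (simp only:)
  next
    case 2
    let ?R = "jac A C k"
    define c where "c = (- 1) ^ k * coeff ?R k"
    have cY: "coeff (pY ^ k) k = (- 1) ^ k"
    proof -
      have "degree (pY ^ k) = k" by (simp add: degree_power_eq)
      then show ?thesis using lead_coeff_power[of pY k] by simp
    qed
    have "degree (?R - smult c (pY ^ k)) < k"
    proof (rule degree_lessI)
      show "?R - smult c (pY ^ k) \<noteq> 0 \<or> 0 < k" using 2 by simp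
      show "\<forall>i\<ge>k. coeff (?R - smult c (pY ^ k)) i = 0"
      proof (intro allI impI)
        fix i assume "k \<le> i"
        show "coeff (?R - smult c (pY ^ k)) i = 0"
        proof (cases "i = k")
          case True
          then show ?thesis using cY
            by (simp add: c_def mult.assoc[symmetric] power_mult_distrib[symmetric] mult.commute)
        next
          case False
          with \<open>k \<le> i\<close> have "k < i" by simp
          then show ?thesis using degree_jac_le[of A C k] degree_power_le[of pY k]
            by (simp add: coeff_eq_0)
        qed
      qed
    qed
    from jac_orthogonal_lower_degree[OF this]
    have "jac_norm A C k = c * L (pY ^ k * ?R)"
      by (simp only: left_diff_distrib L_diff L_smult mult_smult_left L_jac_square)
    moreover have "c > 0" unfolding c_def by (rule lead_coeff_jac_pos)
    ultimately show ?thesis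
      using jac_norm_pos'[of k] 2 by (metis less_eq_real_def zero_less_mult_pos)
  next
    case 3
    then have "jac_eigenvalue C (Suc j) - jac_eigenvalue C k > 0"
      using strict_monoD[OF jac_eigenvalue_strict_mono] by simp
    moreover have "(jac_eigenvalue C (Suc j) - jac_eigenvalue C k) * L (pY ^ Suc j * jac A C k) \<ge> 0"
      unfolding moment_recursion using Suc A_less_C by (intro mult_nonneg_nonneg) auto
    ultimately show ?thesis by (simp only: zero_le_mult_iff) auto
  qed
qed

lemma moment_Suc: "L (pY ^ Suc j) = (real j + C - A) / (real j + C) * L (pY ^ j)"
proof -
  have "(real j + 1) * (real j + C) * L (pY ^ Suc j) = (real j + 1) * (real j + C - A) * L (pY ^ j)"
    using moment_recursion[of j 0] by (simp add: jac_eigenvalue_def mult.assoc add_ac del: power_Suc)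
  then have "(real j + C) * L (pY ^ Suc j) = (real j + C - A) * L (pY ^ j)"
    unfolding mult.assoc by (simp del: power_Suc)
  then show ?thesis using A_pos A_less_C by (simp add: divide_simps mult.commute del: power_Suc)
qed

lemma moment_pos: "L (pY ^ j) > 0"
proof (induction j)
  case (Suc j)
  then show ?case unfolding moment_Suc using A_pos A_less_C by simp
qed (simp add: L_1)

lemma moment_concentration_pcompose:
  "(\<lambda>j. L (pY ^ j * pcompose q pY) / L (pY ^ j)) \<longlonglongrightarrow> poly q 1"
proof (induction q)
  case 0
  then show ?case by simp
next
  case (pCons a q)
  have ratio: "(\<lambda>j. L (pY ^ Suc j) / L (pY ^ j)) \<longlonglongrightarrow> 1"
  proof -
    have "(\<lambda>j. (real j + C - A) / (real j + C)) \<longlonglongrightarrow> 1" by real_asymp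
    moreover have "L (pY ^ Suc j) / L (pY ^ j) = (real j + C - A) / (real j + C)" for j
      unfolding moment_Suc using moment_pos[of j] by simp
    ultimately show ?thesis by simp
  qed
  have split: "L (pY ^ j * pcompose (pCons a q) pY) / L (pY ^ j)
     = a + L (pY ^ Suc j * pcompose q pY) / L (pY ^ Suc j) * (L (pY ^ Suc j) / L (pY ^ j))" for j
  proof -
    have "pY ^ j * pcompose (pCons a q) pY = smult a (pY ^ j) + pY ^ Suc j * pcompose q pY"
      by (simp only: pcompose_pCons ring_distribs power_Suc mult_ac) simp
    then show ?thesis using moment_pos[of j] moment_pos[of "Suc j"]
      by (simp only: L_add L_smult add_divide_distrib) (simp del: power_Suc)
  qed
  have "(\<lambda>j. a + L (pY ^ Suc j * pcompose q pY) / L (pY ^ Suc j) * (L (pY ^ Suc j) / L (pY ^ j)))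
      \<longlonglongrightarrow> a + poly q 1 * 1"
    by (intro tendsto_intros ratio LIMSEQ_Suc[OF pCons.IH])
  then show ?case unfolding split by simp
qed

text \<open>
The probability densities proportional to \<open>(1 - u) ^ j\<close> concentrate at \<open>u = 0\<close>, because the ratio of
consecutive moments tends to 1.
\<close>

lemma moment_concentration: "(\<lambda>j. L (pY ^ j * p) / L (pY ^ j)) \<longlonglongrightarrow> poly p 0"
proof -
  have "pcompose (pcompose p pY) pY = p"
    by (rule poly_ext) (simp add: poly_pcompose)
  then show ?thesis using moment_concentration_pcompose[of "pcompose p pY"]
    by (simp add: poly_pcompose)
qed

end

text \<open>
By the Gauss product for the Gamma function, a ratio of Pochhammer symbols \<open>pochhammer a k\<close> and
\<open>pochhammer b k\<close> grows like \<open>k powr (a - b)\<close>. Up to a bounded factor \<open>jac_norm A C k\<close> is the product of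
\<open>pochhammer 1 k / pochhammer C k\<close> and \<open>pochhammer (C - A) k / pochhammer A k\<close>, with exponents \<open>1 - C\<close>
and \<open>C - 2 * A\<close>.
\<close>

lemma jac_norm_bound:
  assumes A: "0 < A" "A < C" "1 \<le> C" and m: "2 * real m \<le> 2 * A - 1"
  shows "\<exists>B. \<forall>k\<ge>1. real k ^ (2 * m) * jac_norm A C k \<le> B"
proof -
  \<comment> \<open>Gauss: \<open>G z k\<close> is \<open>k powr z * fact k / pochhammer z (k + 1)\<close> and tends to \<open>Gamma z\<close>.\<close>
  define G where "G z k = Gamma_series z k" for z :: real and k
  define H where "H k = G A k * G C k / G (C - A) k * ((A + k) * (C + k) / ((C - A + k) * k))" for k :: nat
  have "H \<longlonglongrightarrow> Gamma A * Gamma C / Gamma (C - A) * 1"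
    unfolding H_def G_def
  proof (intro tendsto_intros)
    show "Gamma (C - A) \<noteq> 0"
      using A by (metis diff_gt_0_iff_gt order_less_irrefl Gamma_real_pos)
    show "(\<lambda>k. (A + real k) * (C + real k) / ((C - A + real k) * real k)) \<longlonglongrightarrow> 1"
      by real_asymp
  qed
  then have "Bseq H" by (rule convergent_imp_Bseq[OF convergentI])
  then obtain B where B: "\<And>k. norm (H k) \<le> B" by (auto simp: Bseq_def)
  have "real k ^ (2 * m) * jac_norm A C k \<le> B" if k: "k \<ge> 1" for k
  proof -
    define K where "K = real k"
    have K: "K \<ge> 1" using k by (simp add: K_def)
    define a b c f where "a = pochhammer A k" and "b = pochhammer (C - A) k"
      and "c = pochhammer C k" and "f = (fact k :: real)"
    have pos: "a > 0" "b > 0" "c > 0" "f > 0"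
      unfolding a_def b_def c_def f_def using A by (auto intro: pochhammer_pos)
    have e: "exp (z * ln K) = K powr z" for z using K by (simp add: powr_def)
    have GA: "G A k = K powr A * f / (a * (A + K))" "G C k = K powr C * f / (c * (C + K))"
      "G (C - A) k = K powr (C - A) * f / (b * (C - A + K))"
      unfolding G_def Gamma_series_def a_def b_def c_def f_def
      using e by (simp_all add: pochhammer_Suc K_def mult_ac)
    have "K powr A * K powr C = K powr (C - A) * (K powr (2 * A - 1) * K)"
    proof -
      have "K powr (C - A) * (K powr (2 * A - 1) * K powr 1) = K powr A * K powr C"
        by (simp only: powr_add[symmetric]) simp
      then show ?thesis using K by simp
    qed
    moreover have "K powr (C - A) > 0" using K by simp
    ultimately have H: "H k = K powr (2 * A - 1) * (f * b / (a * c))"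
      unfolding H_def GA K_def[symmetric] using pos K A
      by (simp add: divide_simps)
    have poch2: "pochhammer C (2 * k) * (K + C - 1) = c * pochhammer (K + C - 1) k * (2 * K + C - 1)"
    proof -
      have "pochhammer C (2 * k) = c * pochhammer (C + K) k"
        unfolding c_def K_def by (metis mult_2 pochhammer_product')
      moreover have "(K + C - 1) * pochhammer (C + K) k = pochhammer (K + C - 1) k * (2 * K + C - 1)"
      proof -
        have "pochhammer (K + C - 1) (Suc k) = (K + C - 1) * pochhammer (C + K) k"
          by (simp add: pochhammer_rec algebra_simps)
        moreover have "pochhammer (K + C - 1) (Suc k) = pochhammer (K + C - 1) k * (2 * K + C - 1)"
          by (simp add: pochhammer_Suc K_def algebra_simps)
        ultimately show ?thesis by simp
      qed
      ultimately show ?thesis by (simp add: mult_ac)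
    qed
    have p2: "pochhammer C (2 * k) > 0" using A by (auto intro: pochhammer_pos)
    have "jac_norm A C k = f * b / (a * c) * ((K + C - 1) / (2 * K + C - 1))"
    proof -
      have nn: "2 * K + C - 1 > 0" "K + C - 1 > 0" using K A by linarith+
      have "pochhammer (K + C - 1) k / pochhammer C (2 * k) = (K + C - 1) / (c * (2 * K + C - 1))"
        using poch2 nn p2 pos by (simp add: divide_simps) (simp add: mult_ac)
      then have "f * b / a * (pochhammer (K + C - 1) k / pochhammer C (2 * k))
        = f * b / a * ((K + C - 1) / (c * (2 * K + C - 1)))" by simp
      then show ?thesis
        unfolding jac_norm_def a_def[symmetric] b_def[symmetric] f_def[symmetric] K_def[symmetric]
        by (simp add: mult_ac)
    qed
    also have "\<dots> \<le> f * b / (a * c) * 1"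
      using pos K A by (intro mult_left_mono) auto
    finally have jn: "jac_norm A C k \<le> f * b / (a * c)" by simp
    have "real k ^ (2 * m) * jac_norm A C k \<le> K powr (2 * A - 1) * (f * b / (a * c))"
    proof (rule mult_mono)
      have "real k ^ (2 * m) = K powr (2 * real m)"
        using K by (simp add: K_def powr_realpow[symmetric])
      also have "\<dots> \<le> K powr (2 * A - 1)"
        using K m by (intro powr_mono) auto
      finally show "real k ^ (2 * m) \<le> K powr (2 * A - 1)" .
    qed (use jn jac_norm_pos[OF A, of k] in auto)
    also have "\<dots> = H k" using H by simp
    also have "\<dots> \<le> B" using B[of k] by simp
    finally show ?thesis .
  qed
  then show ?thesis by blast
qed

section \<open>Jacobi series with nonnegative coefficients\<close>

lemma class_C_from_derivatives:
  assumes "open S"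
    and D: "\<And>i t. i < m \<Longrightarrow> t \<in> S \<Longrightarrow> (D i has_real_derivative D (Suc i) t) (at t)"
    and D0: "\<And>t. t \<in> S \<Longrightarrow> f t = D 0 t"
    and cont: "continuous_on S (D m)"
  shows "class_C m f S"
proof -
  have eq: "j \<le> m \<Longrightarrow> t \<in> S \<Longrightarrow> (deriv ^^ j) f t = D j t" for j t
  proof (induction j arbitrary: t)
    case 0
    then show ?case using D0 by simp
  next
    case (Suc j)
    have "((deriv ^^ j) f has_real_derivative D (Suc j) t) (at t)"
      by (rule has_field_derivative_transform_within_open[OF D[of j t] \<open>open S\<close>])
        (use Suc in auto)
    then show ?case by (simp add: DERIV_imp_deriv)
  qed
  have "(deriv ^^ j) f differentiable (at t)" if "j < m" "t \<in> S" for j t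
  proof -
    have "((deriv ^^ j) f has_real_derivative D (Suc j) t) (at t)"
      by (rule has_field_derivative_transform_within_open[OF D[of j t] \<open>open S\<close>])
        (use that eq in auto)
    then show ?thesis using real_differentiable_def by blast
  qed
  moreover have "continuous_on S ((deriv ^^ m) f)"
    using cont eq[of m] by (simp cong: continuous_on_cong)
  ultimately show ?thesis by (auto simp: class_C_def)
qed

text \<open>
The functions \<open>E t * exp (K * t)\<close> and \<open>E t * exp (- K * t)\<close> are monotone.
\<close>

lemma compare_if_derivative_le:
  fixes E :: "real \<Rightarrow> real"
  assumes E: "\<And>t. (E has_real_derivative E' t) (at t)"
    and K: "\<And>t. a \<le> t \<Longrightarrow> t \<le> b \<Longrightarrow> \<bar>E' t\<bar> \<le> K * E t"
    and nonneg: "E v \<ge> 0" and "K \<ge> 0"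
    and u: "a \<le> u" "u \<le> b" and v: "a \<le> v" "v \<le> b"
  shows "E u \<le> exp (K * (b - a)) * E v"
proof -
  have "E u \<le> exp (K * \<bar>u - v\<bar>) * E v"
  proof (cases "u \<le> v")
    case True
    have "E u * exp (K * u) \<le> E v * exp (K * v)"
    proof (rule DERIV_nonneg_imp_nondecreasing[OF True])
      fix t assume t: "u \<le> t" "t \<le> v"
      have "((\<lambda>t. E t * exp (K * t)) has_real_derivative (E' t + K * E t) * exp (K * t)) (at t)"
        by (auto intro!: derivative_eq_intros E simp: algebra_simps)
      moreover have "E' t + K * E t \<ge> 0" using K[of t] t u v by (simp add: abs_le_iff)
      ultimately show "\<exists>y. ((\<lambda>t. E t * exp (K * t)) has_real_derivative y) (at t) \<and> 0 \<le> y"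
        by (intro exI[of _ "(E' t + K * E t) * exp (K * t)"]) auto
    qed
    then have "E u * exp (K * u) * exp (- (K * u)) \<le> E v * exp (K * v) * exp (- (K * u))"
      by (rule mult_right_mono) simp
    then show ?thesis using True by (simp add: mult.assoc exp_add[symmetric] algebra_simps)
  next
    case False
    then have "v \<le> u" by simp
    have "E v * exp (- (K * v)) \<ge> E u * exp (- (K * u))"
    proof (rule DERIV_nonpos_imp_nonincreasing[OF \<open>v \<le> u\<close>])
      fix t assume t: "v \<le> t" "t \<le> u"
      have "((\<lambda>t. E t * exp (- (K * t))) has_real_derivative (E' t - K * E t) * exp (- (K * t))) (at t)"
        by (auto intro!: derivative_eq_intros E simp: algebra_simps)
      moreover have "E' t - K * E t \<le> 0" using K[of t] t u v by (simp add: abs_le_iff)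
      ultimately show "\<exists>y. ((\<lambda>t. E t * exp (- (K * t))) has_real_derivative y) (at t) \<and> y \<le> 0"
        by (intro exI[of _ "(E' t - K * E t) * exp (- (K * t))"]) (auto intro: mult_nonpos_nonneg)
    qed
    then have "E u * exp (- (K * u)) * exp (K * u) \<le> E v * exp (- (K * v)) * exp (K * u)"
      by (rule mult_right_mono) simp
    then show ?thesis using \<open>v \<le> u\<close> by (simp add: mult.assoc exp_add[symmetric] algebra_simps)
  qed
  also have "\<dots> \<le> exp (K * (b - a)) * E v"
    using u v \<open>K \<ge> 0\<close> nonneg by (intro mult_right_mono) (auto intro!: mult_left_mono)
  finally show ?thesis .
qed

lemma bounded_on_unit_interval:
  fixes f :: "real \<Rightarrow> real"
  assumes "continuous_on UNIV f"
  shows "\<exists>B. \<forall>u\<in>{0..1}. norm (f u) \<le> B"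
proof -
  have "bounded (f ` {0..1})"
    by (intro compact_imp_bounded compact_continuous_image continuous_on_subset[OF assms]) auto
  then show ?thesis unfolding bounded_iff by blast
qed

text \<open>
Differentiating the hypergeometric equation raises \<open>A\<close> by 1 and \<open>C\<close> by 2 and lowers the eigenvalue.
\<close>

lemma jac_derivative_ode:
  assumes "A > 0"
  shows "pX * (pderiv ^^ (i + 2)) (jac A C k)
    + [:A + real i, - (C + 2 * real i):] * (pderiv ^^ (i + 1)) (jac A C k)
    + smult (jac_eigenvalue C k - real i * (C + real i - 1)) ((pderiv ^^ i) (jac A C k)) = 0"
proof (induction i)
  case 0
  then show ?case using jac_ode[OF assms, of C k] by (simp add: numeral_2_eq_2)
next
  case (Suc i)
  define y where "y = (pderiv ^^ i) (jac A C k)"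
  define l where "l = jac_eigenvalue C k - real i * (C + real i - 1)"
  have ode: "pX * pderiv (pderiv y) + [:A + real i, - (C + 2 * real i):] * pderiv y + smult l y = 0"
    using Suc by (simp add: y_def l_def numeral_2_eq_2)
  have "pderiv (pX * pderiv (pderiv y) + [:A + real i, - (C + 2 * real i):] * pderiv y + smult l y)
     = pX * pderiv (pderiv (pderiv y)) + [:A + real (Suc i), - (C + 2 * real (Suc i)):] * pderiv (pderiv y)
       + smult (l - (C + 2 * real i)) (pderiv y)"
    by (rule poly_ext) (simp add: pderiv_add pderiv_mult pderiv_pCons pderiv_smult pderiv_minus algebra_simps)
  moreover have "l - (C + 2 * real i) = jac_eigenvalue C k - real (Suc i) * (C + real (Suc i) - 1)"
    by (simp add: l_def algebra_simps)
  ultimately show ?case using ode by (simp add: y_def[symmetric] numeral_2_eq_2)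
qed

text \<open>
Laws on the unit interval whose expectation is a \<open>jacobi_functional\<close>. That open intervals have
positive measure serves to bound a function with slowly varying size by its mean, and to identify
continuous functions that agree in mean square.
\<close>

locale jacobi_measure = prob_space M for M :: "real measure" +
  fixes A C :: real
  assumes A_pos: "0 < A" and A_less_C: "A < C" and C_ge_1: "1 \<le> C"
    and sets_M [measurable_cong]: "sets M = sets borel"
    and AE_unit: "AE u in M. 0 \<le> u \<and> u \<le> 1"
    and pearson_integral:
      "\<And>p. (\<integral>u. poly (pX * pderiv p + [:A, -C:] * p) u \<partial>M) = 0"
    and interval_pos: "\<And>a b. 0 \<le> a \<Longrightarrow> a < b \<Longrightarrow> b \<le> 1 \<Longrightarrow> measure M {a<..<b} > 0"
begin

lemma integrable_continuous:
  fixes f :: "real \<Rightarrow> real"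
  assumes "continuous_on UNIV f"
  shows "integrable M f"
proof -
  have [measurable]: "f \<in> borel_measurable borel"
    by (rule borel_measurable_continuous_onI[OF assms])
  obtain B where "\<And>u. u \<in> {0..1} \<Longrightarrow> norm (f u) \<le> B"
    using bounded_on_unit_interval[OF assms] by blast
  then have "AE u in M. norm (f u) \<le> B" using AE_unit by auto
  then show ?thesis by (rule integrable_const_bound) measurable
qed

lemma integrable_poly: "integrable M (poly p)"
  by (intro integrable_continuous continuous_intros)

abbreviation L :: "real poly \<Rightarrow> real" where "L p \<equiv> \<integral>u. poly p u \<partial>M"

sublocale jacobi_functional L A C
proof
  show "L (p + q) = L p + L q" for p q
    by (simp add: integrable_poly)
  show "L 1 = 1" by (simp add: prob_space)
qed (use A_pos A_less_C C_ge_1 pearson_integral in auto)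

lemma integral_mono_unit:
  fixes f g :: "real \<Rightarrow> real"
  assumes "continuous_on UNIV f" "continuous_on UNIV g" "\<And>u. 0 \<le> u \<Longrightarrow> u \<le> 1 \<Longrightarrow> f u \<le> g u"
  shows "(\<integral>u. f u \<partial>M) \<le> (\<integral>u. g u \<partial>M)"
  using assms AE_unit by (intro integral_mono_AE integrable_continuous) auto

lemma integral_ge_on_interval:
  fixes f :: "real \<Rightarrow> real"
  assumes f: "continuous_on UNIV f" and nonneg: "\<And>u. 0 \<le> u \<Longrightarrow> u \<le> 1 \<Longrightarrow> 0 \<le> f u"
    and ge: "\<And>u. a < u \<Longrightarrow> u < b \<Longrightarrow> c \<le> f u"
  shows "c * measure M {a<..<b} \<le> (\<integral>u. f u \<partial>M)"
proof -
  have "c * measure M {a<..<b} = (\<integral>u. c * indicator {a<..<b} u \<partial>M)" by simp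
  also have "\<dots> \<le> (\<integral>u. f u \<partial>M)"
  proof (rule integral_mono_AE)
    show "integrable M (\<lambda>u. c * indicator {a<..<b} u)"
      by (intro integrable_mult_right) (simp add: integrable_indicator_iff emeasure_eq_measure)
    show "integrable M f" by (rule integrable_continuous[OF f])
    show "AE u in M. c * indicator {a<..<b} u \<le> f u"
      using AE_unit by eventually_elim (auto simp: nonneg ge indicator_def)
  qed
  finally show ?thesis .
qed

lemma jac_energy_integral:
  assumes "k \<ge> 1"
  shows "L (jac A C k * jac A C k
      + smult (1 / jac_eigenvalue C k) (pX * pderiv (jac A C k) * pderiv (jac A C k)))
    = 2 * jac_norm A C k"
proof -
  have "jac_eigenvalue C k > 0" using assms C_ge_1 by (auto simp: jac_eigenvalue_def)
  then show ?thesis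
    by (simp only: L_add L_smult jac_weak_ode[symmetric] L_jac_square) simp
qed

text \<open>
For a solution \<open>R\<close> of the hypergeometric equation with eigenvalue \<open>l\<close> the energy
\<open>R\<^sup>2 + u * (1 - u) * R'\<^sup>2 / l\<close> has a derivative that contains \<open>R'\<^sup>2 / l\<close> only, since the second
derivative is eliminated by the equation. On a compact part of the open interval the energy therefore
varies by a bounded factor, uniformly in \<open>l\<close>, and its value anywhere is bounded by its mean, which is
twice the squared norm of \<open>R\<close>.
\<close>

lemma jac_energy_bound:
  assumes ab: "0 < a" "a < b" "b < 1"
  shows "\<exists>G\<ge>0. \<forall>k\<ge>1. \<forall>v\<in>{a..b}.
    (poly (jac A C k) v)\<^sup>2 + v * (1 - v) * (poly (pderiv (jac A C k)) v)\<^sup>2 / jac_eigenvalue C k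
     \<le> G * jac_norm A C k"
proof -
  define K where "K = (3 + 2 * A + 2 * C) / (a * (1 - b))"
  \<comment> \<open>The energy varies by a factor of at most \<open>exp (K * (b - a))\<close> on \<open>{a..b}\<close>, and its mean is twice the squared norm.\<close>
  define G where "G = 2 * exp (K * (b - a)) / measure M {a<..<b}"
  have mpos: "measure M {a<..<b} > 0" using ab by (intro interval_pos) auto
  have K0: "K \<ge> 0" using ab A_pos A_less_C by (simp add: K_def)
  have "(poly (jac A C k) v)\<^sup>2 + v * (1 - v) * (poly (pderiv (jac A C k)) v)\<^sup>2 / jac_eigenvalue C k
     \<le> G * jac_norm A C k" if k: "k \<ge> 1" and v: "v \<in> {a..b}" for k v
  proof -
    define R where "R = jac A C k"
    define l where "l = jac_eigenvalue C k"
    define E where "E u = (poly R u)\<^sup>2 + u * (1 - u) * (poly (pderiv R) u)\<^sup>2 / l" for u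
    define E' where "E' u = ((1 - 2 * u) - 2 * (A - C * u)) * (poly (pderiv R) u)\<^sup>2 / l" for u
    have l: "l > 0" using k C_ge_1 by (auto simp: jac_eigenvalue_def l_def)
    have ode: "u * (1 - u) * poly (pderiv (pderiv R)) u
        = - (A - C * u) * poly (pderiv R) u - l * poly R u" for u
    proof -
      have "poly (pX * pderiv (pderiv R) + [:A, -C:] * pderiv R + smult l R) u = 0"
        using jac_ode[OF A_pos, of C k] by (simp add: R_def l_def)
      then show ?thesis by (simp add: algebra_simps)
    qed
    have dE: "(E has_real_derivative E' u) (at u)" for u
    proof -
      have "(E has_real_derivative
          2 * poly R u * poly (pderiv R) u + ((1 - 2 * u) * (poly (pderiv R) u)\<^sup>2
            + 2 * poly (pderiv R) u * (u * (1 - u) * poly (pderiv (pderiv R)) u)) / l) (at u)"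
        unfolding E_def using l
        by (auto intro!: derivative_eq_intros simp: field_simps power2_eq_square)
      also have "2 * poly R u * poly (pderiv R) u + ((1 - 2 * u) * (poly (pderiv R) u)\<^sup>2
            + 2 * poly (pderiv R) u * (u * (1 - u) * poly (pderiv (pderiv R)) u)) / l = E' u"
        unfolding ode E'_def using l by (simp add: field_simps power2_eq_square)
      finally show ?thesis .
    qed
    have bound: "\<bar>E' u\<bar> \<le> K * E u" if u: "a \<le> u" "u \<le> b" for u
    proof -
      have w: "a * (1 - b) \<le> u * (1 - u)" using u ab by (intro mult_mono) auto
      have cu: "0 \<le> C * u" "C * u \<le> C"
        using u ab A_pos A_less_C mult_left_mono[of u 1 C] by auto
      have "\<bar>(1 - 2 * u) - 2 * (A - C * u)\<bar> \<le> 3 + 2 * A + 2 * C"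
        using u ab A_pos cu by (auto simp: abs_le_iff)
      also have "\<dots> = K * (a * (1 - b))" using ab by (simp add: K_def)
      also have "\<dots> \<le> K * (u * (1 - u))" using w K0 by (intro mult_left_mono)
      finally have "\<bar>(1 - 2 * u) - 2 * (A - C * u)\<bar> * ((poly (pderiv R) u)\<^sup>2 / l)
          \<le> K * (u * (1 - u)) * ((poly (pderiv R) u)\<^sup>2 / l)"
        using l by (intro mult_right_mono) auto
      then have "\<bar>E' u\<bar> \<le> K * (u * (1 - u) * (poly (pderiv R) u)\<^sup>2 / l)"
        using l by (simp add: E'_def abs_mult mult.assoc)
      also have "\<dots> \<le> K * E u" using K0 by (intro mult_left_mono) (auto simp: E_def)
      finally show ?thesis .
    qed
    have E0: "E u \<ge> 0" if "0 \<le> u" "u \<le> 1" for u using that l by (simp add: E_def)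
    have "E v * exp (- (K * (b - a))) * measure M {a<..<b} \<le> (\<integral>u. E u \<partial>M)"
    proof (rule integral_ge_on_interval)
      show "continuous_on UNIV E" unfolding E_def using l by (intro continuous_intros) auto
      show "E v * exp (- (K * (b - a))) \<le> E u" if "a < u" "u < b" for u
      proof -
        have "E v \<le> exp (K * (b - a)) * E u"
          by (rule compare_if_derivative_le[OF dE bound])
             (use that v ab K0 E0[of u] in auto)
        then have "E v * exp (- (K * (b - a))) \<le> exp (K * (b - a)) * E u * exp (- (K * (b - a)))"
          by (rule mult_right_mono) simp
        moreover have "exp (K * (b - a)) * exp (- (K * (b - a))) = 1"
          by (simp add: exp_add[symmetric])
        ultimately show ?thesis by (simp add: mult.assoc mult.left_commute)
      qed
    qed (use E0 in auto)
    also have "(\<integral>u. E u \<partial>M) = L (R * R + smult (1 / l) (pX * pderiv R * pderiv R))"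
      unfolding E_def by (intro Bochner_Integration.integral_cong)
        (auto simp: power2_eq_square algebra_simps diff_divide_distrib)
    also have "\<dots> = 2 * jac_norm A C k"
      unfolding R_def l_def by (rule jac_energy_integral[OF k])
    finally have le: "E v * exp (- (K * (b - a))) * measure M {a<..<b} \<le> 2 * jac_norm A C k" .
    have "E v * measure M {a<..<b} = E v * exp (- (K * (b - a))) * measure M {a<..<b} * exp (K * (b - a))"
      by (simp add: exp_minus)
    also have "\<dots> \<le> 2 * jac_norm A C k * exp (K * (b - a))"
      using le by (rule mult_right_mono) simp
    finally have "E v \<le> G * jac_norm A C k"
      using mpos by (simp add: G_def pos_le_divide_eq mult_ac)
    then show ?thesis by (simp add: E_def R_def l_def)
  qed
  moreover have "G \<ge> 0" by (simp add: G_def)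
  ultimately show ?thesis by blast
qed

lemma jac_eigenvalue_le: "k \<ge> 1 \<Longrightarrow> jac_eigenvalue C k \<le> C * (real k)\<^sup>2"
proof -
  assume k: "k \<ge> 1"
  have "(real k - 1) * (C - 1) \<ge> 0" using k C_ge_1 by simp
  then have "real k + C - 1 \<le> C * real k" by (simp add: algebra_simps)
  then have "real k * (real k + C - 1) \<le> real k * (C * real k)"
    by (intro mult_left_mono) auto
  then show ?thesis by (simp add: jac_eigenvalue_def power2_eq_square mult_ac)
qed

text \<open>
The energy bound gives the orders 0 and 1, as the eigenvalue is \<open>O(k\<^sup>2)\<close>. The differential equation
expresses each further derivative through the two preceding ones, at the cost of a factor \<open>k\<^sup>2\<close> for
the lower one.
\<close>

lemma jac_derivative_bound:
  assumes ab: "0 < a" "a < b" "b < 1"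
  shows "\<exists>G. \<forall>k\<ge>1. \<forall>v\<in>{a..b}.
    \<bar>poly ((pderiv ^^ i) (jac A C k)) v\<bar> \<le> G * real k ^ i * sqrt (jac_norm A C k)"
proof (induction i rule: less_induct)
  case (less i)
  obtain G where G0: "G \<ge> 0" and G: "\<And>k v. k \<ge> 1 \<Longrightarrow> v \<in> {a..b} \<Longrightarrow>
    (poly (jac A C k) v)\<^sup>2 + v * (1 - v) * (poly (pderiv (jac A C k)) v)\<^sup>2 / jac_eigenvalue C k
     \<le> G * jac_norm A C k"
    using jac_energy_bound[OF ab] by blast
  have w: "a * (1 - b) \<le> v * (1 - v)" if "v \<in> {a..b}" for v
    using that ab by (intro mult_mono) auto
  have w0: "a * (1 - b) > 0" using ab by simp
  consider "i = 0" | "i = 1" | j where "i = j + 2"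
    by (metis One_nat_def add_2_eq_Suc' not0_implies_Suc)
  then show ?case
  proof cases
    case 1
    have "\<bar>poly ((pderiv ^^ i) (jac A C k)) v\<bar> \<le> sqrt G * real k ^ i * sqrt (jac_norm A C k)"
      if k: "k \<ge> 1" and v: "v \<in> {a..b}" for k v
    proof -
      have "v * (1 - v) * (poly (pderiv (jac A C k)) v)\<^sup>2 / jac_eigenvalue C k \<ge> 0"
        using v ab C_ge_1 by (auto simp: jac_eigenvalue_def intro!: divide_nonneg_nonneg mult_nonneg_nonneg)
      then have "(poly (jac A C k) v)\<^sup>2 \<le> G * jac_norm A C k" using G[OF k v] by linarith
      then have "\<bar>poly (jac A C k) v\<bar> \<le> sqrt (G * jac_norm A C k)"
        by (simp only: real_sqrt_le_iff flip: real_sqrt_abs)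
      then show ?thesis by (simp add: 1 real_sqrt_mult)
    qed
    then show ?thesis by blast
  next
    case 2
    define H where "H = sqrt (G * C / (a * (1 - b)))"
    have "\<bar>poly ((pderiv ^^ i) (jac A C k)) v\<bar> \<le> H * real k ^ i * sqrt (jac_norm A C k)"
      if k: "k \<ge> 1" and v: "v \<in> {a..b}" for k v
    proof -
      have l: "jac_eigenvalue C k > 0" using k C_ge_1 by (auto simp: jac_eigenvalue_def)
      have "v * (1 - v) * (poly (pderiv (jac A C k)) v)\<^sup>2 / jac_eigenvalue C k \<le> G * jac_norm A C k"
        using G[OF k v] zero_le_power2[of "poly (jac A C k) v"] by linarith
      then have "v * (1 - v) * (poly (pderiv (jac A C k)) v)\<^sup>2 \<le> G * jac_norm A C k * jac_eigenvalue C k"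
        using l by (simp add: pos_divide_le_eq)
      moreover have "a * (1 - b) * (poly (pderiv (jac A C k)) v)\<^sup>2 \<le> v * (1 - v) * (poly (pderiv (jac A C k)) v)\<^sup>2"
        using w[OF v] by (intro mult_right_mono) auto
      moreover have "G * jac_norm A C k * jac_eigenvalue C k \<le> G * jac_norm A C k * (C * (real k)\<^sup>2)"
        using jac_eigenvalue_le[OF k] G0 jac_norm_pos'[of k] by (intro mult_left_mono) auto
      ultimately have "a * (1 - b) * (poly (pderiv (jac A C k)) v)\<^sup>2 \<le> G * jac_norm A C k * (C * (real k)\<^sup>2)"
        by linarith
      then have "(poly (pderiv (jac A C k)) v)\<^sup>2 \<le> G * C / (a * (1 - b)) * (real k)\<^sup>2 * jac_norm A C k"
        using w0 by (simp add: pos_le_divide_eq mult_ac)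
      then have "\<bar>poly (pderiv (jac A C k)) v\<bar> \<le> sqrt (G * C / (a * (1 - b)) * (real k)\<^sup>2 * jac_norm A C k)"
        by (simp only: real_sqrt_le_iff flip: real_sqrt_abs)
      then show ?thesis by (simp only: 2 H_def real_sqrt_mult) simp
    qed
    then show ?thesis by blast
  next
    case (3 j)
    obtain G0 where G0: "\<And>k v. k \<ge> 1 \<Longrightarrow> v \<in> {a..b} \<Longrightarrow>
       \<bar>poly ((pderiv ^^ j) (jac A C k)) v\<bar> \<le> G0 * real k ^ j * sqrt (jac_norm A C k)"
      using less[of j] 3 by (metis less_add_same_cancel1 zero_less_numeral)
    obtain G1 where G1: "\<And>k v. k \<ge> 1 \<Longrightarrow> v \<in> {a..b} \<Longrightarrow>
       \<bar>poly ((pderiv ^^ (j + 1)) (jac A C k)) v\<bar> \<le> G1 * real k ^ (j + 1) * sqrt (jac_norm A C k)"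
      using less[of "j + 1"] 3 by (metis add_less_cancel_left one_less_numeral_iff semiring_norm(76))
    \<comment> \<open>Bounds for the coefficients of the two lower derivatives in \<open>jac_derivative_ode\<close>; \<open>c0\<close> is to be multiplied by \<open>k\<^sup>2\<close>.\<close>
    define c0 where "c0 = C + real j * (C + real j)"
    define c1 where "c1 = A + C + 3 * real j"
    have c: "c0 \<ge> 0" "c1 \<ge> 0" using A_pos C_ge_1 by (auto simp: c0_def c1_def)
    define H where "H = (c1 * \<bar>G1\<bar> + c0 * \<bar>G0\<bar>) / (a * (1 - b))"
    have "\<bar>poly ((pderiv ^^ i) (jac A C k)) v\<bar> \<le> H * real k ^ i * sqrt (jac_norm A C k)"
      if k: "k \<ge> 1" and v: "v \<in> {a..b}" for k v
    proof -
      define y0 where "y0 = poly ((pderiv ^^ j) (jac A C k)) v"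
      define y1 where "y1 = poly ((pderiv ^^ (j + 1)) (jac A C k)) v"
      define y2 where "y2 = poly ((pderiv ^^ (j + 2)) (jac A C k)) v"
      define s where "s = sqrt (jac_norm A C k)"
      define l where "l = jac_eigenvalue C k - real j * (C + real j - 1)"
      have s: "s > 0" using jac_norm_pos'[of k] by (simp add: s_def)
      have "poly (pX * (pderiv ^^ (j + 2)) (jac A C k)
         + [:A + real j, - (C + 2 * real j):] * (pderiv ^^ (j + 1)) (jac A C k)
         + smult l ((pderiv ^^ j) (jac A C k))) v = 0"
        unfolding l_def using jac_derivative_ode[OF A_pos, of j C k] by simp
      then have "v * (1 - v) * y2 = - (A + real j - (C + 2 * real j) * v) * y1 - l * y0"
        unfolding y0_def[symmetric] y1_def[symmetric] y2_def[symmetric] poly_add poly_mult poly_smult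
        by (simp add: algebra_simps)
      then have eq: "v * (1 - v) * \<bar>y2\<bar> = \<bar>(A + real j - (C + 2 * real j) * v) * y1 + l * y0\<bar>"
      proof -
        have "v * (1 - v) * \<bar>y2\<bar> = \<bar>v * (1 - v) * y2\<bar>" using v ab by (simp add: abs_mult)
        also have "\<dots> = \<bar>- ((A + real j - (C + 2 * real j) * v) * y1 + l * y0)\<bar>"
          unfolding \<open>v * (1 - v) * y2 = _\<close> by (simp add: algebra_simps)
        finally show ?thesis by (simp only: abs_minus_cancel)
      qed
      have kj: "real k ^ (j + 1) \<le> real k ^ i" "(real k)\<^sup>2 * real k ^ j = real k ^ i"
        using k by (rule_tac power_increasing) (auto simp: 3 power_add power2_eq_square)
      have "v * C \<le> C" "v * real j \<le> real j" "0 \<le> v * C" "0 \<le> v * real j"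
        using v ab C_ge_1 by (auto intro: mult_left_le_one_le)
      moreover have "A + real j - (C + 2 * real j) * v = A + real j - v * C - 2 * (v * real j)"
        by (simp add: algebra_simps)
      ultimately have "\<bar>A + real j - (C + 2 * real j) * v\<bar> \<le> c1"
        using A_pos C_ge_1 unfolding c1_def abs_le_iff by linarith
      then have t1: "\<bar>(A + real j - (C + 2 * real j) * v) * y1\<bar> \<le> c1 * (\<bar>G1\<bar> * real k ^ i * s)"
      proof -
        have "\<bar>y1\<bar> \<le> G1 * real k ^ (j + 1) * s" using G1[OF k v] by (simp add: y1_def s_def)
        also have "\<dots> \<le> \<bar>G1\<bar> * real k ^ i * s" using kj s by (intro mult_right_mono mult_mono) auto
        finally show ?thesis using \<open>\<bar>A + real j - (C + 2 * real j) * v\<bar> \<le> c1\<close> c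
          unfolding abs_mult by (intro mult_mono) auto
      qed
      have "\<bar>l\<bar> \<le> c0 * (real k)\<^sup>2"
      proof -
        have "real j * (C + real j) \<ge> 0" using C_ge_1 by simp
        then have q: "real j * (C + real j) * 1 \<le> real j * (C + real j) * (real k)\<^sup>2"
          using k by (intro mult_left_mono) auto
        have "jac_eigenvalue C k \<ge> 0" using C_ge_1 by (simp add: jac_eigenvalue_def)
        moreover have "0 \<le> real j * (C + real j - 1)" "real j * (C + real j - 1) \<le> real j * (C + real j)"
          using C_ge_1 by (auto intro!: mult_left_mono mult_nonneg_nonneg)
        moreover have "0 \<le> C * (real k)\<^sup>2" using C_ge_1 by simp
        ultimately show ?thesis using jac_eigenvalue_le[OF k] q
          unfolding l_def c0_def abs_le_iff by (simp add: ring_distribs)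
      qed
      then have t0: "\<bar>l * y0\<bar> \<le> c0 * (\<bar>G0\<bar> * real k ^ i * s)"
      proof -
        have "\<bar>y0\<bar> \<le> G0 * real k ^ j * s" using G0[OF k v] by (simp add: y0_def s_def)
        also have "\<dots> \<le> \<bar>G0\<bar> * real k ^ j * s" using s by (intro mult_right_mono) auto
        finally have "\<bar>l\<bar> * \<bar>y0\<bar> \<le> (c0 * (real k)\<^sup>2) * (\<bar>G0\<bar> * real k ^ j * s)"
          using \<open>\<bar>l\<bar> \<le> c0 * (real k)\<^sup>2\<close> c by (intro mult_mono) auto
        then show ?thesis unfolding abs_mult kj(2)[symmetric] by (simp add: mult_ac)
      qed
      have "a * (1 - b) * \<bar>y2\<bar> \<le> v * (1 - v) * \<bar>y2\<bar>" using w[OF v] by (intro mult_right_mono) auto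
      also have "\<dots> \<le> (c1 * \<bar>G1\<bar> + c0 * \<bar>G0\<bar>) * (real k ^ i * s)"
        unfolding eq using t0 t1 abs_triangle_ineq[of "(A + real j - (C + 2 * real j) * v) * y1" "l * y0"]
        by (simp add: algebra_simps)
      finally have "\<bar>y2\<bar> \<le> H * (real k ^ i * s)"
        unfolding H_def using w0 by (simp add: pos_le_divide_eq mult_ac)
      then show ?thesis by (simp add: y2_def s_def 3 mult_ac)
    qed
    then show ?thesis by blast
  qed
qed

lemma jac_derivatives_uniformly_bounded:
  assumes ab: "0 < a" "a < b" "b < 1" and m: "2 * real m \<le> 2 * A - 1"
  shows "\<exists>G. \<forall>k. \<forall>i\<le>m. \<forall>v\<in>{a..b}. \<bar>poly ((pderiv ^^ i) (jac A C k)) v\<bar> \<le> G"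
proof -
  have "\<forall>i. \<exists>G. \<forall>k\<ge>1. \<forall>v\<in>{a..b}.
    \<bar>poly ((pderiv ^^ i) (jac A C k)) v\<bar> \<le> G * real k ^ i * sqrt (jac_norm A C k)"
    using jac_derivative_bound[OF ab] by blast
  then obtain G where G: "\<And>i k v. k \<ge> 1 \<Longrightarrow> v \<in> {a..b} \<Longrightarrow>
    \<bar>poly ((pderiv ^^ i) (jac A C k)) v\<bar> \<le> G i * real k ^ i * sqrt (jac_norm A C k)"
    by metis
  obtain B where B: "\<And>k. k \<ge> 1 \<Longrightarrow> real k ^ (2 * m) * jac_norm A C k \<le> B"
    using jac_norm_bound[OF A_pos A_less_C C_ge_1 m] by blast
  define H where "H = 1 + (\<Sum>i\<le>m. \<bar>G i\<bar>) * sqrt B"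
  have B0: "B \<ge> 0" using B[of 1] jac_norm_pos'[of 1] by simp
  have "\<bar>poly ((pderiv ^^ i) (jac A C k)) v\<bar> \<le> H" if i: "i \<le> m" and v: "v \<in> {a..b}" for i k v
  proof (cases "k = 0")
    case True
    have "(pderiv ^^ i) (1 :: real poly) = (if i = 0 then 1 else 0)"
      by (induction i) (auto simp: pderiv_1)
    then have "\<bar>poly ((pderiv ^^ i) (jac A C k)) v\<bar> \<le> 1" using True by simp
    also have "1 \<le> H" using B0 by (simp add: H_def sum_nonneg)
    finally show ?thesis .
  next
    case False
    then have k: "k \<ge> 1" by simp
    have "real k ^ i * sqrt (jac_norm A C k) \<le> real k ^ m * sqrt (jac_norm A C k)"
      using k i jac_norm_pos'[of k] by (intro mult_right_mono power_increasing) auto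
    also have "\<dots> = sqrt (real k ^ (2 * m) * jac_norm A C k)"
      by (simp add: real_sqrt_mult power_even_eq)
    also have "\<dots> \<le> sqrt B" using B[OF k] by simp
    finally have s: "real k ^ i * sqrt (jac_norm A C k) \<le> sqrt B" .
    have "\<bar>poly ((pderiv ^^ i) (jac A C k)) v\<bar> \<le> G i * (real k ^ i * sqrt (jac_norm A C k))"
      using G[OF k v, of i] by (simp add: mult.assoc)
    also have "\<dots> \<le> \<bar>G i\<bar> * (real k ^ i * sqrt (jac_norm A C k))"
      using jac_norm_pos'[of k] by (intro mult_right_mono) auto
    also have "\<dots> \<le> \<bar>G i\<bar> * sqrt B" using s by (intro mult_left_mono) auto
    also have "\<dots> \<le> (\<Sum>i\<le>m. \<bar>G i\<bar>) * sqrt B"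
      using i B0 by (intro mult_right_mono member_le_sum) auto
    finally show ?thesis by (simp add: H_def)
  qed
  then show ?thesis by blast
qed

definition jac_coeff :: "(real \<Rightarrow> real) \<Rightarrow> nat \<Rightarrow> real" where
  "jac_coeff f k = (\<integral>u. f u * poly (jac A C k) u \<partial>M) / jac_norm A C k"

lemma integral_mult_jac_sum:
  assumes f: "continuous_on UNIV f"
  shows "(\<integral>u. f u * poly (\<Sum>k\<le>n. smult (b k) (jac A C k)) u \<partial>M)
    = (\<Sum>k\<le>n. b k * (jac_coeff f k * jac_norm A C k))"
proof -
  have int: "integrable M (\<lambda>u. f u * poly p u)" for p
    by (intro integrable_continuous continuous_intros f)
  have "(\<integral>u. f u * poly (\<Sum>k\<le>n. smult (b k) (jac A C k)) u \<partial>M)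
      = (\<integral>u. (\<Sum>k\<le>n. b k * (f u * poly (jac A C k) u)) \<partial>M)"
    by (intro Bochner_Integration.integral_cong) (auto simp: poly_sum sum_distrib_left mult_ac)
  also have "\<dots> = (\<Sum>k\<le>n. b k * (\<integral>u. f u * poly (jac A C k) u \<partial>M))"
    by (subst Bochner_Integration.integral_sum) (auto simp: int)
  also have "\<dots> = (\<Sum>k\<le>n. b k * (jac_coeff f k * jac_norm A C k))"
    unfolding jac_coeff_def using jac_norm_pos' by (intro sum.cong) (auto simp: less_imp_neq[symmetric])
  finally show ?thesis .
qed

text \<open>
Expand \<open>(1 - u) ^ j\<close> in Jacobi polynomials and integrate against \<open>f\<close>. All terms are nonnegative, and
after division by the mean of \<open>(1 - u) ^ j\<close> the total is at most the supremum of \<open>\<bar>f\<bar>\<close>. As \<open>j\<close> tends to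
infinity each term tends to the corresponding coefficient, because \<open>jac A C k\<close> is 1 at the end point
where the densities concentrate.
\<close>

lemma summable_jac_coeff:
  assumes f: "continuous_on UNIV f" and nonneg: "\<And>k. jac_coeff f k \<ge> 0"
  shows "summable (jac_coeff f)"
proof -
  obtain B where B: "\<And>u. u \<in> {0..1} \<Longrightarrow> norm (f u) \<le> B"
    using bounded_on_unit_interval[OF f] by blast
  have partial: "(\<Sum>k\<le>N. jac_coeff f k) \<le> B" for N
  proof (rule tendsto_upperbound)
    show "(\<lambda>j. \<Sum>k\<le>N. jac_coeff f k * (L (pY ^ j * jac A C k) / L (pY ^ j)))
        \<longlonglongrightarrow> (\<Sum>k\<le>N. jac_coeff f k)"
    proof -
      have "(\<lambda>j. \<Sum>k\<le>N. jac_coeff f k * (L (pY ^ j * jac A C k) / L (pY ^ j)))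
        \<longlonglongrightarrow> (\<Sum>k\<le>N. jac_coeff f k * poly (jac A C k) 0)"
        by (intro tendsto_intros moment_concentration)
      then show ?thesis by simp
    qed
    show "\<forall>\<^sub>F j in sequentially. (\<Sum>k\<le>N. jac_coeff f k * (L (pY ^ j * jac A C k) / L (pY ^ j))) \<le> B"
      unfolding eventually_sequentially
    proof (intro exI[of _ N] allI impI)
      fix j assume j: "N \<le> j"
      have mp: "L (pY ^ j) > 0" by (rule moment_pos)
      have "(\<Sum>k\<le>N. jac_coeff f k * (L (pY ^ j * jac A C k) / L (pY ^ j)))
          \<le> (\<Sum>k\<le>j. jac_coeff f k * (L (pY ^ j * jac A C k) / L (pY ^ j)))"
        using j nonneg moment_jac_nonneg mp
        by (intro sum_mono2) (auto intro!: mult_nonneg_nonneg divide_nonneg_nonneg simp del: poly_mult poly_power)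
      also have "\<dots> = (\<Sum>k\<le>j. L (pY ^ j * jac A C k) / jac_norm A C k * (jac_coeff f k * jac_norm A C k)) / L (pY ^ j)"
        unfolding sum_divide_distrib
      proof (intro sum.cong refl)
        fix k
        show "jac_coeff f k * (L (pY ^ j * jac A C k) / L (pY ^ j))
          = L (pY ^ j * jac A C k) / jac_norm A C k * (jac_coeff f k * jac_norm A C k) / L (pY ^ j)"
          using jac_norm_pos'[of k] by (simp del: poly_mult poly_power)
      qed
      also have "(\<Sum>k\<le>j. L (pY ^ j * jac A C k) / jac_norm A C k * (jac_coeff f k * jac_norm A C k))
          = (\<integral>u. f u * poly (pY ^ j) u \<partial>M)"
      proof -
        have deg: "degree (pY ^ j) \<le> j" using degree_power_le[of pY j] by simp
        from integral_mult_jac_sum[OF f, where n = j and b = "\<lambda>k. L (pY ^ j * jac A C k) / jac_norm A C k"]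
        show ?thesis unfolding jac_expansion[OF deg, symmetric] by (rule sym)
      qed
      also have "\<dots> \<le> (\<integral>u. B * poly (pY ^ j) u \<partial>M)"
      proof (rule integral_mono_unit)
        show "f u * poly (pY ^ j) u \<le> B * poly (pY ^ j) u" if "0 \<le> u" "u \<le> 1" for u
          using B[of u] that by (intro mult_right_mono) auto
      qed (intro continuous_intros f)+
      also have "\<dots> = B * L (pY ^ j)" by simp
      finally show "(\<Sum>k\<le>N. jac_coeff f k * (L (pY ^ j * jac A C k) / L (pY ^ j))) \<le> B"
        using mp by (simp add: divide_right_mono)
    qed
  qed simp
  show ?thesis
  proof (rule bounded_imp_summable)
    show "sum (jac_coeff f) {..n} \<le> B" for n by (rule partial)
  qed (rule nonneg)
qed

text \<open>
The partial sums are the best approximations in mean square among polynomials of the same degree,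
and Bernstein polynomials approximate uniformly.
\<close>

lemma L2_convergence:
  assumes f: "continuous_on UNIV f" and e: "e > 0"
  shows "\<exists>N. \<forall>n\<ge>N. (\<integral>u. (f u - (\<Sum>k\<le>n. jac_coeff f k * poly (jac A C k) u))\<^sup>2 \<partial>M) \<le> e\<^sup>2"
proof -
  obtain N where N: "\<And>x. x \<in> {0..1} \<Longrightarrow> \<bar>f x - (\<Sum>k\<le>N. f (k/N) * Bernstein N k x)\<bar> < e"
    using Bernstein_Weierstrass[OF continuous_on_subset[OF f subset_UNIV] e] by blast
  define p where "p = (\<Sum>k\<le>N. smult (f (k/N) * of_nat (N choose k)) ([:0, 1:] ^ k * pY ^ (N - k)))"
  have p: "poly p x = (\<Sum>k\<le>N. f (k/N) * Bernstein N k x)" for x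
    by (simp add: p_def poly_sum Bernstein_def mult_ac)
  have degp: "degree p \<le> N" unfolding p_def
  proof (rule degree_sum_le, simp)
    fix k assume "k \<in> {..N}"
    have "degree ([:0, 1:] ^ k * pY ^ (N - k)) \<le> degree ([:0, 1 :: real:] ^ k) + degree (pY ^ (N - k))"
      by (rule degree_mult_le)
    also have "\<dots> \<le> k + (N - k)"
      using degree_power_le[of "[:0, 1 :: real:]" k] degree_power_le[of pY "N - k"] by simp
    finally show "degree (smult (f (k/N) * of_nat (N choose k)) ([:0, 1:] ^ k * pY ^ (N - k))) \<le> N"
      using \<open>k \<in> {..N}\<close> by simp
  qed
  have "(\<integral>u. (f u - (\<Sum>k\<le>n. jac_coeff f k * poly (jac A C k) u))\<^sup>2 \<partial>M) \<le> e\<^sup>2" if n: "n \<ge> N" for n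
  proof -
    define S where "S = (\<Sum>k\<le>n. smult (jac_coeff f k) (jac A C k))"
    have S: "poly S u = (\<Sum>k\<le>n. jac_coeff f k * poly (jac A C k) u)" for u
      by (simp add: S_def poly_sum)
    have "degree (S - p) \<le> n"
    proof (rule degree_diff_le)
      show "degree S \<le> n" unfolding S_def
      proof (rule degree_sum_le, simp)
        fix k assume "k \<in> {..n}"
        then show "degree (smult (jac_coeff f k) (jac A C k)) \<le> n"
          using degree_jac_le[of A C k] degree_smult_le[of "jac_coeff f k" "jac A C k"] by simp
      qed
      show "degree p \<le> n" using degp n by simp
    qed
    then obtain b where b: "S - p = (\<Sum>j\<le>n. smult (b j) (jac A C j))"
      using jac_expansion_exists by blast
    have orth: "(\<integral>u. (f u - poly S u) * poly (S - p) u \<partial>M) = 0"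
    proof -
      have i1: "integrable M (\<lambda>u. f u * poly (S - p) u)" "integrable M (\<lambda>u. poly S u * poly (S - p) u)"
        by (intro integrable_continuous continuous_intros f)+
      have "(\<integral>u. (f u - poly S u) * poly (S - p) u \<partial>M)
         = (\<integral>u. f u * poly (S - p) u \<partial>M) - (\<integral>u. poly S u * poly (S - p) u \<partial>M)"
        using i1 by (simp only: left_diff_distrib Bochner_Integration.integral_diff)
      also have "(\<integral>u. f u * poly (S - p) u \<partial>M) = (\<Sum>k\<le>n. b k * (jac_coeff f k * jac_norm A C k))"
        unfolding b by (rule integral_mult_jac_sum[OF f])
      also have "(\<integral>u. poly S u * poly (S - p) u \<partial>M) = (\<Sum>k\<le>n. b k * (jac_coeff (poly S) k * jac_norm A C k))"
        unfolding b by (rule integral_mult_jac_sum) (intro continuous_intros)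
      also have "\<dots> = (\<Sum>k\<le>n. b k * (jac_coeff f k * jac_norm A C k))"
      proof (intro sum.cong refl)
        fix k assume k: "k \<in> {..n}"
        have "(\<integral>u. poly S u * poly (jac A C k) u \<partial>M) = L (S * jac A C k)" by simp
        also have "\<dots> = (\<Sum>j\<le>n. jac_coeff f j * L (jac A C j * jac A C k))"
          unfolding S_def by (simp only: sum_distrib_right L_sum L_smult mult_smult_left)
        also have "\<dots> = (\<Sum>j\<le>n. if j = k then jac_coeff f j * jac_norm A C k else 0)"
        proof (intro sum.cong refl)
          fix j
          show "jac_coeff f j * L (jac A C j * jac A C k)
            = (if j = k then jac_coeff f j * jac_norm A C k else 0)"
            using L_jac_square[of k] jac_orthogonal[of j k] by (cases "j = k") (simp_all del: poly_mult)
        qed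
        also have "\<dots> = jac_coeff f k * jac_norm A C k" using k by simp
        finally show "b k * (jac_coeff (poly S) k * jac_norm A C k) = b k * (jac_coeff f k * jac_norm A C k)"
          using jac_norm_pos'[of k] by (simp add: jac_coeff_def)
      qed
      finally show ?thesis by simp
    qed
    have int: "integrable M (\<lambda>u. (f u - poly S u)\<^sup>2)" "integrable M (\<lambda>u. (f u - poly S u) * poly (S - p) u)"
      "integrable M (\<lambda>u. (poly (S - p) u)\<^sup>2)"
      by (intro integrable_continuous continuous_intros f)+
    have "(\<integral>u. (f u - poly S u)\<^sup>2 \<partial>M) \<le> (\<integral>u. (f u - poly S u)\<^sup>2 \<partial>M) + (\<integral>u. (poly (S - p) u)\<^sup>2 \<partial>M)"
      by simp
    also have "\<dots> = (\<integral>u. (f u - poly S u)\<^sup>2 + 2 * ((f u - poly S u) * poly (S - p) u) + (poly (S - p) u)\<^sup>2 \<partial>M)"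
      using int orth by simp
    also have "\<dots> = (\<integral>u. (f u - poly p u)\<^sup>2 \<partial>M)"
      by (intro Bochner_Integration.integral_cong) (auto simp: power2_eq_square algebra_simps)
    also have "\<dots> \<le> (\<integral>u. e\<^sup>2 \<partial>M)"
    proof (rule integral_mono_unit)
      show "(f u - poly p u)\<^sup>2 \<le> e\<^sup>2" if "0 \<le> u" "u \<le> 1" for u
        using N[of u] that unfolding p by (subst abs_le_square_iff[symmetric]) auto
    qed (intro continuous_intros f)+
    also have "\<dots> = e\<^sup>2" by (simp add: prob_space)
    finally show ?thesis by (simp add: S)
  qed
  then show ?thesis by blast
qed

text \<open>
The series converges uniformly near \<open>t\<close>. If its sum differed from \<open>f\<close> at \<open>t\<close>, then the partial sums
would stay away from \<open>f\<close> on a whole interval, against the convergence in mean square. This argument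
stays inside the open interval, where the Jacobi polynomials are known to be bounded.
\<close>

lemma jac_series_represents:
  assumes f: "continuous_on UNIV f" and nonneg: "\<And>k. jac_coeff f k \<ge> 0"
    and m: "2 * A \<ge> 1" and t: "0 < t" "t < 1"
  shows "f t = (\<Sum>k. jac_coeff f k * poly (jac A C k) t)"
proof (rule ccontr)
  define g where "g u = (\<Sum>k. jac_coeff f k * poly (jac A C k) u)" for u
  assume "f t \<noteq> (\<Sum>k. jac_coeff f k * poly (jac A C k) t)"
  then have ne: "\<bar>f t - g t\<bar> > 0" by (simp add: g_def)
  define a b where "a = t / 2" and "b = (1 + t) / 2"
  have ab: "0 < a" "a < b" "b < 1" "a < t" "t < b" using t by (auto simp: a_def b_def)
  obtain G where G: "\<And>k v. v \<in> {a..b} \<Longrightarrow> \<bar>poly (jac A C k) v\<bar> \<le> G"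
  proof -
    have "\<exists>G. \<forall>k. \<forall>v\<in>{a..b}. \<bar>poly (jac A C k) v\<bar> \<le> G"
      using jac_derivatives_uniformly_bounded[OF ab(1-3), of 0] m by simp
    then show ?thesis using that by blast
  qed
  have ul: "uniform_limit {a..b} (\<lambda>n u. \<Sum>k<n. jac_coeff f k * poly (jac A C k) u) g sequentially"
    unfolding g_def
  proof (rule Weierstrass_m_test)
    show "norm (jac_coeff f n * poly (jac A C n) u) \<le> jac_coeff f n * G" if "u \<in> {a..b}" for n u
      using G[OF that] nonneg[of n] by (auto simp: abs_mult intro: mult_left_mono)
    show "summable (\<lambda>n. jac_coeff f n * G)"
      by (intro summable_mult2 summable_jac_coeff f nonneg)
  qed
  have "continuous_on {a..b} g"
    by (rule uniform_limit_theorem[OF _ ul]) (auto intro!: continuous_intros always_eventually)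
  then have c: "continuous_on {a..b} (\<lambda>u. \<bar>f u - g u\<bar>)"
    by (intro continuous_intros continuous_on_subset[OF f]) auto
  \<comment> \<open>A quarter, so that the gap stays above \<open>2 * \<epsilon>\<close> near \<open>t\<close> and above \<open>\<epsilon>\<close> for the partial sums.\<close>
  define \<epsilon> where "\<epsilon> = \<bar>f t - g t\<bar> / 4"
  have eps: "\<epsilon> > 0" using ne by (simp add: \<epsilon>_def)
  have "isCont (\<lambda>u. \<bar>f u - g u\<bar>) t"
    using continuous_on_interior[OF c] ab by (simp add: interior_atLeastAtMost_real)
  then obtain d where d: "d > 0" "\<And>u. dist u t < d \<Longrightarrow> dist \<bar>f u - g u\<bar> \<bar>f t - g t\<bar> < \<epsilon>"
    using eps unfolding continuous_at_eps_delta by (metis dist_commute)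
  define a' b' where "a' = max a (t - d)" and "b' = min b (t + d)"
  have ab': "a' < b'" "a \<le> a'" "b' \<le> b" using ab d(1) by (auto simp: a'_def b'_def)
  have big: "2 * \<epsilon> \<le> \<bar>f u - g u\<bar>" if "a' < u" "u < b'" for u
  proof -
    have "dist u t < d" using that by (auto simp: a'_def b'_def dist_real_def)
    moreover have "\<bar>x - y\<bar> < y / 4 \<Longrightarrow> 0 \<le> y \<Longrightarrow> 2 * (y / 4) \<le> x" for x y :: real
      by linarith
    ultimately show ?thesis using d(2)[of u] unfolding dist_real_def \<epsilon>_def by simp
  qed
  have mpos: "measure M {a'<..<b'} > 0" using ab ab' by (intro interval_pos) auto
  define \<eta> where "\<eta> = sqrt (\<epsilon>\<^sup>2 * measure M {a'<..<b'} / 2)"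
  have eta: "\<eta> > 0" "\<eta>\<^sup>2 < \<epsilon>\<^sup>2 * measure M {a'<..<b'}" using eps mpos by (auto simp: \<eta>_def)
  obtain N where N: "\<And>n. n \<ge> N \<Longrightarrow>
      (\<integral>u. (f u - (\<Sum>k\<le>n. jac_coeff f k * poly (jac A C k) u))\<^sup>2 \<partial>M) \<le> \<eta>\<^sup>2"
    using L2_convergence[OF f eta(1)] by blast
  obtain N' where N': "\<And>n u. n \<ge> N' \<Longrightarrow> u \<in> {a..b} \<Longrightarrow>
      dist (\<Sum>k<n. jac_coeff f k * poly (jac A C k) u) (g u) < \<epsilon>"
    using uniform_limitD[OF ul eps] unfolding eventually_sequentially by blast
  define n where "n = max N N'"
  have "\<epsilon>\<^sup>2 * measure M {a'<..<b'} \<le> (\<integral>u. (f u - (\<Sum>k\<le>n. jac_coeff f k * poly (jac A C k) u))\<^sup>2 \<partial>M)"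
  proof (rule integral_ge_on_interval)
    show "continuous_on UNIV (\<lambda>u. (f u - (\<Sum>k\<le>n. jac_coeff f k * poly (jac A C k) u))\<^sup>2)"
      by (intro continuous_intros f)
    fix u assume u: "a' < u" "u < b'"
    have "dist (\<Sum>k\<le>n. jac_coeff f k * poly (jac A C k) u) (g u) < \<epsilon>"
      using N'[of "Suc n" u] u ab' by (simp add: n_def lessThan_Suc_atMost)
    then have "\<epsilon> \<le> \<bar>f u - (\<Sum>k\<le>n. jac_coeff f k * poly (jac A C k) u)\<bar>"
      using big[OF u] unfolding dist_real_def by linarith
    then show "\<epsilon>\<^sup>2 \<le> (f u - (\<Sum>k\<le>n. jac_coeff f k * poly (jac A C k) u))\<^sup>2"
      using eps by (subst abs_le_square_iff[symmetric]) auto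
  qed simp
  also have "\<dots> \<le> \<eta>\<^sup>2" by (rule N) (simp add: n_def)
  finally show False using eta(2) by simp
qed

theorem class_C_if_jac_coeff_nonneg:
  assumes f: "continuous_on UNIV f" and nonneg: "\<And>k. jac_coeff f k \<ge> 0"
    and m: "2 * real m \<le> 2 * A - 1"
  shows "class_C m f {0<..<1}"
proof (rule class_C_from_derivatives[where D = "\<lambda>i t. \<Sum>k. jac_coeff f k * poly ((pderiv ^^ i) (jac A C k)) t"])
  let ?h = "\<lambda>i k t. jac_coeff f k * poly ((pderiv ^^ i) (jac A C k)) t"
  have conv: "uniform_limit {a..b} (\<lambda>n t. \<Sum>k<n. ?h i k t) (\<lambda>t. \<Sum>k. ?h i k t) sequentially \<and>
      (\<forall>t\<in>{a..b}. summable (\<lambda>k. ?h i k t))"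
    if ab: "0 < a" "a < b" "b < 1" and i: "i \<le> m" for a b i
  proof -
    obtain G where G: "\<And>k v. v \<in> {a..b} \<Longrightarrow> \<bar>poly ((pderiv ^^ i) (jac A C k)) v\<bar> \<le> G"
      using jac_derivatives_uniformly_bounded[OF ab m] i by blast
    have le: "norm (?h i n u) \<le> jac_coeff f n * G" if "u \<in> {a..b}" for n u
      using G[OF that] nonneg[of n] by (auto simp: abs_mult intro: mult_left_mono)
    have s: "summable (\<lambda>n. jac_coeff f n * G)"
      by (intro summable_mult2 summable_jac_coeff f nonneg)
    show ?thesis
      by (intro conjI ballI Weierstrass_m_test[OF le s] summable_comparison_test'[OF s le])
  qed
  show "f t = (\<Sum>k. ?h 0 k t)" if "t \<in> {0<..<1}" for t
    using jac_series_represents[OF f nonneg, of t] that m by simp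
  show "((\<lambda>t. \<Sum>k. ?h i k t) has_real_derivative (\<Sum>k. ?h (Suc i) k t)) (at t)"
    if i: "i < m" and t: "t \<in> {0<..<1}" for i t
  proof -
    define a b where "a = t / 2" and "b = (1 + t) / 2"
    have ab: "0 < a" "a < b" "b < 1" "a < t" "t < b" using t by (auto simp: a_def b_def)
    show ?thesis
    proof (rule has_field_derivative_series'(2)[of "{a..b}" _ _ t])
      show "(?h i k has_real_derivative ?h (Suc i) k x) (at x within {a..b})" for k x
        unfolding funpow.simps o_apply
        by (rule has_field_derivative_at_within[OF DERIV_cmult[OF poly_DERIV]])
      show "uniformly_convergent_on {a..b} (\<lambda>n x. \<Sum>k<n. ?h (Suc i) k x)"
        using conv[OF ab(1-3), of "Suc i"] i unfolding uniformly_convergent_on_def by (metis Suc_leI)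
      show "summable (\<lambda>k. ?h i k t)" using conv[OF ab(1-3), of i] i ab by auto
      show "t \<in> interior {a..b}" using ab by (simp add: interior_atLeastAtMost_real)
    qed (use ab in auto)
  qed
  show "continuous_on {0<..<1} (\<lambda>t. \<Sum>k. ?h m k t)"
    unfolding continuous_on_eq_continuous_at[OF open_greaterThanLessThan]
  proof
    fix t :: real assume t: "t \<in> {0<..<1}"
    define a b where "a = t / 2" and "b = (1 + t) / 2"
    have ab: "0 < a" "a < b" "b < 1" "a < t" "t < b" using t by (auto simp: a_def b_def)
    have "continuous_on {a..b} (\<lambda>t. \<Sum>k. ?h m k t)"
      by (rule uniform_limit_theorem[OF _ conjunct1[OF conv[OF ab(1-3) order_refl]]])
         (auto intro!: continuous_intros always_eventually)
    then show "isCont (\<lambda>t. \<Sum>k. ?h m k t) t"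
      by (rule continuous_on_interior) (use ab in \<open>simp add: interior_atLeastAtMost_real\<close>)
  qed
qed simp

end

section \<open>The rotation-invariant mean on the unit sphere\<close>

lemma nn_integral_lborel_translate:
  fixes c :: "'a::euclidean_space"
  assumes [measurable]: "f \<in> borel_measurable borel"
  shows "(\<integral>\<^sup>+x. f (c + x) \<partial>lborel) = (\<integral>\<^sup>+x. f x \<partial>lborel)"
proof -
  have "(\<integral>\<^sup>+x. f x \<partial>lborel) = (\<integral>\<^sup>+x. f x \<partial>distr lborel borel ((+) c))"
    by (simp only: lborel_distr_plus)
  also have "\<dots> = (\<integral>\<^sup>+x. f (c + x) \<partial>lborel)" by (subst nn_integral_distr) auto
  finally show ?thesis by simp
qed

lemma nn_integral_lborel_reflect:
  fixes c :: "'a::euclidean_space"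
  assumes [measurable]: "f \<in> borel_measurable borel"
  shows "(\<integral>\<^sup>+x. f (c - x) \<partial>lborel) = (\<integral>\<^sup>+x. f x \<partial>lborel)"
proof -
  have "(lborel :: 'a measure) = distr lborel borel (\<lambda>x. c - x)"
    using lborel_affine[of "-1" c] by (simp add: density_1)
  then have "(\<integral>\<^sup>+x. f x \<partial>lborel) = (\<integral>\<^sup>+x. f x \<partial>distr lborel borel (\<lambda>x. c - x))"
    by simp
  also have "\<dots> = (\<integral>\<^sup>+x. f (c - x) \<partial>lborel)" by (subst nn_integral_distr) auto
  finally show ?thesis by simp
qed

lemma orthogonal_transformation_measurable:
  "orthogonal_transformation (T :: 'a::euclidean_space \<Rightarrow> 'a) \<Longrightarrow> T \<in> borel_measurable borel"
  by (intro borel_measurable_continuous_onI linear_continuous_on linear_conv_bounded_linear[THEN iffD1]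
      orthogonal_transformation_linear)

text \<open>
The usual proof that a translation-invariant measure is unique up to a factor, for Lebesgue measure
and its image under \<open>T\<close>: integrate the indicator of \<open>x \<in> B \<and> T y - x \<in> ball 0 1\<close> in both orders.
The factor is 1 because \<open>T\<close> preserves the unit ball.
\<close>

lemma distr_lborel_orthogonal:
  fixes T :: "'a::euclidean_space \<Rightarrow> 'a"
  assumes T: "orthogonal_transformation T"
  shows "distr lborel borel T = lborel"
proof (rule measure_eqI)
  note [measurable] = orthogonal_transformation_measurable[OF T]
  note lin = orthogonal_transformation_linear[OF T]
  fix B :: "'a set" assume "B \<in> sets (distr lborel borel T)"
  then have [measurable]: "B \<in> sets borel" by simp
  define b :: "'a set" where "b = ball 0 1"
  have [measurable]: "b \<in> sets borel" by (simp add: b_def)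
  have Tb: "T x \<in> b \<longleftrightarrow> x \<in> b" for x
    using orthogonal_transformation_norm[OF T] by (simp add: b_def)
  have T_diff: "\<exists>c'. \<forall>y. T y - c = T (c' + y)" for c
  proof -
    obtain c' where "c = T c'" using orthogonal_transformation_surj[OF T] by (metis surjD)
    then have "\<forall>y. T y - c = T (- c' + y)" by (simp add: linear_diff[OF lin, symmetric])
    then show ?thesis by blast
  qed
  have inner1: "(\<integral>\<^sup>+y. indicator A (T y - c) \<partial>lborel) = (\<integral>\<^sup>+y. indicator A (T y) \<partial>lborel)"
    if [measurable]: "A \<in> sets borel" for A c
  proof -
    obtain c' where c': "\<And>y. T y - c = T (c' + y)" using T_diff by blast
    show ?thesis unfolding c' by (rule nn_integral_lborel_translate) simp
  qed
  define I where "I = (\<integral>\<^sup>+x. (\<integral>\<^sup>+y. indicator B x * indicator b (T y - x) \<partial>lborel) \<partial>lborel)"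
  have "I = (\<integral>\<^sup>+x. indicator B x * emeasure lborel b \<partial>lborel)"
    unfolding I_def
  proof (intro nn_integral_cong)
    fix x
    have "(\<integral>\<^sup>+y. indicator B x * indicator b (T y - x) \<partial>lborel)
        = indicator B x * (\<integral>\<^sup>+y. indicator b (T y - x) \<partial>lborel)"
      by (rule nn_integral_cmult) measurable
    also have "(\<integral>\<^sup>+y. indicator b (T y - x) \<partial>lborel) = (\<integral>\<^sup>+y. indicator b (T y) \<partial>lborel)"
      by (rule inner1) simp
    also have "\<dots> = (\<integral>\<^sup>+y. indicator b y \<partial>lborel)"
      using Tb by (simp add: indicator_def)
    also have "\<dots> = emeasure lborel b" by simp
    finally show "(\<integral>\<^sup>+y. indicator B x * indicator b (T y - x) \<partial>lborel)
        = indicator B x * emeasure lborel b" .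
  qed
  then have I1: "I = emeasure lborel B * emeasure lborel b"
    by (simp add: nn_integral_multc)
  have "I = (\<integral>\<^sup>+y. (\<integral>\<^sup>+x. indicator B x * indicator b (T y - x) \<partial>lborel) \<partial>lborel)"
    unfolding I_def by (rule lborel_pair.Fubini') simp
  also have "\<dots> = (\<integral>\<^sup>+y. (\<integral>\<^sup>+z. indicator B (T y - z) * indicator b z \<partial>lborel) \<partial>lborel)"
  proof (rule nn_integral_cong)
    fix y
    show "(\<integral>\<^sup>+x. indicator B x * indicator b (T y - x) \<partial>lborel)
      = (\<integral>\<^sup>+z. indicator B (T y - z) * indicator b z \<partial>lborel)"
      using nn_integral_lborel_reflect[of "\<lambda>x. indicator B x * indicator b (T y - x)" "T y"] by simp
  qed
  also have "\<dots> = (\<integral>\<^sup>+z. (\<integral>\<^sup>+y. indicator B (T y - z) * indicator b z \<partial>lborel) \<partial>lborel)"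
    by (rule lborel_pair.Fubini') simp
  also have "\<dots> = (\<integral>\<^sup>+z. (\<integral>\<^sup>+y. indicator B (T y) \<partial>lborel) * indicator b z \<partial>lborel)"
    by (intro nn_integral_cong) (simp add: nn_integral_multc inner1)
  also have "\<dots> = (\<integral>\<^sup>+y. indicator B (T y) \<partial>lborel) * emeasure lborel b"
    by (simp add: nn_integral_cmult)
  also have "(\<integral>\<^sup>+y. indicator B (T y) \<partial>lborel) = emeasure (distr lborel borel T) B"
  proof -
    have "emeasure (distr lborel borel T) B = (\<integral>\<^sup>+y. indicator B y \<partial>distr lborel borel T)" by simp
    also have "\<dots> = (\<integral>\<^sup>+y. indicator B (T y) \<partial>lborel)" by (rule nn_integral_distr) auto
    finally show ?thesis by simp
  qed
  finally have "emeasure (distr lborel borel T) B * emeasure lborel b = emeasure lborel B * emeasure lborel b"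
    using I1 by simp
  moreover have "emeasure lborel b \<noteq> \<infinity>" using emeasure_lborel_ball_finite[of "0::'a" 1] by (auto simp: b_def)
  moreover have "emeasure lborel b \<noteq> 0"
    using content_ball_pos[of 1 "0::'a"] by (auto simp: b_def measure_def)
  ultimately show "emeasure (distr lborel borel T) B = emeasure lborel B"
    by (auto simp: ennreal_mult_cancel_left mult.commute[of _ "emeasure lborel b"])
qed simp

text \<open>
The uniform distribution on the unit ball, projected to the sphere: \<open>sgn y\<close> is \<open>y\<close> divided by its norm.
\<close>

definition sphere_measure :: "'a::euclidean_space measure" where
  "sphere_measure = distr (uniform_measure lborel (ball 0 1)) borel sgn"

lemma sets_sphere_measure [measurable_cong, simp]: "sets sphere_measure = sets borel"
  and space_sphere_measure [simp]: "space sphere_measure = UNIV"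
  by (auto simp: sphere_measure_def)

lemma measurable_sgn_euclidean [measurable]: "(sgn :: 'a::euclidean_space \<Rightarrow> 'a) \<in> borel_measurable borel"
  unfolding sgn_div_norm by measurable

lemma sgn_vimage_borel:
  "B \<in> sets borel \<Longrightarrow> (sgn :: 'a::euclidean_space \<Rightarrow> 'a) -` B \<in> sets borel"
  by (rule measurable_sets_borel[OF measurable_sgn_euclidean])

lemma emeasure_unit_ball:
  "emeasure lborel (ball (0::'a::euclidean_space) 1) \<noteq> 0"
  "emeasure lborel (ball (0::'a::euclidean_space) 1) \<noteq> \<infinity>"
  using content_ball_pos[of 1 "0::'a"] emeasure_lborel_ball_finite[of "0::'a" 1]
  by (auto simp: measure_def)

interpretation sphere: prob_space "sphere_measure :: 'a::euclidean_space measure"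
  unfolding sphere_measure_def
  by (intro prob_space.prob_space_distr prob_space_uniform_measure emeasure_unit_ball) simp

interpretation sphere_pair: pair_sigma_finite
  "sphere_measure :: 'a::euclidean_space measure" "sphere_measure :: 'a measure"
  by unfold_locales

lemma sphere_measure_UNIV [simp]: "measure sphere_measure UNIV = 1"
  using sphere.prob_space by simp

lemma AE_sphere: "AE x in (sphere_measure :: 'a::euclidean_space measure). norm x = 1"
proof -
  have "AE x in (lborel :: 'a measure). x \<noteq> 0"
    by (rule AE_lborel_singleton)
  then have "AE x in uniform_measure (lborel :: 'a measure) (ball 0 1). norm (sgn x) = 1"
    by (intro AE_uniform_measureI) (auto simp: norm_sgn)
  then show ?thesis unfolding sphere_measure_def
    by (subst AE_distr_iff) auto
qed

lemma distr_sphere_measure: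
  fixes T :: "'a::euclidean_space \<Rightarrow> 'a"
  assumes T: "orthogonal_transformation T"
  shows "distr sphere_measure borel T = sphere_measure"
proof (rule measure_eqI)
  note [measurable] = orthogonal_transformation_measurable[OF T]
  note lin = orthogonal_transformation_linear[OF T]
  have sgnT: "T (sgn x) = sgn (T x)" for x
    by (simp add: sgn_div_norm linear_scale[OF lin] orthogonal_transformation_norm[OF T])
  fix B :: "'a set" assume "B \<in> sets (distr sphere_measure borel T)"
  then have [measurable]: "B \<in> sets borel" by simp
  have "emeasure (distr sphere_measure borel T) B
      = emeasure (uniform_measure lborel (ball 0 1)) ((\<lambda>x. T (sgn x)) -` B)"
    by (simp add: sphere_measure_def emeasure_distr distr_distr comp_def)
  also have "\<dots> = emeasure lborel (ball 0 1 \<inter> (\<lambda>x. sgn (T x)) -` B) / emeasure lborel (ball (0::'a) 1)"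
  proof -
    have "(\<lambda>x. sgn (T x)) \<in> borel_measurable borel" by measurable
    from measurable_sets_borel[OF this, of B] show ?thesis
      unfolding sgnT by (subst emeasure_uniform_measure) auto
  qed
  also have "ball 0 1 \<inter> (\<lambda>x. sgn (T x)) -` B = T -` (ball 0 1 \<inter> sgn -` B)"
    using orthogonal_transformation_norm[OF T] by auto
  also have "emeasure lborel (T -` (ball 0 1 \<inter> sgn -` B))
      = emeasure (distr lborel borel T) (ball 0 1 \<inter> sgn -` B)"
    using sgn_vimage_borel[of B] by (subst emeasure_distr) auto
  also have "\<dots> = emeasure lborel (ball 0 1 \<inter> sgn -` B)"
    by (simp only: distr_lborel_orthogonal[OF T])
  also have "\<dots> / emeasure lborel (ball (0::'a) 1) = emeasure sphere_measure B"
    unfolding sphere_measure_def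
    using sgn_vimage_borel[of B] by (subst emeasure_distr) (auto simp: emeasure_uniform_measure)
  finally show "emeasure (distr sphere_measure borel T) B = emeasure sphere_measure B" .
qed simp

lemma sphere_integral_orthogonal:
  fixes T :: "'a::euclidean_space \<Rightarrow> 'a" and g :: "'a \<Rightarrow> real"
  assumes T: "orthogonal_transformation T" and [measurable]: "g \<in> borel_measurable borel"
  shows "(\<integral>y. g (T y) \<partial>sphere_measure) = (\<integral>y. g y \<partial>sphere_measure)"
proof -
  note [measurable] = orthogonal_transformation_measurable[OF T]
  have "(\<integral>y. g y \<partial>sphere_measure) = (\<integral>y. g y \<partial>distr sphere_measure borel T)"
    by (simp only: distr_sphere_measure[OF T])
  also have "\<dots> = (\<integral>y. g (T y) \<partial>sphere_measure)" by (subst integral_distr) auto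
  finally show ?thesis by simp
qed

lemma sphere_measure_open_pos:
  fixes V :: "'a::euclidean_space set"
  assumes "open V" "x \<in> V" "norm x = 1"
  shows "measure sphere_measure V > 0"
proof -
  have "x /\<^sub>R 2 \<noteq> 0" and sx: "sgn (x /\<^sub>R 2) = x" using assms(3) by (auto simp: sgn_div_norm)
  then have "isCont sgn (x /\<^sub>R 2)" by (intro isCont_sgn) auto
  then have "\<forall>\<^sub>F y in at (x /\<^sub>R 2). sgn y \<in> V"
    using topological_tendstoD[of sgn "sgn (x /\<^sub>R 2)" "at (x /\<^sub>R 2)" V] assms sx by (simp add: isCont_def)
  then have "\<forall>\<^sub>F y in nhds (x /\<^sub>R 2). sgn y \<in> V"
    using sx assms by (simp add: eventually_nhds_conv_at)
  moreover have "\<forall>\<^sub>F y in nhds (x /\<^sub>R 2). y \<in> ball 0 1"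
    using assms(3) by (intro eventually_nhds_in_open) auto
  ultimately have "\<forall>\<^sub>F y in nhds (x /\<^sub>R 2). y \<in> ball 0 1 \<inter> sgn -` V"
    by eventually_elim auto
  then obtain r where r: "r > 0" "ball (x /\<^sub>R 2) r \<subseteq> ball 0 1 \<inter> sgn -` V"
    unfolding eventually_nhds_metric by (auto simp: subset_eq dist_commute)
  have [measurable]: "V \<in> sets borel" using assms(1) by simp
  have "0 < measure lborel (ball (x /\<^sub>R 2) r)" using content_ball_pos[OF r(1)] by simp
  also have "\<dots> \<le> measure lborel (ball 0 1 \<inter> sgn -` V)"
  proof (rule measure_mono_fmeasurable[OF r(2)])
    show "ball 0 1 \<inter> sgn -` V \<in> fmeasurable lborel"
    proof (rule fmeasurableI2[of "ball 0 1"])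
      show "ball (0::'a) 1 \<in> fmeasurable lborel"
        using emeasure_lborel_ball_finite[of "0::'a" 1] by (simp add: fmeasurable_def)
      have "sgn -` V \<in> sets borel" by (rule sgn_vimage_borel) simp
      then show "ball 0 1 \<inter> sgn -` V \<in> sets lborel" by simp
    qed simp
  qed simp
  finally have "0 < measure lborel (ball 0 1 \<inter> sgn -` V)" .
  moreover have "measure sphere_measure V = measure lborel (ball 0 1 \<inter> sgn -` V) / measure lborel (ball (0::'a) 1)"
    unfolding sphere_measure_def
    using emeasure_unit_ball[where 'a='a] sgn_vimage_borel[of V]
    by (subst measure_distr) (auto simp: measure_uniform_measure)
  ultimately show ?thesis using content_ball_pos[of 1 "0::'a"] by simp
qed

lemma integrable_sphere:
  fixes g :: "'a::euclidean_space \<Rightarrow> real"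
  assumes "continuous_on UNIV g"
  shows "integrable sphere_measure g"
proof -
  have [measurable]: "g \<in> borel_measurable borel"
    by (rule borel_measurable_continuous_onI[OF assms])
  have "bounded (g ` sphere 0 1)"
    by (intro compact_imp_bounded compact_continuous_image continuous_on_subset[OF assms]) auto
  then obtain B where "\<forall>x\<in>g ` sphere 0 1. norm x \<le> B" unfolding bounded_iff by blast
  then have "AE x in sphere_measure. norm (g x) \<le> B" using AE_sphere by auto
  then show ?thesis by (rule sphere.integrable_const_bound) measurable
qed

lemma continuous_on_section:
  assumes "continuous_on UNIV (\<lambda>(x, y). G x y)"
  shows "continuous_on UNIV (G x)"
proof -
  have "continuous_on UNIV (\<lambda>y. (\<lambda>(x, y). G x y) (x, y))"
    by (rule continuous_on_compose2[OF assms]) (auto intro!: continuous_intros)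
  then show ?thesis by simp
qed

lemma integrable_sphere_pair:
  fixes G :: "'a::euclidean_space \<Rightarrow> 'a \<Rightarrow> real"
  assumes G: "continuous_on UNIV (\<lambda>(x, y). G x y)"
  shows "integrable (sphere_measure \<Otimes>\<^sub>M sphere_measure) (\<lambda>(x, y). G x y)"
proof -
  have "(\<lambda>(x, y). G x y) \<in> borel_measurable borel"
    by (rule borel_measurable_continuous_onI[OF G])
  then have [measurable]: "(\<lambda>(x, y). G x y) \<in> borel_measurable (borel \<Otimes>\<^sub>M borel)"
    by (simp add: borel_prod)
  have "bounded ((\<lambda>(x, y). G x y) ` (sphere 0 1 \<times> sphere 0 1))"
    by (intro compact_imp_bounded compact_continuous_image continuous_on_subset[OF G] compact_Times) auto
  then obtain B where B: "\<forall>z\<in>(\<lambda>(x, y). G x y) ` (sphere 0 1 \<times> sphere 0 1). norm z \<le> B"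
    unfolding bounded_iff by blast
  have "AE z in sphere_measure \<Otimes>\<^sub>M sphere_measure. norm (fst z :: 'a) = 1 \<and> norm (snd z :: 'a) = 1"
  proof (rule sphere_pair.AE_pair_measure)
    show "{x \<in> space (sphere_measure \<Otimes>\<^sub>M sphere_measure). norm (fst x :: 'a) = 1 \<and> norm (snd x :: 'a) = 1}
       \<in> sets (sphere_measure \<Otimes>\<^sub>M sphere_measure)" by measurable
    show "AE x in sphere_measure. AE y in sphere_measure. norm (fst (x :: 'a, y :: 'a)) = 1 \<and> norm (snd (x, y)) = 1"
      using AE_sphere AE_sphere by (auto elim!: eventually_mono)
  qed
  then have "AE z in sphere_measure \<Otimes>\<^sub>M sphere_measure. norm ((\<lambda>(x, y). G x y) z) \<le> B"
    by eventually_elim (use B in \<open>force split: prod.splits\<close>)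
  then show ?thesis
    by (intro finite_measure.integrable_const_bound finite_measure_pair_measure sphere.finite_measure_axioms)
       measurable
qed

lemma integrable_sphere_inner:
  fixes G :: "'a::euclidean_space \<Rightarrow> 'a \<Rightarrow> real"
  assumes G: "continuous_on UNIV (\<lambda>(x, y). G x y)"
  shows "integrable sphere_measure (\<lambda>x. \<integral>y. G x y \<partial>sphere_measure)"
  using sphere_pair.integrable_fst[OF integrable_sphere_pair[OF G]] by simp

lemma sphere_borel_measurable:
  fixes g :: "'a::euclidean_space \<Rightarrow> real"
  assumes "continuous_on UNIV g"
  shows "g \<in> borel_measurable sphere_measure"
  using borel_measurable_continuous_onI[OF assms] by (simp cong: measurable_cong_sets)

lemma sphere_integral_cong:
  fixes f g :: "'a::euclidean_space \<Rightarrow> real"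
  assumes "continuous_on UNIV f" "continuous_on UNIV g" "\<And>y. norm y = 1 \<Longrightarrow> f y = g y"
  shows "(\<integral>y. f y \<partial>sphere_measure) = (\<integral>y. g y \<partial>sphere_measure)"
proof (rule integral_cong_AE)
  show "AE y in sphere_measure. f y = g y"
    using AE_sphere by eventually_elim (rule assms(3))
qed (rule sphere_borel_measurable assms(1,2))+

lemma sphere_iterated_integral_cong:
  fixes G :: "'a::euclidean_space \<Rightarrow> 'a \<Rightarrow> real"
  assumes G: "continuous_on UNIV (\<lambda>(x, y). G x y)" and f: "continuous_on UNIV f"
    and eq: "\<And>x. norm x = 1 \<Longrightarrow> (\<integral>y. G x y \<partial>sphere_measure) = f x"
  shows "(\<integral>x. (\<integral>y. G x y \<partial>sphere_measure) \<partial>sphere_measure) = (\<integral>x. f x \<partial>sphere_measure)"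
proof (rule integral_cong_AE)
  show "AE x in sphere_measure. (\<integral>y. G x y \<partial>sphere_measure) = f x"
    using AE_sphere by eventually_elim (rule eq)
qed (intro borel_measurable_integrable integrable_sphere_inner G sphere_borel_measurable f)+

lemma sphere_Fubini:
  fixes G :: "'a::euclidean_space \<Rightarrow> 'a \<Rightarrow> real"
  assumes G: "continuous_on UNIV (\<lambda>(x, y). G x y)"
  shows "(\<integral>x. (\<integral>y. G x y \<partial>sphere_measure) \<partial>sphere_measure)
    = (\<integral>y. (\<integral>x. G x y \<partial>sphere_measure) \<partial>sphere_measure)"
  using sphere_pair.Fubini_integral[OF integrable_sphere_pair[OF G]] by simp

text \<open>
A double integral is a limit of the finite quadratic forms: cut the sphere into small pieces, choose
a point in each, and weight it with the measure of its piece.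
\<close>

lemma double_integral_nonneg:
  fixes G :: "'a::euclidean_space \<Rightarrow> 'a \<Rightarrow> real"
  assumes G: "continuous_on UNIV (\<lambda>(x, y). G x y)"
    and pos: "\<And>(n::nat) x c. (\<And>i. i < n \<Longrightarrow> norm (x i) = 1) \<Longrightarrow>
       0 \<le> (\<Sum>i<n. \<Sum>j<n. c i * c j * G (x i) (x j))"
  shows "0 \<le> (\<integral>x. (\<integral>y. G x y \<partial>sphere_measure) \<partial>sphere_measure)"
proof (rule field_le_epsilon)
  fix e :: real assume e: "e > 0"
  let ?S = "sphere (0::'a) 1"
  have "uniformly_continuous_on (?S \<times> ?S) (\<lambda>(x, y). G x y)"
    by (intro compact_uniformly_continuous continuous_on_subset[OF G] compact_Times) auto
  then obtain d where d: "d > 0" and dG: "\<And>z z'. z \<in> ?S \<times> ?S \<Longrightarrow> z' \<in> ?S \<times> ?S \<Longrightarrow> dist z' z < d \<Longrightarrow>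
      dist ((\<lambda>(x, y). G x y) z') ((\<lambda>(x, y). G x y) z) < e"
    using e unfolding uniformly_continuous_on_def by metis
  have "\<exists>P. finite P \<and> P \<subseteq> ?S \<and> ?S \<subseteq> (\<Union>x\<in>P. ball x (d / 2))"
    using d by (intro seq_compact_imp_totally_bounded[rule_format])
      (auto simp: compact_eq_seq_compact_metric[symmetric])
  then obtain P where P: "finite P" "P \<subseteq> ?S" "?S \<subseteq> (\<Union>x\<in>P. ball x (d / 2))" by blast
  obtain p n where p: "P = p ` {i::nat. i < n}"
    using finite_imp_nat_seg_image_inj_on[OF P(1)] by metis
  have pS: "norm (p i) = 1" if "i < n" for i using P(2) p that by auto
  \<comment> \<open>Half of \<open>d\<close>, since both arguments of the kernel are moved.\<close>
  define D where "D = disjointed (\<lambda>i. ball (p i) (d / 2))"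
  have [measurable]: "D i \<in> sets borel" for i
    unfolding D_def disjointed_def by auto
  have D_ex: "\<exists>i<n. x \<in> D i" if "norm x = 1" for x
  proof -
    have "x \<in> (\<Union>x\<in>P. ball x (d / 2))" by (rule subsetD[OF P(3)]) (simp add: that)
    then have "\<exists>i<n. x \<in> ball (p i) (d / 2)" by (auto simp: p)
    then obtain i where i: "i < n" "x \<in> ball (p i) (d / 2)" "\<And>j. j < i \<Longrightarrow> \<not> (j < n \<and> x \<in> ball (p j) (d / 2))"
      using exists_least_iff[of "\<lambda>i. i < n \<and> x \<in> ball (p i) (d / 2)"] by auto
    then have "x \<in> D i" by (auto simp: D_def disjointed_def)
    then show ?thesis using i(1) by blast
  qed
  have D_unique: "i = j" if "x \<in> D i" "x \<in> D j" for x i j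
    using disjoint_family_disjointed[of "\<lambda>i. ball (p i) (d / 2)"] that
    unfolding D_def[symmetric] disjoint_family_on_def by auto
  have D_sub: "x \<in> D i \<Longrightarrow> dist (p i) x < d / 2" for x i
    by (auto simp: D_def disjointed_def)
  define s where "s x y = (\<Sum>i<n. \<Sum>j<n. indicator (D i) x * (indicator (D j) y * G (p i) (p j)))" for x y
  have s_le: "s x y - e \<le> G x y" if x: "norm x = 1" and y: "norm y = 1" for x y
  proof -
    obtain i where i: "i < n" "x \<in> D i" using D_ex[OF x] by blast
    obtain j where j: "j < n" "y \<in> D j" using D_ex[OF y] by blast
    have ind: "indicator (D i') x = (if i' = i then 1 else (0::real))"
      "indicator (D j') y = (if j' = j then 1 else (0::real))" for i' j'
      using i j D_unique by (auto simp: indicator_def)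
    have "s x y = G (p i) (p j)"
    proof -
      have "(\<Sum>j'<n. indicator (D i') x * (indicator (D j') y * G (p i') (p j')))
          = (if i' = i then G (p i) (p j) else 0)" for i'
        unfolding ind using j(1)
        by (cases "i' = i") (simp_all add: if_distrib[of "\<lambda>t. t * _"] cong: if_cong)
      then show ?thesis unfolding s_def using i(1) by simp
    qed
    moreover have "dist (p i, p j) (x, y) < d"
    proof -
      have "dist (p i, p j) (x, y) \<le> dist (p i) x + dist (p j) y"
        unfolding dist_Pair_Pair by (rule order_trans[OF real_sqrt_sum_squares_triangle_ineq[of _ 0 0, simplified]]) simp
      then show ?thesis using D_sub[OF i(2)] D_sub[OF j(2)] by linarith
    qed
    then have "dist (G (p i) (p j)) (G x y) < e"
      using dG[of "(x, y)" "(p i, p j)"] x y pS i j by simp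
    ultimately show ?thesis unfolding dist_real_def by linarith
  qed
  define a where "a i = measure (sphere_measure :: 'a measure) (D i)" for i
  have int_ind: "integrable sphere_measure (\<lambda>y. indicator (D j) y * c)" for j and c :: real
    by (intro integrable_mult_left) (simp add: integrable_indicator_iff sphere.emeasure_eq_measure)
  have inner: "(\<integral>y. s x y \<partial>sphere_measure) = (\<Sum>i<n. \<Sum>j<n. indicator (D i) x * (a j * G (p i) (p j)))" for x
  proof -
    have ind: "(\<integral>y. indicator (D i) x * (indicator (D j) y * G (p i) (p j)) \<partial>sphere_measure)
        = indicator (D i) x * (a j * G (p i) (p j))" for i j
      by (simp only: integral_mult_right_zero integral_mult_left_zero a_def) simp
    have int: "integrable sphere_measure (\<lambda>y. indicator (D i) x * (indicator (D j) y * G (p i) (p j)))" for i j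
      by (intro integrable_mult_right int_ind)
    have "(\<integral>y. s x y \<partial>sphere_measure)
      = (\<Sum>i<n. (\<integral>y. (\<Sum>j<n. indicator (D i) x * (indicator (D j) y * G (p i) (p j))) \<partial>sphere_measure))"
      unfolding s_def by (intro Bochner_Integration.integral_sum Bochner_Integration.integrable_sum int)
    also have "\<dots> = (\<Sum>i<n. \<Sum>j<n. indicator (D i) x * (a j * G (p i) (p j)))"
      unfolding ind[symmetric] by (intro sum.cong refl Bochner_Integration.integral_sum int)
    finally show ?thesis .
  qed
  have int_s: "integrable sphere_measure (\<lambda>y. s x y)" for x
    unfolding s_def by (intro Bochner_Integration.integrable_sum integrable_mult_right int_ind)
  have outer: "(\<integral>x. (\<integral>y. s x y \<partial>sphere_measure) \<partial>sphere_measure) = (\<Sum>i<n. \<Sum>j<n. a i * a j * G (p i) (p j))"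
  proof -
    have ind: "(\<integral>x. indicator (D i) x * (a j * G (p i) (p j)) \<partial>sphere_measure)
        = a i * a j * G (p i) (p j)" for i j
      by (simp only: integral_mult_right_zero integral_mult_left_zero a_def) simp
    have "(\<integral>x. (\<integral>y. s x y \<partial>sphere_measure) \<partial>sphere_measure)
      = (\<Sum>i<n. (\<integral>x. (\<Sum>j<n. indicator (D i) x * (a j * G (p i) (p j))) \<partial>sphere_measure))"
      unfolding inner by (intro Bochner_Integration.integral_sum Bochner_Integration.integrable_sum int_ind)
    also have "\<dots> = (\<Sum>i<n. \<Sum>j<n. a i * a j * G (p i) (p j))"
      unfolding ind[symmetric] by (intro sum.cong refl Bochner_Integration.integral_sum int_ind)
    finally show ?thesis .
  qed
  have int_G: "integrable sphere_measure (G x)" for x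
    by (intro integrable_sphere continuous_on_section[OF G])
  have "(\<integral>x. (\<integral>y. s x y \<partial>sphere_measure) - e \<partial>sphere_measure)
      \<le> (\<integral>x. (\<integral>y. G x y \<partial>sphere_measure) \<partial>sphere_measure)"
  proof (rule integral_mono_AE)
    show "integrable sphere_measure (\<lambda>x. (\<integral>y. s x y \<partial>sphere_measure) - e)"
      unfolding inner
      by (intro Bochner_Integration.integrable_diff Bochner_Integration.integrable_sum int_ind) simp
    show "integrable sphere_measure (\<lambda>x. \<integral>y. G x y \<partial>sphere_measure)"
      by (rule integrable_sphere_inner[OF G])
    show "AE x in sphere_measure. (\<integral>y. s x y \<partial>sphere_measure) - e \<le> (\<integral>y. G x y \<partial>sphere_measure)"
      using AE_sphere
    proof eventually_elim
      fix x :: 'a assume x: "norm x = 1"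
      have "(\<integral>y. s x y \<partial>sphere_measure) - e = (\<integral>y. s x y - e \<partial>sphere_measure)"
        using int_s[of x] by (simp add: sphere.prob_space)
      also have "\<dots> \<le> (\<integral>y. G x y \<partial>sphere_measure)"
        using int_s[of x] int_G[of x] AE_sphere
        by (intro integral_mono_AE) (auto elim!: eventually_mono intro: s_le[OF x])
      finally show "(\<integral>y. s x y \<partial>sphere_measure) - e \<le> (\<integral>y. G x y \<partial>sphere_measure)" .
    qed
  qed
  moreover have "(\<integral>x. (\<integral>y. s x y \<partial>sphere_measure) - e \<partial>sphere_measure) = (\<Sum>i<n. \<Sum>j<n. a i * a j * G (p i) (p j)) - e"
  proof -
    have "integrable sphere_measure (\<lambda>x. \<integral>y. s x y \<partial>sphere_measure)"
      unfolding inner by (intro Bochner_Integration.integrable_sum int_ind)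
    then show ?thesis using outer by (simp add: sphere.prob_space)
  qed
  moreover have "0 \<le> (\<Sum>i<n. \<Sum>j<n. a i * a j * G (p i) (p j))"
    by (rule pos) (rule pS)
  ultimately show "0 \<le> (\<integral>x. (\<integral>y. G x y \<partial>sphere_measure) \<partial>sphere_measure) + e" by linarith
qed

definition orthonormal_frame :: "nat \<Rightarrow> (nat \<Rightarrow> 'a::real_inner) \<Rightarrow> bool" where
  "orthonormal_frame r v \<longleftrightarrow> (\<forall>i<r. \<forall>j<r. v i \<bullet> v j = (if i = j then 1 else 0))"

lemma exists_reflection:
  fixes x y :: "'a::euclidean_space"
  assumes "norm x = norm y"
  shows "\<exists>T. orthogonal_transformation T \<and> T x = y \<and> (\<forall>z. z \<bullet> x = z \<bullet> y \<longrightarrow> T z = z)"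
proof -
  define u where "u = x - y"
  define T where "T z = z - (2 * (z \<bullet> u) / (u \<bullet> u)) *\<^sub>R u" for z
  have "linear T"
    unfolding T_def by (rule linearI) (simp_all add: inner_add_left algebra_simps add_divide_distrib)
  moreover have "T a \<bullet> T b = a \<bullet> b" for a b
    by (cases "u = 0") (simp_all add: T_def inner_diff_left inner_diff_right inner_commute)
  ultimately have "orthogonal_transformation T" by (simp add: orthogonal_transformation_def)
  moreover have "T x = y"
  proof (cases "u = 0")
    case True
    then show ?thesis by (simp add: T_def u_def)
  next
    case False
    have "x \<bullet> x = y \<bullet> y" using assms by (simp add: norm_eq)
    then have "2 * (x \<bullet> u) = u \<bullet> u"
      by (simp add: u_def inner_diff_left inner_diff_right inner_commute)
    then show ?thesis using False by (simp add: T_def) (simp add: u_def)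
  qed
  moreover have "T z = z" if "z \<bullet> x = z \<bullet> y" for z
    using that by (simp add: T_def u_def inner_diff_right)
  ultimately show ?thesis by blast
qed

text \<open>
Move the vectors to their targets one at a time. The reflection that exchanges the image of \<open>v r\<close> with
\<open>w r\<close> fixes the targets already reached, since these are orthogonal to both.
\<close>

lemma orthonormal_frame_transitive:
  fixes v w :: "nat \<Rightarrow> 'a::euclidean_space"
  assumes "orthonormal_frame r v" "orthonormal_frame r w"
  shows "\<exists>T. orthogonal_transformation T \<and> (\<forall>i<r. T (v i) = w i)"
  using assms
proof (induction r)
  case 0
  then show ?case using orthogonal_transformation_id by blast
next
  case (Suc r)
  then obtain T where T: "orthogonal_transformation T" "\<And>i. i < r \<Longrightarrow> T (v i) = w i"
    by (auto simp: orthonormal_frame_def)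
  have "norm (v r) = 1" "norm (w r) = 1"
    using Suc.prems by (simp_all add: orthonormal_frame_def norm_eq_sqrt_inner)
  then have "norm (T (v r)) = norm (w r)"
    by (simp add: orthogonal_transformation_norm[OF T(1)])
  from exists_reflection[OF this] obtain R where R: "orthogonal_transformation R" "R (T (v r)) = w r"
    "\<And>z. z \<bullet> T (v r) = z \<bullet> w r \<Longrightarrow> R z = z" by blast
  have "R (w i) = w i" if i: "i < r" for i
  proof (rule R(3))
    have "w i \<bullet> T (v r) = v i \<bullet> v r"
      using T i by (metis orthogonal_transformation_def)
    then show "w i \<bullet> T (v r) = w i \<bullet> w r"
      using Suc.prems i by (simp add: orthonormal_frame_def)
  qed
  then have "(R \<circ> T) (v i) = w i" if "i < Suc r" for i
    using that T(2) R(2) by (cases "i = r") auto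
  then show ?case using orthogonal_transformation_compose[OF R(1) T(1)] by blast
qed

lemma exists_unit_orthogonal:
  fixes v :: "nat \<Rightarrow> 'a::euclidean_space"
  assumes "a < DIM('a)"
  shows "\<exists>w. norm w = 1 \<and> (\<forall>i<a. w \<bullet> v i = 0)"
proof -
  let ?S = "v ` {..<a}"
  have "dim ?S \<le> card ?S" by (rule dim_le_card') simp
  also have "\<dots> \<le> a" using card_image_le[of "{..<a}" v] by simp
  finally have "dim ?S < DIM('a)" using assms by simp
  then obtain z where z: "z \<noteq> 0" "\<And>y. y \<in> span ?S \<Longrightarrow> orthogonal z y"
    using orthogonal_to_subspace_exists[of ?S] by metis
  have "(z /\<^sub>R norm z) \<bullet> v i = 0" if "i < a" for i
    using z(2)[OF span_base, of "v i"] that by (auto simp: orthogonal_def)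
  then show ?thesis using z(1) by (intro exI[of _ "z /\<^sub>R norm z"]) auto
qed

section \<open>Zonal functions on a sphere and the Funk-Hecke formula\<close>

lemma continuous_on_UNIV_poly: "continuous_on UNIV (poly (p :: real poly))"
  by (intro continuous_intros)

text \<open>
The sphere carries a function \<open>U\<close> that plays the part of \<open>(1 - t) / 2\<close>, where \<open>t\<close> is the argument of
the radial part. The two analytic assumptions are the ones that distinguish the spaces: zonal
convolution with a power of \<open>U\<close> does not raise the degree, and the law of \<open>U x\<close> under the uniform
distribution is a Beta law, expressed by integration by parts.
\<close>

locale zonal_space =
  fixes U :: "'a::euclidean_space \<Rightarrow> 'a \<Rightarrow> real" and A C :: real
  assumes DIM_ge_2: "2 \<le> DIM('a)"
    and A_pos: "0 < A" and A_less_C: "A < C" and C_ge_1: "1 \<le> C"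
    and U_cont: "continuous_on UNIV (\<lambda>(x, y). U x y)"
    and U_sym: "\<And>x y. norm x = 1 \<Longrightarrow> norm y = 1 \<Longrightarrow> U x y = U y x"
    and U_range: "\<And>x y. norm x = 1 \<Longrightarrow> norm y = 1 \<Longrightarrow> 0 \<le> U x y \<and> U x y \<le> 1"
    and U_refl: "\<And>x. norm x = 1 \<Longrightarrow> U x x = 0"
    and U_far: "\<And>x. norm x = 1 \<Longrightarrow> \<exists>w. norm w = 1 \<and> U x w = 1"
    and convolution_power: "\<And>g k. continuous_on UNIV g \<Longrightarrow> \<exists>q. degree q \<le> k \<and>
      (\<forall>x e. norm x = 1 \<longrightarrow> norm e = 1 \<longrightarrow>
        (\<integral>y. g (U x y) * U e y ^ k \<partial>sphere_measure) = poly q (U x e))"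
    and pearson_sphere: "\<And>x p. norm x = 1 \<Longrightarrow>
      (\<integral>y. poly (pX * pderiv p + [:A, -C:] * p) (U x y) \<partial>sphere_measure) = 0"
begin

lemma continuous_on_U [continuous_intros]:
  "continuous_on T a \<Longrightarrow> continuous_on T b \<Longrightarrow> continuous_on T (\<lambda>z. U (a z) (b z))"
  using continuous_on_compose2[OF U_cont, of T "\<lambda>z. (a z, b z)"]
  by (auto intro: continuous_on_Pair)

lemma continuous_on_comp_U:
  "continuous_on UNIV (g :: real \<Rightarrow> real) \<Longrightarrow> continuous_on T a \<Longrightarrow> continuous_on T b
    \<Longrightarrow> continuous_on T (\<lambda>z. g (U (a z) (b z)))"
  by (rule continuous_on_compose2[of UNIV g]) (auto intro: continuous_on_U)

lemmas U_cont_intros = continuous_on_comp_U continuous_intros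

lemma U_onto:
  assumes x: "norm x = 1" and u: "0 \<le> u" "u \<le> 1"
  shows "\<exists>y. norm y = 1 \<and> U x y = u"
proof -
  obtain w where w: "norm w = 1" "U x w = 1" using U_far[OF x] by blast
  have "connected (U x ` sphere 0 1)"
    by (intro connected_continuous_image connected_sphere DIM_ge_2 continuous_intros)
  moreover have "U x x \<in> U x ` sphere 0 1" "U x w \<in> U x ` sphere 0 1"
    using x w by auto
  then have "0 \<in> U x ` sphere 0 1" "1 \<in> U x ` sphere 0 1"
    using w U_refl[OF x] by simp_all
  ultimately have "u \<in> U x ` sphere 0 1"
    using u by (auto simp: connected_iff_interval)
  then show ?thesis by auto
qed

lemma exists_unit: "\<exists>x::'a. norm x = 1"
  using nonempty_Basis norm_Basis by blast

lemma convolution_poly: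
  assumes g: "continuous_on UNIV g" and p: "degree p \<le> n"
  shows "\<exists>q. degree q \<le> n \<and> (\<forall>x e. norm x = 1 \<longrightarrow> norm e = 1 \<longrightarrow>
        (\<integral>y. g (U x y) * poly p (U e y) \<partial>sphere_measure) = poly q (U x e))"
proof -
  obtain Q where Q: "\<And>k. degree (Q k) \<le> k" "\<And>k x e. norm x = 1 \<Longrightarrow> norm e = 1 \<Longrightarrow>
      (\<integral>y. g (U x y) * U e y ^ k \<partial>sphere_measure) = poly (Q k) (U x e)"
    using convolution_power[OF g] by metis
  define q where "q = (\<Sum>k\<le>n. smult (coeff p k) (Q k))"
  have "degree q \<le> n" unfolding q_def
  proof (rule degree_sum_le, simp)
    fix k assume "k \<in> {..n}"
    then show "degree (smult (coeff p k) (Q k)) \<le> n"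
      using Q(1)[of k] degree_smult_le[of "coeff p k" "Q k"] by simp
  qed
  moreover have "(\<integral>y. g (U x y) * poly p (U e y) \<partial>sphere_measure) = poly q (U x e)"
    if "norm x = 1" "norm e = 1" for x e
  proof -
    have "(\<integral>y. g (U x y) * poly p (U e y) \<partial>sphere_measure)
       = (\<integral>y. (\<Sum>k\<le>n. coeff p k * (g (U x y) * U e y ^ k)) \<partial>sphere_measure)"
    proof (rule Bochner_Integration.integral_cong[OF refl])
      fix y
      have "poly p (U e y) = (\<Sum>k\<le>n. coeff p k * U e y ^ k)"
        unfolding poly_altdef by (rule sum.mono_neutral_left) (use p in \<open>auto simp: coeff_eq_0\<close>)
      then show "g (U x y) * poly p (U e y) = (\<Sum>k\<le>n. coeff p k * (g (U x y) * U e y ^ k))"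
        by (simp add: sum_distrib_left mult_ac)
    qed
    also have "\<dots> = (\<Sum>k\<le>n. coeff p k * (\<integral>y. g (U x y) * U e y ^ k \<partial>sphere_measure))"
      by (subst Bochner_Integration.integral_sum)
         (auto intro!: integrable_mult_right integrable_sphere U_cont_intros g)
    also have "\<dots> = poly q (U x e)"
      using Q(2)[OF that] by (simp add: q_def poly_sum)
    finally show ?thesis .
  qed
  ultimately show ?thesis by blast
qed

definition pole :: 'a where "pole = (SOME x. norm x = 1)"

lemma norm_pole: "norm pole = 1"
  unfolding pole_def using exists_unit by (rule someI_ex)

lemma law_independent:
  fixes g :: "real \<Rightarrow> real"
  assumes "continuous_on UNIV g" "norm x = 1"
  shows "(\<integral>y. g (U x y) \<partial>sphere_measure) = (\<integral>y. g (U pole y) \<partial>sphere_measure)"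
proof -
  obtain q where "degree q \<le> 0" and q: "\<And>x e. norm x = 1 \<Longrightarrow> norm e = 1 \<Longrightarrow>
      (\<integral>y. g (U x y) * U e y ^ 0 \<partial>sphere_measure) = poly q (U x e)"
    using convolution_power[OF assms(1), of 0] by blast
  then obtain c where "q = [:c:]" by (metis le_zero_eq degree_eq_zeroE)
  then show ?thesis using q[OF assms(2) norm_pole] q[OF norm_pole norm_pole] by simp
qed

definition U_law :: "real measure" where
  "U_law = distr sphere_measure borel (U pole)"

lemma U_pole_measurable [measurable]: "U x \<in> borel_measurable borel"
  by (intro borel_measurable_continuous_onI continuous_intros)

lemma integral_U_law:
  fixes g :: "real \<Rightarrow> real"
  assumes "continuous_on UNIV g" "norm x = 1"
  shows "(\<integral>u. g u \<partial>U_law) = (\<integral>y. g (U x y) \<partial>sphere_measure)"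
proof -
  have [measurable]: "g \<in> borel_measurable borel"
    by (rule borel_measurable_continuous_onI[OF assms(1)])
  show ?thesis unfolding U_law_def law_independent[OF assms] by (subst integral_distr) auto
qed

sublocale law: jacobi_measure U_law A C
proof -
  interpret prob_space U_law unfolding U_law_def by (rule sphere.prob_space_distr) simp
  show "jacobi_measure U_law A C"
  proof
    show "sets U_law = sets borel" by (simp add: U_law_def)
    have "AE y in sphere_measure. 0 \<le> U pole y \<and> U pole y \<le> 1"
      using AE_sphere by eventually_elim (use U_range norm_pole in auto)
    then show "AE u in U_law. 0 \<le> u \<and> u \<le> 1"
      unfolding U_law_def by (subst AE_distr_iff) auto
    show "(\<integral>u. poly (pX * pderiv p + [:A, -C:] * p) u \<partial>U_law) = 0" for p
    proof -
      have "(\<integral>u. poly (pX * pderiv p + [:A, -C:] * p) u \<partial>U_law)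
          = (\<integral>y. poly (pX * pderiv p + [:A, -C:] * p) (U pole y) \<partial>sphere_measure)"
        by (rule integral_U_law[OF _ norm_pole]) (intro continuous_intros)
      then show ?thesis by (simp only: pearson_sphere[OF norm_pole])
    qed
    show "measure U_law {a<..<b} > 0" if ab: "0 \<le> a" "a < b" "b \<le> 1" for a b
    proof -
      obtain y where y: "norm y = 1" "U pole y = (a + b) / 2"
        using U_onto[OF norm_pole, of "(a + b) / 2"] ab by auto
      have "open (U pole -` {a<..<b})"
        by (intro open_vimage open_greaterThanLessThan continuous_intros)
      then have "measure sphere_measure (U pole -` {a<..<b}) > 0"
        by (rule sphere_measure_open_pos[OF _ _ y(1)]) (use y ab in auto)
      then show ?thesis unfolding U_law_def by (subst measure_distr) auto
    qed
  qed (rule A_pos A_less_C C_ge_1)+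
qed

text \<open>
The convolution \<open>r\<close> of \<open>jac A C k\<close> with \<open>p\<close> has degree at most that of \<open>p\<close>. Against a polynomial \<open>s\<close> of
degree below \<open>k\<close> it integrates to the product of \<open>jac A C k\<close> with the convolution of \<open>p\<close> and \<open>s\<close>, again
of degree below \<open>k\<close>, so the result is 0. Hence \<open>r\<close> is orthogonal to itself.
\<close>

lemma convolution_jac_lower_degree:
  assumes p: "degree p < k" and x: "norm x = 1" and e: "norm e = 1"
  shows "(\<integral>y. poly (jac A C k) (U x y) * poly p (U e y) \<partial>sphere_measure) = 0"
proof -
  let ?R = "jac A C k"
  obtain r where r: "degree r \<le> degree p" "\<And>x e. norm x = 1 \<Longrightarrow> norm e = 1 \<Longrightarrow>
      (\<integral>y. poly ?R (U x y) * poly p (U e y) \<partial>sphere_measure) = poly r (U x e)"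
    using convolution_poly[OF continuous_on_UNIV_poly[of ?R] order_refl[of "degree p"]] by blast
  have orth: "law.L (r * s) = 0" if s: "degree s < k" for s
  proof -
    obtain t where t: "degree t \<le> degree s" "\<And>x e. norm x = 1 \<Longrightarrow> norm e = 1 \<Longrightarrow>
      (\<integral>y. poly p (U x y) * poly s (U e y) \<partial>sphere_measure) = poly t (U x e)"
      using convolution_poly[OF continuous_on_UNIV_poly[of p] order_refl[of "degree s"]] by blast
    let ?G = "\<lambda>e y. poly ?R (U x y) * poly p (U y e) * poly s (U x e)"
    have G: "continuous_on UNIV (\<lambda>(e, y). ?G e y)" "continuous_on UNIV (\<lambda>(y, e). ?G e y)"
      unfolding case_prod_beta by (intro continuous_intros)+
    have "law.L (r * s) = (\<integral>e. poly r (U x e) * poly s (U x e) \<partial>sphere_measure)"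
      by (subst integral_U_law[OF _ x]) (auto intro!: continuous_intros)
    also have "\<dots> = (\<integral>e. (\<integral>y. ?G e y \<partial>sphere_measure) \<partial>sphere_measure)"
    proof (rule sphere_iterated_integral_cong[OF G(1), symmetric])
      fix e :: 'a assume e: "norm e = 1"
      have "(\<integral>y. poly ?R (U x y) * poly p (U y e) \<partial>sphere_measure)
          = (\<integral>y. poly ?R (U x y) * poly p (U e y) \<partial>sphere_measure)"
        by (rule sphere_integral_cong) (auto intro!: continuous_intros simp: U_sym[OF e])
      then show "(\<integral>y. ?G e y \<partial>sphere_measure) = poly r (U x e) * poly s (U x e)"
        by (simp add: r(2)[OF x e])
    qed (intro continuous_intros)
    also have "\<dots> = (\<integral>y. (\<integral>e. ?G e y \<partial>sphere_measure) \<partial>sphere_measure)"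
      by (rule sphere_Fubini[OF G(1)])
    also have "\<dots> = (\<integral>y. poly ?R (U x y) * poly t (U x y) \<partial>sphere_measure)"
    proof (rule sphere_iterated_integral_cong[OF G(2)])
      fix y :: 'a assume y: "norm y = 1"
      show "(\<integral>e. ?G e y \<partial>sphere_measure) = poly ?R (U x y) * poly t (U x y)"
        using t(2)[OF y x] by (simp add: mult.assoc U_sym[OF x y])
    qed (intro continuous_intros)
    also have "\<dots> = law.L (t * ?R)"
      by (subst integral_U_law[OF _ x]) (auto intro!: continuous_intros simp: mult.commute)
    also have "\<dots> = 0" by (rule law.jac_orthogonal_lower_degree) (use t s in simp)
    finally show ?thesis .
  qed
  have "r = (\<Sum>j\<le>degree p. smult (law.L (r * jac A C j) / jac_norm A C j) (jac A C j))"
    by (rule law.jac_expansion[OF r(1)])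
  also have "\<dots> = 0"
  proof (intro sum.neutral ballI)
    fix j assume "j \<in> {..degree p}"
    then have "law.L (r * jac A C j) = 0"
      using degree_jac_le[of A C j] p by (intro orth) simp
    then show "smult (law.L (r * jac A C j) / jac_norm A C j) (jac A C j) = 0" by simp
  qed
  finally have "r = 0" .
  then show ?thesis using r(2)[OF x e] by simp
qed

text \<open>
The convolution of \<open>g\<close> with \<open>jac A C k\<close> is a polynomial of degree at most \<open>k\<close>, orthogonal to all lower
degrees by the preceding lemma, hence a multiple of \<open>jac A C k\<close>. The factor is read off at \<open>e = x\<close>.
\<close>

lemma Funk_Hecke:
  assumes g: "continuous_on UNIV g" and x: "norm x = 1" and e: "norm e = 1"
  shows "(\<integral>y. g (U x y) * poly (jac A C k) (U e y) \<partial>sphere_measure)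
    = (\<integral>u. g u * poly (jac A C k) u \<partial>U_law) * poly (jac A C k) (U x e)"
proof -
  let ?R = "jac A C k"
  obtain q where q: "degree q \<le> k" "\<And>x e. norm x = 1 \<Longrightarrow> norm e = 1 \<Longrightarrow>
      (\<integral>y. g (U x y) * poly ?R (U e y) \<partial>sphere_measure) = poly q (U x e)"
    using convolution_poly[OF g degree_jac_le] by blast
  have orth: "law.L (q * p) = 0" if p: "degree p < k" for p
  proof -
    let ?G = "\<lambda>e y. g (U x y) * poly ?R (U e y) * poly p (U x e)"
    have G: "continuous_on UNIV (\<lambda>(e, y). ?G e y)" "continuous_on UNIV (\<lambda>(y, e). ?G e y)"
      unfolding case_prod_beta by (intro U_cont_intros g)+
    have "law.L (q * p) = (\<integral>e. poly q (U x e) * poly p (U x e) \<partial>sphere_measure)"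
      by (subst integral_U_law[OF _ x]) (auto intro!: continuous_intros)
    also have "\<dots> = (\<integral>e. (\<integral>y. ?G e y \<partial>sphere_measure) \<partial>sphere_measure)"
      by (rule sphere_iterated_integral_cong[OF G(1), symmetric])
         (intro continuous_intros, simp add: q(2)[OF x])
    also have "\<dots> = (\<integral>y. (\<integral>e. ?G e y \<partial>sphere_measure) \<partial>sphere_measure)"
      by (rule sphere_Fubini[OF G(1)])
    also have "\<dots> = (\<integral>y. 0 \<partial>(sphere_measure :: 'a measure))"
    proof (rule sphere_iterated_integral_cong[OF G(2)])
      fix y :: 'a assume y: "norm y = 1"
      have "(\<integral>e. poly ?R (U e y) * poly p (U x e) \<partial>sphere_measure)
          = (\<integral>e. poly ?R (U y e) * poly p (U x e) \<partial>sphere_measure)"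
        by (rule sphere_integral_cong) (auto intro!: continuous_intros simp: U_sym[OF y])
      also have "\<dots> = 0" by (rule convolution_jac_lower_degree[OF p y x])
      finally show "(\<integral>e. ?G e y \<partial>sphere_measure) = 0" by (simp add: mult.assoc)
    qed (intro continuous_intros)
    finally show ?thesis by simp
  qed
  define c where "c = law.L (q * ?R) / jac_norm A C k"
  have "q = (\<Sum>j\<le>k. smult (law.L (q * jac A C j) / jac_norm A C j) (jac A C j))"
    by (rule law.jac_expansion[OF q(1)])
  also have "\<dots> = (\<Sum>j\<le>k. if j = k then smult c ?R else 0)"
  proof (intro sum.cong refl)
    fix j assume "j \<in> {..k}"
    then show "smult (law.L (q * jac A C j) / jac_norm A C j) (jac A C j)
      = (if j = k then smult c ?R else 0)"
      using orth[of "jac A C j"] degree_jac_le[of A C j] by (cases "j = k") (auto simp: c_def simp del: poly_mult)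
  qed
  also have "\<dots> = smult c ?R" by simp
  finally have qc: "q = smult c ?R" .
  have "c = poly q (U x x)" unfolding U_refl[OF x] qc by simp
  also have "\<dots> = (\<integral>y. g (U x y) * poly ?R (U x y) \<partial>sphere_measure)" using q(2)[OF x x] by simp
  also have "\<dots> = (\<integral>u. g u * poly ?R u \<partial>U_law)"
    by (rule integral_U_law[OF _ x, symmetric]) (intro continuous_intros g)
  finally show ?thesis using q(2)[OF x e] by (simp add: qc)
qed

text \<open>
Integrate the kernel against \<open>h x * h y\<close>, where \<open>h\<close> is the Jacobi polynomial seen from a fixed point. By
the Funk-Hecke formula the nonnegative result is the coefficient times a positive factor.
\<close>

lemma jac_coeff_nonneg:
  assumes g: "continuous_on UNIV g"
    and pos: "\<And>(n::nat) x c. (\<And>i. i < n \<Longrightarrow> norm (x i) = 1) \<Longrightarrow>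
       0 \<le> (\<Sum>i<n. \<Sum>j<n. c i * c j * g (U (x i) (x j)))"
  shows "law.jac_coeff g k \<ge> 0"
proof -
  let ?R = "jac A C k"
  let ?l = "\<integral>u. g u * poly ?R u \<partial>U_law"
  define h where "h x = poly ?R (U pole x)" for x
  have hc: "continuous_on T a \<Longrightarrow> continuous_on T (\<lambda>z. h (a z))" for a :: "'b::topological_space \<Rightarrow> 'a" and T
    unfolding h_def by (intro continuous_intros)
  have G: "continuous_on UNIV (\<lambda>(x, y). g (U x y) * (h x * h y))"
    unfolding case_prod_beta by (intro U_cont_intros g hc)
  have "0 \<le> (\<integral>x. (\<integral>y. g (U x y) * (h x * h y) \<partial>sphere_measure) \<partial>sphere_measure)"
  proof (rule double_integral_nonneg[OF G])
    show "0 \<le> (\<Sum>i<n. \<Sum>j<n. c i * c j * (g (U (x i) (x j)) * (h (x i) * h (x j))))"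
      if "\<And>i. i < n \<Longrightarrow> norm (x i) = 1" for n :: nat and x c
      using pos[of n x "\<lambda>i. c i * h (x i)", OF that] by (simp add: mult_ac)
  qed
  also have "\<dots> = (\<integral>x. ?l * (h x * h x) \<partial>sphere_measure)"
  proof (rule sphere_iterated_integral_cong[OF G])
    fix x :: 'a assume x: "norm x = 1"
    have "(\<integral>y. g (U x y) * h y \<partial>sphere_measure) = ?l * h x"
      unfolding h_def by (simp only: Funk_Hecke[OF g x norm_pole] U_sym[OF x norm_pole])
    then show "(\<integral>y. g (U x y) * (h x * h y) \<partial>sphere_measure) = ?l * (h x * h x)"
      by (simp add: mult.left_commute[of _ "h x"])
  qed (intro continuous_intros hc)
  also have "\<dots> = ?l * law.L (?R * ?R)"
    unfolding h_def by (subst integral_U_law[OF _ norm_pole]) (auto intro!: continuous_intros)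
  also have "\<dots> = ?l * jac_norm A C k" by (simp only: law.L_jac_square)
  finally have "?l \<ge> 0" using law.jac_norm_pos'[of k] by (simp add: zero_le_mult_iff)
  then show ?thesis unfolding law.jac_coeff_def using law.jac_norm_pos'[of k] by simp
qed

theorem positive_definite_class_C:
  assumes F: "continuous_on {0..1} F"
    and pos: "\<And>(n::nat) x c. (\<And>i. i < n \<Longrightarrow> norm (x i) = 1) \<Longrightarrow>
       0 \<le> (\<Sum>i<n. \<Sum>j<n. c i * c j * F (U (x i) (x j)))"
    and m: "2 * real m \<le> 2 * A - 1"
  shows "\<exists>g. class_C m g {0<..<1} \<and> (\<forall>u\<in>{0..1}. g u = F u)"
proof -
  \<comment> \<open>The constant extension is continuous on the whole line and agrees with \<open>F\<close> at all values of \<open>U\<close>.\<close>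
  define g where "g u = F (max 0 (min 1 u))" for u
  have g: "continuous_on UNIV g"
    unfolding g_def by (rule continuous_on_compose2[OF F]) (auto intro!: continuous_intros)
  have gF: "g u = F u" if "u \<in> {0..1}" for u using that by (simp add: g_def)
  have "class_C m g {0<..<1}"
  proof (rule law.class_C_if_jac_coeff_nonneg[OF g _ m])
    fix k show "law.jac_coeff g k \<ge> 0"
    proof (rule jac_coeff_nonneg[OF g])
      fix n :: nat and x :: "nat \<Rightarrow> 'a" and c :: "nat \<Rightarrow> real"
      assume x: "\<And>i. i < n \<Longrightarrow> norm (x i) = 1"
      have "(\<Sum>i<n. \<Sum>j<n. c i * c j * g (U (x i) (x j))) = (\<Sum>i<n. \<Sum>j<n. c i * c j * F (U (x i) (x j)))"
        using U_range x by (intro sum.cong refl) (simp add: gF)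
      then show "0 \<le> (\<Sum>i<n. \<Sum>j<n. c i * c j * g (U (x i) (x j)))"
        using pos[of n x c, OF x] by simp
    qed
  qed
  then show ?thesis using gF by blast
qed

end

section \<open>Convolution by symmetrization\<close>

text \<open>
The polynomial in \<open>u\<close> whose value is \<open>((a + b) ^ k + (a - b) ^ k) / 2\<close> when \<open>a = a0 + a1 * u\<close> and
\<open>b\<^sup>2 = r * u * (1 - u)\<close>. The recursion is the one for power sums of two numbers with sum \<open>2 * a\<close> and
product \<open>a\<^sup>2 - b\<^sup>2\<close>; it shows that the degree in \<open>u\<close> is at most \<open>k\<close> although \<open>b\<close> involves a square root.
\<close>

fun symmetrized_power :: "real \<Rightarrow> real \<Rightarrow> real \<Rightarrow> nat \<Rightarrow> real poly" where
  "symmetrized_power a0 a1 r 0 = 1"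
| "symmetrized_power a0 a1 r (Suc 0) = [:a0, a1:]"
| "symmetrized_power a0 a1 r (Suc (Suc k)) =
     [:2 * a0, 2 * a1:] * symmetrized_power a0 a1 r (Suc k)
     - [:a0\<^sup>2, 2 * a0 * a1 - r, a1\<^sup>2 + r:] * symmetrized_power a0 a1 r k"

lemma poly_symmetrized_power:
  assumes "b\<^sup>2 = r * (u * (1 - u))"
  shows "poly (symmetrized_power a0 a1 r k) u = ((a0 + a1 * u + b) ^ k + (a0 + a1 * u - b) ^ k) / 2"
proof (induction k rule: induct_nat_012)
  case (ge2 k)
  define a where "a = a0 + a1 * u"
  have q: "poly [:a0\<^sup>2, 2 * a0 * a1 - r, a1\<^sup>2 + r:] u = a\<^sup>2 - b\<^sup>2"
    unfolding assms a_def by (simp add: power2_eq_square algebra_simps)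
  have l: "poly [:2 * a0, 2 * a1:] u = 2 * a" by (simp add: a_def algebra_simps)
  show ?case
    unfolding symmetrized_power.simps poly_diff poly_mult q l ge2 a_def[symmetric]
    by (simp add: power2_eq_square field_simps)
qed auto

lemma degree_symmetrized_power: "degree (symmetrized_power a0 a1 r k) \<le> k"
proof (induction a0 a1 r k rule: symmetrized_power.induct)
  case (3 a0 a1 r k)
  have "degree ([:2 * a0, 2 * a1:] * symmetrized_power a0 a1 r (Suc k)) \<le> 1 + Suc k"
    by (rule order_trans[OF degree_mult_le]) (rule add_mono, simp, rule 3)
  moreover have "degree ([:a0\<^sup>2, 2 * a0 * a1 - r, a1\<^sup>2 + r:] * symmetrized_power a0 a1 r k) \<le> 2 + k"
    by (rule order_trans[OF degree_mult_le]) (rule add_mono, simp, rule 3)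
  ultimately show ?case by (auto intro!: degree_diff_le)
qed auto

lemma continuous_on_coeff_symmetrized_power:
  assumes "continuous_on T a0" "continuous_on T a1" "continuous_on T r"
  shows "continuous_on T (\<lambda>y. coeff (symmetrized_power (a0 y) (a1 y) (r y) k) j)"
proof -
  have "\<forall>j. continuous_on T (\<lambda>y. coeff (symmetrized_power (a0 y) (a1 y) (r y) k) j)
      \<and> continuous_on T (\<lambda>y. coeff (symmetrized_power (a0 y) (a1 y) (r y) (Suc k)) j)"
  proof (induction k)
    case 0
    have "continuous_on T (\<lambda>y. coeff [:a0 y, a1 y:] j)" for j
      by (cases j; cases "j - 1") (simp_all add: assms)
    then show ?case by simp
  next
    case (Suc k)
    have m: "coeff ([:c0, c1, c2:] * p) j = c0 * coeff p j + (if j \<ge> 1 then c1 * coeff p (j - 1) else 0)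
         + (if j \<ge> 2 then c2 * coeff p (j - 2) else 0)" for c0 c1 c2 :: real and p j
      by (cases j; cases "j - 1") (auto simp: numeral_2_eq_2)
    have m1: "[:c0, c1:] = [:c0, c1, 0 :: real:]" for c0 c1 by simp
    have "continuous_on T (\<lambda>y. coeff (symmetrized_power (a0 y) (a1 y) (r y) (Suc (Suc k))) j)" for j
    proof -
      have cS: "continuous_on T (\<lambda>y. if P then f y else (0 :: real))" if "continuous_on T f" for P f
        using that by (cases P) auto
      show ?thesis
        unfolding symmetrized_power.simps coeff_diff
        by (subst m1, unfold m) (intro continuous_intros cS assms Suc[rule_format, THEN conjunct1] Suc[rule_format, THEN conjunct2])
    qed
    then show ?case using Suc by blast
  qed
  then show ?thesis by blast
qed

lemma symmetrized_integral_polynomial: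
  fixes g a0 a1 r :: "'a::euclidean_space \<Rightarrow> real"
  assumes g: "continuous_on UNIV g"
    and a: "continuous_on UNIV a0" "continuous_on UNIV a1" "continuous_on UNIV r"
  shows "\<exists>q. degree q \<le> k \<and> (\<forall>u b. (\<forall>y. (b y)\<^sup>2 = r y * (u * (1 - u))) \<longrightarrow>
     (\<integral>y. g y * (((a0 y + a1 y * u + b y) ^ k + (a0 y + a1 y * u - b y) ^ k) / 2) \<partial>sphere_measure)
       = poly q u)"
proof -
  define P where "P y = symmetrized_power (a0 y) (a1 y) (r y) k" for y
  define q where "q = (\<Sum>j\<le>k. monom (\<integral>y. g y * coeff (P y) j \<partial>sphere_measure) j)"
  have c: "continuous_on UNIV (\<lambda>y. g y * coeff (P y) j)" for j
    unfolding P_def by (intro continuous_intros g continuous_on_coeff_symmetrized_power a)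
  have "degree q \<le> k" unfolding q_def
    by (rule degree_sum_le) (auto intro: order_trans[OF degree_monom_le])
  moreover have "(\<integral>y. g y * (((a0 y + a1 y * u + b y) ^ k + (a0 y + a1 y * u - b y) ^ k) / 2) \<partial>sphere_measure)
      = poly q u" if b: "\<And>y. (b y)\<^sup>2 = r y * (u * (1 - u))" for u b
  proof -
    have "(\<integral>y. g y * (((a0 y + a1 y * u + b y) ^ k + (a0 y + a1 y * u - b y) ^ k) / 2) \<partial>sphere_measure)
        = (\<integral>y. (\<Sum>j\<le>k. g y * coeff (P y) j * u ^ j) \<partial>sphere_measure)"
    proof (rule Bochner_Integration.integral_cong[OF refl])
      fix y
      have "poly (P y) u = (\<Sum>j\<le>k. coeff (P y) j * u ^ j)"
        unfolding poly_altdef P_def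
        by (rule sum.mono_neutral_left) (use degree_symmetrized_power in \<open>auto simp: coeff_eq_0\<close>)
      then show "g y * (((a0 y + a1 y * u + b y) ^ k + (a0 y + a1 y * u - b y) ^ k) / 2)
          = (\<Sum>j\<le>k. g y * coeff (P y) j * u ^ j)"
        using poly_symmetrized_power[OF b[of y], of "a0 y" "a1 y" k]
        by (simp add: P_def[symmetric] sum_distrib_left[symmetric] mult.assoc)
    qed
    also have "\<dots> = (\<Sum>j\<le>k. (\<integral>y. g y * coeff (P y) j \<partial>sphere_measure) * u ^ j)"
      by (subst Bochner_Integration.integral_sum)
         (auto intro!: integrable_mult_left integrable_sphere c)
    also have "\<dots> = poly q u" by (simp add: q_def poly_sum poly_monom)
    finally show ?thesis .
  qed
  ultimately show ?thesis by blast
qed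

section \<open>Integration by parts along rotations\<close>

definition plane_rotation :: "'a::euclidean_space \<Rightarrow> 'a \<Rightarrow> real \<Rightarrow> 'a \<Rightarrow> 'a" where
  "plane_rotation b c t y = y + ((cos t - 1) * (y \<bullet> b) - sin t * (y \<bullet> c)) *\<^sub>R b
      + ((cos t - 1) * (y \<bullet> c) + sin t * (y \<bullet> b)) *\<^sub>R c"

lemma plane_rotation_inner:
  assumes "b \<in> Basis" "c \<in> Basis" "b \<noteq> c" "z \<in> Basis"
  shows "plane_rotation b c t y \<bullet> z =
    (if z = b then cos t * (y \<bullet> b) - sin t * (y \<bullet> c)
     else if z = c then cos t * (y \<bullet> c) + sin t * (y \<bullet> b) else y \<bullet> z)"
  using assms by (auto simp: plane_rotation_def inner_add_left inner_Basis algebra_simps)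

lemma orthogonal_transformation_plane_rotation:
  assumes bc: "b \<in> Basis" "c \<in> Basis" "b \<noteq> c"
  shows "orthogonal_transformation (plane_rotation b c t)"
  unfolding orthogonal_transformation_def
proof (intro conjI allI)
  show "linear (plane_rotation b c t)"
    by (rule linearI) (simp_all add: plane_rotation_def inner_add_left algebra_simps)
  fix v w :: 'a
  have bb: "b \<bullet> b = 1" "c \<bullet> c = 1" "b \<bullet> c = 0" "c \<bullet> b = 0" using bc by (auto simp: inner_Basis)
  have s: "sin t * sin t = 1 - cos t * cos t" using sin_squared_eq[of t] by (simp add: power2_eq_square)
  define vb vc wb wc where "vb = v \<bullet> b" and "vc = v \<bullet> c" and "wb = w \<bullet> b" and "wc = w \<bullet> c"
  define C S where "C = cos t - 1" and "S = sin t"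
  have s': "S * S = - (C * C + 2 * C)" using s by (simp add: C_def S_def algebra_simps)
  have "plane_rotation b c t v \<bullet> plane_rotation b c t w =
     v \<bullet> w + vb * (C * wb - S * wc) + vc * (C * wc + S * wb)
     + (C * vb - S * vc) * wb + (C * vc + S * vb) * wc
     + (C * vb - S * vc) * (C * wb - S * wc) + (C * vc + S * vb) * (C * wc + S * wb)"
    unfolding plane_rotation_def vb_def[symmetric] vc_def[symmetric] wb_def[symmetric] wc_def[symmetric]
      C_def[symmetric] S_def[symmetric]
    by (simp add: inner_add_left inner_add_right bb inner_commute[of b w] inner_commute[of c w] algebra_simps
        vb_def[symmetric] vc_def[symmetric] wb_def[symmetric] wc_def[symmetric])
  also have "\<dots> = v \<bullet> w + (2 * C + C * C + S * S) * (vb * wb + vc * wc)"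
    by (simp add: algebra_simps)
  also have "\<dots> = v \<bullet> w" by (simp add: s')
  finally show "plane_rotation b c t v \<bullet> plane_rotation b c t w = v \<bullet> w" .
qed

text \<open>
The mean of \<open>h\<close> does not change under rotations, so the mean of its difference quotients is 0. They
converge to \<open>X\<close> and are bounded by the supremum of \<open>\<bar>X\<bar>\<close> on the sphere, by the mean value theorem.
\<close>

lemma rotation_derivative_integral_zero:
  fixes h X :: "'a::euclidean_space \<Rightarrow> real"
  assumes bc: "b \<in> Basis" "c \<in> Basis" "b \<noteq> c"
    and h: "continuous_on UNIV h" and X: "continuous_on UNIV X"
    and D: "\<And>y t. ((\<lambda>t. h (plane_rotation b c t y)) has_real_derivative X (plane_rotation b c t y)) (at t)"
  shows "(\<integral>y. X y \<partial>sphere_measure) = 0"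
proof -
  let ?R = "plane_rotation b c"
  note orth = orthogonal_transformation_plane_rotation[OF bc]
  have R0: "?R 0 y = y" for y by (simp add: plane_rotation_def)
  have hm [measurable]: "h \<in> borel_measurable borel" by (rule borel_measurable_continuous_onI[OF h])
  have Xm [measurable]: "X \<in> borel_measurable borel" by (rule borel_measurable_continuous_onI[OF X])
  have Rm [measurable]: "?R t \<in> borel_measurable borel" for t
    by (rule orthogonal_transformation_measurable[OF orth])
  have "bounded (X ` sphere 0 1)"
    by (intro compact_imp_bounded compact_continuous_image continuous_on_subset[OF X]) auto
  then obtain B where B: "\<forall>x\<in>X ` sphere 0 1. norm x \<le> B" unfolding bounded_iff by blast
  define Q where "Q n y = (h (?R (1 / real (Suc n)) y) - h y) / (1 / real (Suc n))" for n y
  have "(\<lambda>n. \<integral>y. Q n y \<partial>sphere_measure) \<longlonglongrightarrow> (\<integral>y. X y \<partial>sphere_measure)"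
  proof (rule integral_dominated_convergence[where w = "\<lambda>_. B"])
    show "X \<in> borel_measurable sphere_measure" "Q n \<in> borel_measurable sphere_measure" for n
      unfolding Q_def by (simp_all cong: measurable_cong_sets)
    show "AE y in sphere_measure. (\<lambda>n. Q n y) \<longlonglongrightarrow> X y"
    proof (rule AE_I2)
      fix y
      have "((\<lambda>t. (h (?R t y) - h (?R 0 y)) / (t - 0)) \<longlongrightarrow> X (?R 0 y)) (at 0)"
        using D[of y 0] by (simp add: has_field_derivative_iff)
      moreover have "filterlim (\<lambda>n. 1 / real (Suc n)) (at 0) sequentially"
        using LIMSEQ_Suc[OF lim_1_over_n] unfolding filterlim_at by auto
      ultimately have "(\<lambda>n. (h (?R (1 / real (Suc n)) y) - h (?R 0 y)) / (1 / real (Suc n) - 0)) \<longlonglongrightarrow> X (?R 0 y)"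
        by (rule filterlim_compose)
      then show "(\<lambda>n. Q n y) \<longlonglongrightarrow> X y" by (simp add: R0 Q_def)
    qed
    show "AE y in sphere_measure. norm (Q n y) \<le> B" for n
      using AE_sphere
    proof eventually_elim
      fix y :: 'a assume y: "norm y = 1"
      define t where "t = 1 / real (Suc n)"
      have t: "0 < t" by (simp add: t_def)
      obtain z where "h (?R t y) - h (?R 0 y) = (t - 0) * X (?R z y)"
        using MVT2[OF t, of "\<lambda>t. h (?R t y)" "\<lambda>t. X (?R t y)"] D by blast
      moreover have "Q n y = (h (?R t y) - h y) / t" by (simp only: Q_def t_def)
      ultimately have "Q n y = X (?R z y)" using t by (simp add: R0)
      moreover have "norm (?R z y) = 1" using orthogonal_transformation_norm[OF orth] y by simp
      ultimately show "norm (Q n y) \<le> B" using B by auto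
    qed
  qed simp
  moreover have "(\<integral>y. Q n y \<partial>sphere_measure) = 0" for n
  proof -
    have i1: "integrable sphere_measure (\<lambda>y. h (?R (1 / real (Suc n)) y))"
      by (intro integrable_sphere continuous_on_compose2[OF h]
        linear_continuous_on linear_conv_bounded_linear[THEN iffD1] orthogonal_transformation_linear orth) auto
    show ?thesis unfolding Q_def using i1 integrable_sphere[OF h]
        sphere_integral_orthogonal[OF orth hm, of "1 / real (Suc n)"]
      by simp
  qed
  ultimately show ?thesis by (simp add: LIMSEQ_const_iff)
qed

lemma sum_Basis_squares: "(\<Sum>b\<in>Basis. (y \<bullet> b)\<^sup>2) = (norm (y::'a::euclidean_space))\<^sup>2"
  unfolding power2_norm_eq_inner by (subst euclidean_inner) (simp add: power2_eq_square)

text \<open>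
For \<open>b \<in> I\<close> and \<open>c \<notin> I\<close> differentiate \<open>p (V y) * (y \<bullet> b) * (y \<bullet> c)\<close> along the rotation in the plane of
\<open>b\<close> and \<open>c\<close>, and sum over all such pairs. On the unit sphere the squared coordinates inside and outside
\<open>I\<close> sum to \<open>V\<close> and \<open>1 - V\<close>, so the sum is a function of \<open>V\<close>.
\<close>

lemma pearson_squares:
  fixes I :: "'a::euclidean_space set" and p :: "real poly"
  assumes I: "I \<subseteq> Basis"
  defines "V \<equiv> \<lambda>y. \<Sum>b\<in>I. (y \<bullet> b)\<^sup>2"
  shows "(\<integral>y. (real DIM('a) * V y - real (card I)) * poly p (V y)
      - 2 * (V y * (1 - V y)) * poly (pderiv p) (V y) \<partial>sphere_measure) = 0"
proof -
  have fin: "finite I" using I finite_Basis finite_subset by blast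
  define X where "X b c y = ((y \<bullet> b)\<^sup>2 - (y \<bullet> c)\<^sup>2) * poly p (V y)
      - 2 * ((y \<bullet> b)\<^sup>2 * (y \<bullet> c)\<^sup>2) * poly (pderiv p) (V y)" for b c y
  have Xc: "continuous_on UNIV (X b c)" for b c
    unfolding X_def V_def by (intro continuous_intros)
  have zero: "(\<integral>y. X b c y \<partial>sphere_measure) = 0" if b: "b \<in> I" and c: "c \<in> Basis - I" for b c
  proof (rule rotation_derivative_integral_zero[where b = b and c = c and h = "\<lambda>y. poly p (V y) * ((y \<bullet> b) * (y \<bullet> c))"])
    let ?R = "plane_rotation b c"
    show bc: "b \<in> Basis" "c \<in> Basis" "b \<noteq> c" using that I by auto
    show "continuous_on UNIV (\<lambda>y. poly p (V y) * ((y \<bullet> b) * (y \<bullet> c)))"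
      unfolding V_def by (intro continuous_intros)
    show "continuous_on UNIV (X b c)" by (rule Xc)
    fix y t
    define K where "K = (\<Sum>z\<in>I - {b}. (y \<bullet> z)\<^sup>2)"
    have Rb: "?R t y \<bullet> b = cos t * (y \<bullet> b) - sin t * (y \<bullet> c)" for t
      using bc by (simp add: plane_rotation_inner)
    have Rc: "?R t y \<bullet> c = cos t * (y \<bullet> c) + sin t * (y \<bullet> b)" for t
      using bc by (simp add: plane_rotation_inner)
    have VR: "V (?R t y) = (cos t * (y \<bullet> b) - sin t * (y \<bullet> c))\<^sup>2 + K" for t
    proof -
      have "(\<Sum>z\<in>I - {b}. (?R t y \<bullet> z)\<^sup>2) = K"
        unfolding K_def using bc I c by (intro sum.cong refl) (auto simp: plane_rotation_inner subset_eq)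
      then show ?thesis unfolding V_def by (subst sum.remove[OF fin b]) (simp add: Rb)
    qed
    have d1: "((\<lambda>t. cos t * (y \<bullet> b) - sin t * (y \<bullet> c)) has_real_derivative
        - (cos t * (y \<bullet> c) + sin t * (y \<bullet> b))) (at t)"
      by (auto intro!: derivative_eq_intros)
    have d2: "((\<lambda>t. cos t * (y \<bullet> c) + sin t * (y \<bullet> b)) has_real_derivative
        (cos t * (y \<bullet> b) - sin t * (y \<bullet> c))) (at t)"
      by (auto intro!: derivative_eq_intros)
    define \<alpha> \<gamma> where "\<alpha> t = cos t * (y \<bullet> b) - sin t * (y \<bullet> c)"
      and "\<gamma> t = cos t * (y \<bullet> c) + sin t * (y \<bullet> b)" for t
    have da: "(\<alpha> has_real_derivative - \<gamma> t) (at t)" and dc: "(\<gamma> has_real_derivative \<alpha> t) (at t)"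
      using d1 d2 unfolding \<alpha>_def \<gamma>_def by auto
    have dV: "((\<lambda>t. (\<alpha> t)\<^sup>2 + K) has_real_derivative - 2 * \<alpha> t * \<gamma> t) (at t)"
      by (auto intro!: derivative_eq_intros da)
    have dp: "((\<lambda>t. poly p ((\<alpha> t)\<^sup>2 + K)) has_real_derivative
        poly (pderiv p) ((\<alpha> t)\<^sup>2 + K) * (- 2 * \<alpha> t * \<gamma> t)) (at t)"
      by (rule DERIV_chain2[OF poly_DERIV dV])
    have "((\<lambda>t. poly p ((\<alpha> t)\<^sup>2 + K) * (\<alpha> t * \<gamma> t)) has_real_derivative
       ((\<alpha> t)\<^sup>2 - (\<gamma> t)\<^sup>2) * poly p ((\<alpha> t)\<^sup>2 + K) - 2 * ((\<alpha> t)\<^sup>2 * (\<gamma> t)\<^sup>2) * poly (pderiv p) ((\<alpha> t)\<^sup>2 + K)) (at t)"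
      by (rule derivative_eq_intros dp da dc refl)+ (simp add: power2_eq_square algebra_simps)
    then show "((\<lambda>t. poly p (V (?R t y)) * ((?R t y \<bullet> b) * (?R t y \<bullet> c))) has_real_derivative X b c (?R t y)) (at t)"
      unfolding X_def VR Rb Rc \<alpha>_def \<gamma>_def .
  qed
  have "(\<integral>y. (real DIM('a) * V y - real (card I)) * poly p (V y)
      - 2 * (V y * (1 - V y)) * poly (pderiv p) (V y) \<partial>sphere_measure)
     = (\<integral>y. (\<Sum>b\<in>I. \<Sum>c\<in>Basis - I. X b c y) \<partial>sphere_measure)"
  proof (rule sphere_integral_cong)
    show "continuous_on UNIV (\<lambda>y. \<Sum>b\<in>I. \<Sum>c\<in>Basis - I. X b c y)"
      by (intro continuous_intros Xc)
    show "continuous_on UNIV (\<lambda>y. (real DIM('a) * V y - real (card I)) * poly p (V y)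
      - 2 * (V y * (1 - V y)) * poly (pderiv p) (V y))"
      unfolding V_def by (intro continuous_intros)
    fix y :: 'a assume y: "norm y = 1"
    have W: "(\<Sum>c\<in>Basis - I. (y \<bullet> c)\<^sup>2) = 1 - V y"
      using sum_Basis_squares[of y] y sum.subset_diff[OF I finite_Basis, of "\<lambda>b. (y \<bullet> b)\<^sup>2"]
      by (simp add: V_def)
    have cd: "real (card (Basis - I)) = real DIM('a) - real (card I)"
      using card_Diff_subset[OF fin I] card_mono[OF finite_Basis I] by (simp add: of_nat_diff)
    define P P' W where "P = poly p (V y)" and "P' = poly (pderiv p) (V y)"
      and "W = (\<Sum>c\<in>Basis - I. (y \<bullet> c)\<^sup>2)"
    have inner: "(\<Sum>c\<in>Basis - I. X b c y) =
       (real (card (Basis - I)) * (y \<bullet> b)\<^sup>2 - W) * P - 2 * ((y \<bullet> b)\<^sup>2 * W) * P'" for b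
      unfolding X_def P_def[symmetric] P'_def[symmetric] W_def
      by (simp only: sum_subtractf sum_distrib_left[symmetric] sum_distrib_right[symmetric] sum_constant)
    have "(\<Sum>b\<in>I. \<Sum>c\<in>Basis - I. X b c y) =
       (real (card (Basis - I)) * V y - real (card I) * W) * P - 2 * (V y * W) * P'"
      unfolding inner V_def
      by (simp only: sum_subtractf sum_distrib_left[symmetric] sum_distrib_right[symmetric] sum_constant)
    then have "(\<Sum>b\<in>I. \<Sum>c\<in>Basis - I. X b c y) =
       (real (card (Basis - I)) * V y - real (card I) * (1 - V y)) * poly p (V y)
        - 2 * (V y * (1 - V y)) * poly (pderiv p) (V y)"
      unfolding P_def P'_def W_def W .
    then show "(real DIM('a) * V y - real (card I)) * poly p (V y)
      - 2 * (V y * (1 - V y)) * poly (pderiv p) (V y) = (\<Sum>b\<in>I. \<Sum>c\<in>Basis - I. X b c y)"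
      unfolding cd by (simp add: algebra_simps)
  qed
  also have "\<dots> = (\<Sum>b\<in>I. \<Sum>c\<in>Basis - I. (\<integral>y. X b c y \<partial>sphere_measure))"
    by (subst Bochner_Integration.integral_sum, (intro integrable_sphere continuous_intros Xc))
       (intro sum.cong refl Bochner_Integration.integral_sum integrable_sphere Xc)
  also have "\<dots> = 0" using zero by simp
  finally show ?thesis .
qed

text \<open>
The same with \<open>p (y \<bullet> b) * (y \<bullet> c)\<close>, summed over the basis vectors \<open>c\<close> other than \<open>b\<close>.
\<close>

lemma pearson_linear:
  fixes b :: "'a::euclidean_space" and p :: "real poly"
  assumes b: "b \<in> Basis"
  shows "(\<integral>y. (real DIM('a) - 1) * ((y \<bullet> b) * poly p (y \<bullet> b))
      - (1 - (y \<bullet> b)\<^sup>2) * poly (pderiv p) (y \<bullet> b) \<partial>sphere_measure) = 0"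
proof -
  define X where "X c y = (y \<bullet> b) * poly p (y \<bullet> b) - (y \<bullet> c)\<^sup>2 * poly (pderiv p) (y \<bullet> b)" for c y
  have Xc: "continuous_on UNIV (X c)" for c
    unfolding X_def by (intro continuous_intros)
  have zero: "(\<integral>y. X c y \<partial>sphere_measure) = 0" if c: "c \<in> Basis - {b}" for c
  proof (rule rotation_derivative_integral_zero[where b = b and c = c and h = "\<lambda>y. poly p (y \<bullet> b) * (y \<bullet> c)"])
    let ?R = "plane_rotation b c"
    show bc: "b \<in> Basis" "c \<in> Basis" "b \<noteq> c" using that b by auto
    show "continuous_on UNIV (\<lambda>y. poly p (y \<bullet> b) * (y \<bullet> c))" by (intro continuous_intros)
    show "continuous_on UNIV (X c)" by (rule Xc)
    fix y t
    define \<alpha> \<gamma> where "\<alpha> t = ?R t y \<bullet> b" and "\<gamma> t = ?R t y \<bullet> c" for t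
    have da: "(\<alpha> has_real_derivative - \<gamma> t) (at t)" and dc: "(\<gamma> has_real_derivative \<alpha> t) (at t)"
      unfolding \<alpha>_def \<gamma>_def using bc
      by (auto simp: plane_rotation_inner intro!: derivative_eq_intros)
    have dp: "((\<lambda>t. poly p (\<alpha> t)) has_real_derivative poly (pderiv p) (\<alpha> t) * (- \<gamma> t)) (at t)"
      by (rule DERIV_chain2[OF poly_DERIV da])
    have "((\<lambda>t. poly p (\<alpha> t) * \<gamma> t) has_real_derivative
       \<alpha> t * poly p (\<alpha> t) - (\<gamma> t)\<^sup>2 * poly (pderiv p) (\<alpha> t)) (at t)"
      by (rule derivative_eq_intros dp da dc refl)+ (simp add: power2_eq_square algebra_simps)
    then show "((\<lambda>t. poly p (?R t y \<bullet> b) * (?R t y \<bullet> c)) has_real_derivative X c (?R t y)) (at t)"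
      unfolding X_def \<alpha>_def \<gamma>_def .
  qed
  have "(\<integral>y. (real DIM('a) - 1) * ((y \<bullet> b) * poly p (y \<bullet> b))
      - (1 - (y \<bullet> b)\<^sup>2) * poly (pderiv p) (y \<bullet> b) \<partial>sphere_measure)
     = (\<integral>y. (\<Sum>c\<in>Basis - {b}. X c y) \<partial>sphere_measure)"
  proof (rule sphere_integral_cong)
    show "continuous_on UNIV (\<lambda>y. \<Sum>c\<in>Basis - {b}. X c y)" by (intro continuous_intros Xc)
    show "continuous_on UNIV (\<lambda>y. (real DIM('a) - 1) * ((y \<bullet> b) * poly p (y \<bullet> b))
      - (1 - (y \<bullet> b)\<^sup>2) * poly (pderiv p) (y \<bullet> b))" by (intro continuous_intros)
    fix y :: 'a assume y: "norm y = 1"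
    have W: "(\<Sum>c\<in>Basis - {b}. (y \<bullet> c)\<^sup>2) = 1 - (y \<bullet> b)\<^sup>2"
      using sum_Basis_squares[of y] y b by (simp add: sum.remove[OF finite_Basis b])
    have cd: "real (card (Basis - {b})) = real DIM('a) - 1"
      using b card_Diff_singleton[OF b] DIM_positive[where 'a='a] by (simp add: of_nat_diff)
    show "(real DIM('a) - 1) * ((y \<bullet> b) * poly p (y \<bullet> b))
      - (1 - (y \<bullet> b)\<^sup>2) * poly (pderiv p) (y \<bullet> b) = (\<Sum>c\<in>Basis - {b}. X c y)"
      unfolding X_def W[symmetric] cd[symmetric] by (simp add: sum_subtractf sum_distrib_right)
  qed
  also have "\<dots> = (\<Sum>c\<in>Basis - {b}. (\<integral>y. X c y \<partial>sphere_measure))"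
    by (intro Bochner_Integration.integral_sum integrable_sphere Xc)
  also have "\<dots> = 0" using zero by simp
  finally show ?thesis .
qed

text \<open>
In the applications the sign of the square root \<open>b\<close> can be changed by reversing a vector of an
orthonormal frame, so the two integrals agree and equal their average.
\<close>

lemma convolution_from_symmetrization:
  fixes g a0 a1 r :: "'a::euclidean_space \<Rightarrow> real"
  assumes g: "continuous_on UNIV g"
    and a: "continuous_on UNIV a0" "continuous_on UNIV a1" "continuous_on UNIV r"
  shows "\<exists>q. degree q \<le> k \<and> (\<forall>u b I. continuous_on UNIV b \<longrightarrow> (\<forall>y. (b y)\<^sup>2 = r y * (u * (1 - u))) \<longrightarrow>
     I = (\<integral>y. g y * (a0 y + a1 y * u + b y) ^ k \<partial>sphere_measure) \<longrightarrow>
     I = (\<integral>y. g y * (a0 y + a1 y * u - b y) ^ k \<partial>sphere_measure) \<longrightarrow> I = poly q u)"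
proof -
  obtain q where q: "degree q \<le> k" "\<And>u b. (\<And>y. (b y)\<^sup>2 = r y * (u * (1 - u))) \<Longrightarrow>
     (\<integral>y. g y * (((a0 y + a1 y * u + b y) ^ k + (a0 y + a1 y * u - b y) ^ k) / 2) \<partial>sphere_measure)
       = poly q u"
    using symmetrized_integral_polynomial[OF g a, of k] by blast
  have "I = poly q u"
    if b: "continuous_on UNIV b" "\<And>y. (b y)\<^sup>2 = r y * (u * (1 - u))"
      and I: "I = (\<integral>y. g y * (a0 y + a1 y * u + b y) ^ k \<partial>sphere_measure)"
      "I = (\<integral>y. g y * (a0 y + a1 y * u - b y) ^ k \<partial>sphere_measure)" for u b I
  proof -
    have int: "integrable sphere_measure (\<lambda>y. g y * (a0 y + a1 y * u + b y) ^ k)"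
      "integrable sphere_measure (\<lambda>y. g y * (a0 y + a1 y * u - b y) ^ k)"
      by (intro integrable_sphere continuous_intros g a b)+
    have "poly q u = (\<integral>y. (g y * (a0 y + a1 y * u + b y) ^ k + g y * (a0 y + a1 y * u - b y) ^ k) / 2 \<partial>sphere_measure)"
      unfolding q(2)[OF b(2), symmetric]
      by (intro Bochner_Integration.integral_cong refl) (simp add: field_simps)
    also have "\<dots> = (I + I) / 2"
      using int I by simp
    finally show ?thesis by simp
  qed
  then show ?thesis using q(1) by blast
qed

lemma inner_orthogonal_image:
  fixes T :: "'a::euclidean_space \<Rightarrow> 'a"
  assumes "orthogonal_transformation T" "T v = w"
  shows "T y \<bullet> w = y \<bullet> v"
  using assms by (auto simp: orthogonal_transformation_def)

section \<open>Spheres\<close>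

definition sphere_U :: "'a::euclidean_space \<Rightarrow> 'a \<Rightarrow> real" where
  "sphere_U x y = (1 - x \<bullet> y) / 2"

lemma orthonormal_frame_pair:
  fixes x w :: "'a::euclidean_space"
  assumes "norm x = 1" "norm w = 1" "x \<bullet> w = 0"
  shows "orthonormal_frame 2 (\<lambda>i. if i = 0 then x else w)"
  using assms by (auto simp: orthonormal_frame_def norm_eq_1 inner_commute less_2_cases_iff)

lemma unit_decomposition:
  fixes x e :: "'a::euclidean_space"
  assumes D: "2 \<le> DIM('a)" and x: "norm x = 1" and e: "norm e = 1"
  shows "\<exists>w c. norm w = 1 \<and> x \<bullet> w = 0 \<and> e = (x \<bullet> e) *\<^sub>R x + c *\<^sub>R w \<and> c\<^sup>2 = 1 - (x \<bullet> e)\<^sup>2"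
proof -
  define z where "z = e - (x \<bullet> e) *\<^sub>R x"
  have xx: "x \<bullet> x = 1" "e \<bullet> e = 1" using x e by (simp_all add: norm_eq_1)
  have xz: "x \<bullet> z = 0" by (simp add: z_def inner_diff_right xx)
  have zz: "(norm z)\<^sup>2 = 1 - (x \<bullet> e)\<^sup>2"
    unfolding power2_norm_eq_inner z_def
    by (simp add: inner_diff_left inner_diff_right xx inner_commute[of e x] power2_eq_square)
  show ?thesis
  proof (cases "z = 0")
    case True
    obtain y :: 'a where y: "y \<noteq> 0" "orthogonal x y"
      using orthogonal_to_vector_exists[OF D] by blast
    have "norm (y /\<^sub>R norm y) = 1" "x \<bullet> (y /\<^sub>R norm y) = 0"
      using y by (auto simp: orthogonal_def)
    then show ?thesis using True zz
      by (intro exI[of _ "y /\<^sub>R norm y"] exI[of _ 0]) (auto simp: z_def)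
  next
    case False
    then have "norm (z /\<^sub>R norm z) = 1" "x \<bullet> (z /\<^sub>R norm z) = 0" using xz by auto
    moreover have "e = (x \<bullet> e) *\<^sub>R x + norm z *\<^sub>R (z /\<^sub>R norm z)"
      using False by (simp add: z_def)
    ultimately show ?thesis using zz by blast
  qed
qed

text \<open>
For the convolution write \<open>e\<close> as a combination of \<open>x\<close> and an orthogonal unit vector \<open>w\<close>. An orthogonal map takes
a fixed orthonormal pair to \<open>x, w\<close> or to \<open>x, - w\<close>; in the fixed coordinates \<open>sphere_U e\<close> is
\<open>a0 + a1 * u\<close> plus or minus a term with square \<open>u * (1 - u)\<close> times a squared coordinate.
\<close>

lemma sphere_zonal_space:
  assumes D: "2 \<le> DIM('a)"
  shows "zonal_space (sphere_U :: 'a::euclidean_space \<Rightarrow> 'a \<Rightarrow> real) ((real DIM('a) - 1) / 2) (real DIM('a) - 1)"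
proof
  show "2 \<le> DIM('a)" by (rule D)
  show "0 < (real DIM('a) - 1) / 2" "(real DIM('a) - 1) / 2 < real DIM('a) - 1" "1 \<le> real DIM('a) - 1"
    using D by auto
  show "continuous_on UNIV (\<lambda>(x, y). sphere_U x (y::'a))"
    unfolding sphere_U_def case_prod_beta by (intro continuous_intros) auto
  show "sphere_U x y = sphere_U y x" for x y :: 'a by (simp add: sphere_U_def inner_commute)
  show "0 \<le> sphere_U x y \<and> sphere_U x y \<le> 1" if "norm x = 1" "norm y = 1" for x y :: 'a
    using Cauchy_Schwarz_ineq2[of x y] that by (auto simp: sphere_U_def abs_le_iff)
  show "sphere_U x x = 0" if "norm x = 1" for x :: 'a
    using that by (simp add: sphere_U_def norm_eq_1)
  show "\<exists>w. norm w = 1 \<and> sphere_U x w = 1" if "norm x = 1" for x :: 'a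
    using that by (intro exI[of _ "- x"]) (simp add: sphere_U_def norm_eq_1)
  obtain b0 :: 'a where b0: "norm b0 = 1" using norm_Basis nonempty_Basis by blast
  obtain b1 :: 'a where b1: "norm b1 = 1" "b0 \<bullet> b1 = 0"
    using unit_decomposition[OF D b0 b0] by blast
  show "\<exists>q. degree q \<le> k \<and> (\<forall>x e. norm x = 1 \<longrightarrow> norm e = 1 \<longrightarrow>
        (\<integral>y. g (sphere_U x y) * sphere_U e y ^ k \<partial>sphere_measure) = poly q (sphere_U x (e::'a)))"
    if g: "continuous_on UNIV g" for g k
  proof -
    define G where "G y = g ((1 - y \<bullet> b0) / 2)" for y
    define a0 a1 r where "a0 y = (1 - y \<bullet> b0) / 2" and "a1 y = y \<bullet> b0" and "r y = (y \<bullet> b1)\<^sup>2" for y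
    have cont: "continuous_on UNIV G" "continuous_on UNIV a0" "continuous_on UNIV a1" "continuous_on UNIV r"
      unfolding G_def a0_def a1_def r_def
      by (intro continuous_on_compose2[OF g] continuous_intros; auto)+
    obtain q where q: "degree q \<le> k" "\<And>u b I. continuous_on UNIV b \<Longrightarrow> (\<And>y. (b y)\<^sup>2 = r y * (u * (1 - u))) \<Longrightarrow>
     I = (\<integral>y. G y * (a0 y + a1 y * u + b y) ^ k \<partial>sphere_measure) \<Longrightarrow>
     I = (\<integral>y. G y * (a0 y + a1 y * u - b y) ^ k \<partial>sphere_measure) \<Longrightarrow> I = poly q u"
      using convolution_from_symmetrization[OF cont, of k] by blast
    have "(\<integral>y. g (sphere_U x y) * sphere_U e y ^ k \<partial>sphere_measure) = poly q (sphere_U x e)"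
      if x: "norm x = 1" and e: "norm e = 1" for x e :: 'a
    proof -
      define u where "u = sphere_U x e"
      obtain w c where w: "norm w = 1" "x \<bullet> w = 0" and ew: "e = (x \<bullet> e) *\<^sub>R x + c *\<^sub>R w"
        and c: "c\<^sup>2 = 1 - (x \<bullet> e)\<^sup>2"
        using unit_decomposition[OF D x e] by blast
      have xe: "x \<bullet> e = 1 - 2 * u" by (simp add: u_def sphere_U_def field_simps)
      have gm: "continuous_on UNIV (\<lambda>y. g (sphere_U x y) * sphere_U e y ^ k)"
        unfolding sphere_U_def by (intro continuous_intros continuous_on_compose2[OF g]) auto
      have eq: "(\<integral>y. g (sphere_U x y) * sphere_U e y ^ k \<partial>sphere_measure)
          = (\<integral>y. G y * (a0 y + a1 y * u + (- s * c / 2 * (y \<bullet> b1))) ^ k \<partial>sphere_measure)"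
        if s: "s = 1 \<or> s = -1" for s
      proof -
        have sw: "norm (s *\<^sub>R w) = 1" "x \<bullet> (s *\<^sub>R w) = 0" using w s by auto
        obtain T where T: "orthogonal_transformation T"
          "\<And>i. i < 2 \<Longrightarrow> T (if i = 0 then b0 else b1) = (if i = (0::nat) then x else s *\<^sub>R w)"
          using orthonormal_frame_transitive[OF orthonormal_frame_pair[OF b0 b1] orthonormal_frame_pair[OF x sw]]
          by blast
        have T0: "T b0 = x" and T1: "T b1 = s *\<^sub>R w" using T(2)[of 0] T(2)[of 1] by auto
        have Tx: "x \<bullet> T y = y \<bullet> b0" for y
          using inner_orthogonal_image[OF T(1) T0, of y] by (simp add: inner_commute)
        have Tw: "w \<bullet> T y = s * (y \<bullet> b1)" for y
          using inner_orthogonal_image[OF T(1) T1, of y] s by (auto simp: inner_commute)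
        have Ue: "sphere_U e (T y) = a0 y + a1 y * u + (- s * c / 2 * (y \<bullet> b1))" for y
        proof -
          have "e \<bullet> T y = (x \<bullet> e) * (x \<bullet> T y) + c * (w \<bullet> T y)"
            by (subst ew) (simp only: inner_add_left inner_scaleR_left)
          then show ?thesis
            unfolding sphere_U_def a0_def a1_def Tx Tw xe by (simp add: field_simps)
        qed
        have Ux: "sphere_U x (T y) = (1 - y \<bullet> b0) / 2" for y by (simp add: sphere_U_def Tx)
        have "(\<integral>y. g (sphere_U x y) * sphere_U e y ^ k \<partial>sphere_measure)
            = (\<integral>y. g (sphere_U x (T y)) * sphere_U e (T y) ^ k \<partial>sphere_measure)"
          by (rule sphere_integral_orthogonal[OF T(1) borel_measurable_continuous_onI[OF gm], symmetric])
        then show ?thesis by (simp only: Ue Ux G_def)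
      qed
      have "(\<integral>y. g (sphere_U x y) * sphere_U e y ^ k \<partial>sphere_measure) = poly q u"
      proof (rule q(2)[where b = "\<lambda>y. c / 2 * (y \<bullet> b1)"])
        show "(c / 2 * (y \<bullet> b1))\<^sup>2 = r y * (u * (1 - u))" for y
          unfolding power_mult_distrib power_divide c xe r_def by (simp add: power2_eq_square field_simps)
        show "continuous_on UNIV (\<lambda>y. c / 2 * (y \<bullet> b1))" by (intro continuous_intros)
      qed (use eq[of 1] eq[of "-1"] in auto)
      then show ?thesis by (simp add: u_def)
    qed
    then show ?thesis using q(1) by blast
  qed
  show "(\<integral>y. poly (pX * pderiv q + [:(real DIM('a) - 1) / 2, - (real DIM('a) - 1):] * q) (sphere_U x y) \<partial>sphere_measure) = 0"
    if x: "norm x = 1" for x :: 'a and q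
  proof -
    obtain b :: 'a where b: "b \<in> Basis" using nonempty_Basis by blast
    obtain T where T: "orthogonal_transformation T" "T b = x"
      using exists_reflection[of b x] x b by auto
    define p where "p = pcompose q [:1/2, -1/2:]"
    have dp: "poly (pderiv p) t = - poly (pderiv q) ((1 - t) / 2) / 2" for t
      by (simp add: p_def pderiv_pcompose poly_pcompose pderiv_pCons field_simps)
    have pp: "poly p t = poly q ((1 - t) / 2)" for t
      by (simp add: p_def poly_pcompose field_simps)
    let ?f = "\<lambda>u. poly (pX * pderiv q + [:(real DIM('a) - 1) / 2, - (real DIM('a) - 1):] * q) u"
    have "continuous_on UNIV (\<lambda>y. ?f (sphere_U x y))"
      unfolding sphere_U_def by (intro continuous_intros) auto
    from sphere_integral_orthogonal[OF T(1) borel_measurable_continuous_onI[OF this]]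
    have "(\<integral>y. ?f (sphere_U x y) \<partial>sphere_measure) = (\<integral>y. ?f (sphere_U x (T y)) \<partial>sphere_measure)"
      by simp
    also have "\<dots> = (\<integral>y. 1 / 2 * ((real DIM('a) - 1) * ((y \<bullet> b) * poly p (y \<bullet> b))
      - (1 - (y \<bullet> b)\<^sup>2) * poly (pderiv p) (y \<bullet> b)) \<partial>sphere_measure)"
    proof (rule Bochner_Integration.integral_cong[OF refl])
      fix y
      have "sphere_U x (T y) = (1 - y \<bullet> b) / 2"
        using inner_orthogonal_image[OF T, of y] by (simp add: sphere_U_def inner_commute)
      moreover have "?f ((1 - t) / 2) = 1 / 2 * ((real DIM('a) - 1) * (t * poly q ((1 - t) / 2))
        - (1 - t\<^sup>2) * (- poly (pderiv q) ((1 - t) / 2) / 2))" for t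
      proof -
        define u where "u = (1 - t) / 2"
        have t: "t = 1 - 2 * u" by (simp add: u_def field_simps)
        show ?thesis
          unfolding u_def[symmetric] unfolding t by (simp add: power2_eq_square field_simps)
      qed
      ultimately show "?f (sphere_U x (T y)) = 1 / 2 * ((real DIM('a) - 1) * ((y \<bullet> b) * poly p (y \<bullet> b))
        - (1 - (y \<bullet> b)\<^sup>2) * poly (pderiv p) (y \<bullet> b))"
        unfolding dp pp by (simp only:)
    qed
    also have "\<dots> = 0" using pearson_linear[OF b, of p] by (simp only: integral_mult_right_zero)
    finally show ?thesis .
  qed
qed

section \<open>Projective spaces in terms of real frames\<close>

text \<open>
The line through \<open>x\<close> over an algebra of real dimension \<open>a\<close> is seen through the orthonormal vectors
\<open>J i x\<close> that span it over the reals, so that the squared modulus of the Hermitian product of \<open>x\<close> and \<open>y\<close>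
is the sum of the squares of \<open>y \<bullet> J i x\<close>. The last assumption is the normal form of a pair of lines:
up to a unit scalar, \<open>e\<close> is a combination of \<open>x\<close> and a unit vector \<open>w\<close> orthogonal to the line of \<open>x\<close>
with real coefficients \<open>s\<close> and \<open>c\<close>. Everything else depends only on the real orthonormal frame
made of the \<open>J i x\<close> and \<open>J i w\<close>, hence on nothing but its size.
\<close>

locale projective_frame =
  fixes J :: "nat \<Rightarrow> 'a::euclidean_space \<Rightarrow> 'a" and a :: nat
  assumes a_pos: "1 \<le> a" and a_less: "a < DIM('a)"
    and J_linear: "\<And>i. i < a \<Longrightarrow> linear (J i)"
    and J_frame: "\<And>x. norm x = 1 \<Longrightarrow> orthonormal_frame a (\<lambda>i. J i x)"
    and J_sym: "\<And>x y. norm x = 1 \<Longrightarrow> norm y = 1 \<Longrightarrow> (\<Sum>i<a. (y \<bullet> J i x)\<^sup>2) = (\<Sum>i<a. (x \<bullet> J i y)\<^sup>2)"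
    and J_refl: "\<And>x. norm x = 1 \<Longrightarrow> (\<Sum>i<a. (x \<bullet> J i x)\<^sup>2) = 1"
    and J_pair: "\<And>x e. norm x = 1 \<Longrightarrow> norm e = 1 \<Longrightarrow> \<exists>s c w.
       s\<^sup>2 = (\<Sum>i<a. (e \<bullet> J i x)\<^sup>2) \<and> s\<^sup>2 + c\<^sup>2 = 1 \<and>
       orthonormal_frame (2 * a) (\<lambda>i. if i < a then J i x else J (i - a) w) \<and>
       (\<forall>y. (\<Sum>i<a. (y \<bullet> J i e)\<^sup>2) = (\<Sum>i<a. (s * (y \<bullet> J i x) + c * (y \<bullet> J i w))\<^sup>2))"
begin

definition U :: "'a \<Rightarrow> 'a \<Rightarrow> real" where
  "U x y = 1 - (\<Sum>i<a. (y \<bullet> J i x)\<^sup>2)"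

lemma continuous_on_J: "i < a \<Longrightarrow> continuous_on T f \<Longrightarrow> continuous_on T (\<lambda>z. J i (f z))"
  by (rule continuous_on_compose2[OF linear_continuous_on[of "J i" UNIV]])
     (auto simp: linear_conv_bounded_linear[symmetric] J_linear)

lemma continuous_on_U: "continuous_on UNIV (U x)"
  unfolding U_def by (intro continuous_intros)

lemma bessel:
  assumes x: "norm x = 1" and y: "norm y = 1"
  shows "(\<Sum>i<a. (y \<bullet> J i x)\<^sup>2) \<le> 1"
proof -
  define z where "z = (\<Sum>i<a. (y \<bullet> J i x) *\<^sub>R J i x)"
  have zj: "J j x \<bullet> z = y \<bullet> J j x" if "j < a" for j
  proof -
    have "J j x \<bullet> z = (\<Sum>i<a. (y \<bullet> J i x) * (if j = i then 1 else 0))"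
      unfolding z_def inner_sum_right inner_scaleR_right
      by (intro sum.cong refl) (use J_frame[OF x] that in \<open>auto simp: orthonormal_frame_def\<close>)
    then show ?thesis using that by (simp add: if_distrib[of "\<lambda>t. _ * t"] cong: if_cong)
  qed
  have yz: "y \<bullet> z = (\<Sum>i<a. (y \<bullet> J i x)\<^sup>2)"
    by (simp add: z_def inner_sum_right power2_eq_square)
  moreover have "z \<bullet> z = (\<Sum>i<a. (y \<bullet> J i x)\<^sup>2)"
    by (subst (1) z_def) (simp add: inner_sum_left zj power2_eq_square)
  ultimately have "(y - z) \<bullet> (y - z) = 1 - (\<Sum>i<a. (y \<bullet> J i x)\<^sup>2)"
    using y by (simp add: inner_diff_left inner_diff_right inner_commute[of z y] norm_eq_1)
  then show ?thesis using inner_ge_zero[of "y - z"] by simp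
qed

lemma pearson_U:
  assumes x: "norm x = 1"
  shows "(\<integral>y. poly (pX * pderiv q + [:(real DIM('a) - real a) / 2, - (real DIM('a) / 2):] * q) (U x y)
     \<partial>sphere_measure) = 0"
proof -
  obtain \<beta> :: "nat \<Rightarrow> 'a" where \<beta>: "bij_betw \<beta> {..<DIM('a)} Basis"
    using ex_bij_betw_nat_finite[OF finite_Basis] by (auto simp: atLeast0LessThan)
  then have inj: "inj_on \<beta> {..<a}" and sub: "\<beta> ` {..<a} \<subseteq> Basis"
    using a_less by (auto simp: bij_betw_def intro: inj_on_subset)
  have "orthonormal_frame a \<beta>"
    unfolding orthonormal_frame_def using inj sub
    by (auto simp: inner_Basis image_subset_iff dest: inj_onD)
  from orthonormal_frame_transitive[OF J_frame[OF x] this]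
  obtain T where T: "orthogonal_transformation T" "\<And>i. i < a \<Longrightarrow> T (J i x) = \<beta> i" by blast
  define V where "V y = (\<Sum>b\<in>\<beta> ` {..<a}. (y \<bullet> b)\<^sup>2)" for y
  have V: "V (T y) = 1 - U x y" for y
    unfolding V_def U_def using T(2)
    by (simp add: sum.reindex[OF inj] inner_orthogonal_image[OF T(1) T(2)])
  define p where "p = pcompose q [:1, -1:]"
  have dp: "poly (pderiv p) t = - poly (pderiv q) (1 - t)" for t
    by (simp add: p_def pderiv_pcompose poly_pcompose pderiv_pCons)
  have pp: "poly p t = poly q (1 - t)" for t
    by (simp add: p_def poly_pcompose)
  let ?h = "\<lambda>y. (real DIM('a) * V y - real (card (\<beta> ` {..<a}))) * poly p (V y)
      - 2 * (V y * (1 - V y)) * poly (pderiv p) (V y)"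
  have "continuous_on UNIV ?h" unfolding V_def by (intro continuous_intros)
  from sphere_integral_orthogonal[OF T(1) borel_measurable_continuous_onI[OF this]]
  have "(\<integral>y. ?h (T y) \<partial>sphere_measure) = 0"
    using pearson_squares[OF sub, of p] by (simp add: V_def)
  moreover have "poly (pX * pderiv q + [:(real DIM('a) - real a) / 2, - (real DIM('a) / 2):] * q) (U x y)
     = 1 / 2 * ?h (T y)" for y
    unfolding V dp pp card_image[OF inj] by (simp add: field_simps)
  ultimately show ?thesis by (simp only: integral_mult_right_zero)
qed

text \<open>
In a frame adapted to \<open>x\<close> and \<open>e\<close> the function \<open>U e\<close> is \<open>1 - s\<^sup>2 * P - c\<^sup>2 * Q - 2 * s * c * R\<close>, with
\<open>s\<^sup>2 = 1 - u\<close> and \<open>c\<^sup>2 = u\<close> for \<open>u = U x e\<close>. Reversing \<open>w\<close> changes the sign of \<open>R\<close>, so only even powers of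
\<open>s * c\<close> survive.
\<close>

lemma convolution_U:
  assumes g: "continuous_on UNIV g"
  shows "\<exists>q. degree q \<le> k \<and> (\<forall>x e. norm x = 1 \<longrightarrow> norm e = 1 \<longrightarrow>
        (\<integral>y. g (U x y) * U e y ^ k \<partial>sphere_measure) = poly q (U x e))"
proof -
  obtain x0 :: 'a where x0: "norm x0 = 1" using norm_Basis nonempty_Basis by blast
  obtain w0 where fr0: "orthonormal_frame (2 * a) (\<lambda>i. if i < a then J i x0 else J (i - a) w0)"
    using J_pair[OF x0 x0] by blast
  define P Q R where "P y = (\<Sum>i<a. (y \<bullet> J i x0)\<^sup>2)" and "Q y = (\<Sum>i<a. (y \<bullet> J i w0)\<^sup>2)"
    and "R y = (\<Sum>i<a. (y \<bullet> J i x0) * (y \<bullet> J i w0))" for y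
  have PQR: "continuous_on UNIV P" "continuous_on UNIV Q" "continuous_on UNIV R"
    unfolding P_def Q_def R_def by (intro continuous_intros)+
  define G where "G y = g (1 - P y)" for y
  have cont: "continuous_on UNIV G" "continuous_on UNIV (\<lambda>y. 1 - P y)" "continuous_on UNIV (\<lambda>y. P y - Q y)"
    "continuous_on UNIV (\<lambda>y. 4 * (R y)\<^sup>2)"
    unfolding G_def by (intro continuous_on_compose2[OF g] continuous_intros PQR; auto)+
  obtain q where q: "degree q \<le> k" "\<And>u b I. continuous_on UNIV b \<Longrightarrow> (\<And>y. (b y)\<^sup>2 = 4 * (R y)\<^sup>2 * (u * (1 - u))) \<Longrightarrow>
     I = (\<integral>y. G y * (1 - P y + (P y - Q y) * u + b y) ^ k \<partial>sphere_measure) \<Longrightarrow>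
     I = (\<integral>y. G y * (1 - P y + (P y - Q y) * u - b y) ^ k \<partial>sphere_measure) \<Longrightarrow> I = poly q u"
    using convolution_from_symmetrization[OF cont, of k] by blast
  have "(\<integral>y. g (U x y) * U e y ^ k \<partial>sphere_measure) = poly q (U x e)"
    if x: "norm x = 1" and e: "norm e = 1" for x e
  proof -
    obtain s c w where s: "s\<^sup>2 = (\<Sum>i<a. (e \<bullet> J i x)\<^sup>2)" and sc: "s\<^sup>2 + c\<^sup>2 = 1"
      and fr: "orthonormal_frame (2 * a) (\<lambda>i. if i < a then J i x else J (i - a) w)"
      and ew: "\<And>y. (\<Sum>i<a. (y \<bullet> J i e)\<^sup>2) = (\<Sum>i<a. (s * (y \<bullet> J i x) + c * (y \<bullet> J i w))\<^sup>2)"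
      using J_pair[OF x e] by blast
    define u where "u = U x e"
    have su: "s\<^sup>2 = 1 - u" "c\<^sup>2 = u" using s sc by (simp_all add: u_def U_def)
    have gm: "continuous_on UNIV (\<lambda>y. g (U x y) * U e y ^ k)"
      by (intro continuous_intros continuous_on_compose2[OF g continuous_on_U] continuous_on_U) auto
    have eq: "(\<integral>y. g (U x y) * U e y ^ k \<partial>sphere_measure)
        = (\<integral>y. G y * (1 - P y + (P y - Q y) * u + (- \<sigma> * (2 * s * c * R y))) ^ k \<partial>sphere_measure)"
      if \<sigma>: "\<sigma> = 1 \<or> \<sigma> = -1" for \<sigma>
    proof -
      have Jm: "J i (\<sigma> *\<^sub>R w) = \<sigma> *\<^sub>R J i w" if "i < a" for i
        using linear_scale[OF J_linear[OF that]] .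
      have "orthonormal_frame (2 * a) (\<lambda>i. if i < a then J i x else J (i - a) (\<sigma> *\<^sub>R w))"
        unfolding orthonormal_frame_def
      proof (intro allI impI)
        fix i j assume ij: "i < 2 * a" "j < 2 * a"
        have lt: "i - a < a" "j - a < a" using ij a_pos by linarith+
        define v where "v i = (if i < a then J i x else J (i - a) w)" for i
        define \<tau> where "\<tau> i = (if i < a then 1 else \<sigma>)" for i
        have "(if i < a then J i x else J (i - a) (\<sigma> *\<^sub>R w)) = \<tau> i *\<^sub>R v i"
          "(if j < a then J j x else J (j - a) (\<sigma> *\<^sub>R w)) = \<tau> j *\<^sub>R v j"
          by (simp_all add: v_def \<tau>_def Jm[OF lt(1)] Jm[OF lt(2)])
        moreover have "v i \<bullet> v j = (if i = j then 1 else 0)"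
          using fr ij by (simp only: orthonormal_frame_def v_def)
        moreover have "\<tau> l * \<tau> l = 1" for l using \<sigma> by (auto simp: \<tau>_def)
        ultimately show "(if i < a then J i x else J (i - a) (\<sigma> *\<^sub>R w)) \<bullet> (if j < a then J j x else J (j - a) (\<sigma> *\<^sub>R w))
          = (if i = j then 1 else 0)"
          by (simp only: inner_scaleR_left inner_scaleR_right) simp
      qed
      from orthonormal_frame_transitive[OF fr0 this] obtain T where T: "orthogonal_transformation T"
        "\<And>i. i < 2 * a \<Longrightarrow> T (if i < a then J i x0 else J (i - a) w0)
          = (if i < a then J i x else J (i - a) (\<sigma> *\<^sub>R w))" by blast
      have Tx: "T (J i x0) = J i x" if "i < a" for i using T(2)[of i] that by simp
      have Tw: "T (J i w0) = \<sigma> *\<^sub>R J i w" if "i < a" for i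
        using T(2)[of "i + a"] that by (simp add: Jm)
      have ix: "T y \<bullet> J i x = y \<bullet> J i x0" if "i < a" for i y
        by (rule inner_orthogonal_image[OF T(1) Tx[OF that]])
      have iw: "T y \<bullet> J i w = \<sigma> * (y \<bullet> J i w0)" if "i < a" for i y
        using inner_orthogonal_image[OF T(1) Tw[OF that], of y] \<sigma> by auto
      have Ux: "U x (T y) = 1 - P y" for y
        unfolding U_def P_def by (simp add: ix)
      have Ue: "U e (T y) = 1 - P y + (P y - Q y) * u + (- \<sigma> * (2 * s * c * R y))" for y
      proof -
        have "(\<Sum>i<a. (T y \<bullet> J i e)\<^sup>2) = (\<Sum>i<a. s\<^sup>2 * (y \<bullet> J i x0)\<^sup>2 + c\<^sup>2 * (y \<bullet> J i w0)\<^sup>2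
            + \<sigma> * (2 * s * c) * ((y \<bullet> J i x0) * (y \<bullet> J i w0)))"
          unfolding ew using \<sigma>
          by (intro sum.cong refl) (auto simp: ix iw power2_eq_square algebra_simps)
        also have "\<dots> = s\<^sup>2 * P y + c\<^sup>2 * Q y + \<sigma> * (2 * s * c) * R y"
          unfolding P_def Q_def R_def by (simp only: sum.distrib sum_distrib_left)
        finally show ?thesis unfolding U_def su by (simp add: algebra_simps)
      qed
      have "(\<integral>y. g (U x y) * U e y ^ k \<partial>sphere_measure)
          = (\<integral>y. g (U x (T y)) * U e (T y) ^ k \<partial>sphere_measure)"
        by (rule sphere_integral_orthogonal[OF T(1) borel_measurable_continuous_onI[OF gm], symmetric])
      then show ?thesis by (simp only: Ue Ux G_def)
    qed
    have "(\<integral>y. g (U x y) * U e y ^ k \<partial>sphere_measure) = poly q u"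
    proof (rule q(2)[where b = "\<lambda>y. 2 * s * c * R y"])
      show "(2 * s * c * R y)\<^sup>2 = 4 * (R y)\<^sup>2 * (u * (1 - u))" for y
        unfolding power_mult_distrib su by simp
      show "continuous_on UNIV (\<lambda>y. 2 * s * c * R y)" by (intro continuous_intros PQR)
    qed (use eq[of 1] eq[of "-1"] in auto)
    then show ?thesis by (simp add: u_def)
  qed
  then show ?thesis using q(1) by blast
qed

sublocale zonal_space U "(real DIM('a) - real a) / 2" "real DIM('a) / 2"
proof
  show "2 \<le> DIM('a)" using a_pos a_less by linarith
  show "0 < (real DIM('a) - real a) / 2" "(real DIM('a) - real a) / 2 < real DIM('a) / 2" "1 \<le> real DIM('a) / 2"
    using a_pos a_less by auto
  show "continuous_on UNIV (\<lambda>(x, y). U x y)"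
    unfolding U_def case_prod_beta by (intro continuous_intros continuous_on_J) auto
  show "U x y = U y x" if "norm x = 1" "norm y = 1" for x y
    using J_sym[OF that] by (simp add: U_def)
  show "0 \<le> U x y \<and> U x y \<le> 1" if "norm x = 1" "norm y = 1" for x y
    using bessel[OF that] by (simp add: U_def sum_nonneg)
  show "U x x = 0" if "norm x = 1" for x using J_refl[OF that] by (simp add: U_def)
  show "\<exists>w. norm w = 1 \<and> U x w = 1" if "norm x = 1" for x
    using exists_unit_orthogonal[OF a_less, of "\<lambda>i. J i x"] by (auto simp: U_def)
qed (rule convolution_U pearson_U, assumption)+

end

section \<open>From kernels on a space to functions on the sphere\<close>

text \<open>
Different points of the covering sphere may lie over the same point of the space, so the quadratic
form is needed for repeated points: add up their coefficients.
\<close>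

lemma positive_definite_repeated_points:
  fixes n :: nat
  assumes K: "positive_definite M K" and x: "\<And>i. i < n \<Longrightarrow> x i \<in> M"
  shows "0 \<le> (\<Sum>i<n. \<Sum>j<n. c i * c j * K (x i) (x j))"
proof (cases "n = 0")
  case False
  let ?P = "x ` {..<n}"
  obtain h where h: "bij_betw h {..<card ?P} ?P"
    using ex_bij_betw_nat_finite[of ?P] by (auto simp: atLeast0LessThan)
  define c' where "c' p = (\<Sum>i | i < n \<and> x i = p. c i)" for p
  have grp: "(\<Sum>p\<in>?P. c' p * f p) = (\<Sum>i<n. c i * f (x i))" for f
  proof -
    have "(\<Sum>p\<in>?P. c' p * f p) = (\<Sum>p\<in>?P. \<Sum>i | i \<in> {..<n} \<and> x i = p. c i * f (x i))"
      unfolding c'_def sum_distrib_right by (intro sum.cong) auto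
    also have "\<dots> = (\<Sum>i<n. c i * f (x i))" by (rule sum.group) auto
    finally show ?thesis .
  qed
  have "x 0 \<in> ?P" using False by auto
  then have "0 < card ?P" by (metis card_gt_0_iff empty_iff finite_imageI finite_lessThan)
  moreover have "inj_on h {..<card ?P}" "h ` {..<card ?P} \<subseteq> M"
    using h x by (auto simp: bij_betw_def)
  ultimately have "0 \<le> (\<Sum>i<card ?P. \<Sum>j<card ?P. c' (h i) * c' (h j) * K (h i) (h j))"
    using K by (simp add: positive_definite_def)
  also have "\<dots> = (\<Sum>p\<in>?P. \<Sum>q\<in>?P. c' p * c' q * K p q)"
    by (subst sum.reindex_bij_betw[OF h, symmetric], subst sum.reindex_bij_betw[OF h, symmetric]) (rule refl)
  also have "\<dots> = (\<Sum>p\<in>?P. c' p * (\<Sum>q\<in>?P. c' q * K p q))"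
    by (simp add: sum_distrib_left mult.assoc)
  also have "\<dots> = (\<Sum>i<n. \<Sum>j<n. c i * c j * K (x i) (x j))"
    unfolding grp by (simp add: sum_distrib_left mult.assoc)
  finally show ?thesis .
qed simp

lemma class_C_affine:
  assumes g: "class_C m g {0<..<1}" and f: "\<And>t. -1 < t \<Longrightarrow> t < 1 \<Longrightarrow> f t = g ((1 - t) / 2)"
  shows "class_C m f {-1<..<1}"
proof (rule class_C_from_derivatives[where D = "\<lambda>i t. (- 1 / 2) ^ i * (deriv ^^ i) g ((1 - t) / 2)"])
  show "((\<lambda>t. (- 1 / 2) ^ i * (deriv ^^ i) g ((1 - t) / 2)) has_real_derivative
      (- 1 / 2) ^ Suc i * (deriv ^^ Suc i) g ((1 - t) / 2)) (at t)"
    if i: "i < m" and t: "t \<in> {-1<..<1}" for i t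
  proof -
    have "(1 - t) / 2 \<in> {0<..<1}" using t by auto
    then have "(deriv ^^ i) g differentiable (at ((1 - t) / 2))" using g i by (simp add: class_C_def)
    then have "((deriv ^^ i) g has_real_derivative (deriv ^^ Suc i) g ((1 - t) / 2)) (at ((1 - t) / 2))"
      using DERIV_deriv_iff_real_differentiable by auto
    moreover have "((\<lambda>t. (1 - t) / 2) has_real_derivative - 1 / 2) (at t)"
      by (auto intro!: derivative_eq_intros)
    ultimately have "((\<lambda>t. (deriv ^^ i) g ((1 - t) / 2)) has_real_derivative
        (deriv ^^ Suc i) g ((1 - t) / 2) * (- 1 / 2)) (at t)"
      by (rule DERIV_chain2)
    from DERIV_cmult[OF this, of "(- 1 / 2) ^ i"] show ?thesis by (simp add: mult_ac)
  qed
  have "continuous_on {0<..<1} ((deriv ^^ m) g)" using g by (simp add: class_C_def)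
  then have "continuous_on {-1<..<1} (\<lambda>t. (deriv ^^ m) g ((1 - t) / 2))"
    by (rule continuous_on_compose2) (auto intro!: continuous_intros)
  then show "continuous_on {-1<..<1} (\<lambda>t. (- 1 / 2) ^ m * (deriv ^^ m) g ((1 - t) / 2))"
    by (intro continuous_intros)
qed (use f in auto)

text \<open>
The function \<open>F u = f (1 - 2 * u)\<close> is continuous because \<open>U pole\<close> maps the compact sphere onto the unit
interval and is therefore a closed map, while the composition of \<open>F\<close> with it is a section of the kernel.
\<close>

theorem (in zonal_space) radial_part_class_C:
  assumes \<pi>: "\<And>x. norm x = 1 \<Longrightarrow> \<pi> x \<in> M"
    and dist: "\<And>x y. norm x = 1 \<Longrightarrow> norm y = 1 \<Longrightarrow> \<delta> (\<pi> x) (\<pi> y) = 2 * arccos (1 - 2 * U x y)"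
    and cont: "continuous_kernel M \<delta> K" and pd: "positive_definite M K"
    and radial: "radial_part M \<delta> K f" and m: "2 * real m \<le> 2 * A - 1"
  shows "class_C m f {-1<..<1}"
proof -
  define F where "F u = f (1 - 2 * u)" for u
  have K: "K (\<pi> x) (\<pi> y) = F (U x y)" if x: "norm x = 1" and y: "norm y = 1" for x y
  proof -
    have "cos (\<delta> (\<pi> x) (\<pi> y) / 2) = 1 - 2 * U x y"
      using U_range[OF x y] by (simp add: dist[OF x y] cos_arccos)
    then show ?thesis using radial \<pi>[OF x] \<pi>[OF y] by (simp add: radial_part_def F_def)
  qed
  let ?S = "sphere (0::'a) 1"
  have G: "continuous_on ?S (\<lambda>y. F (U pole y))"
    unfolding continuous_on_iff
  proof (intro ballI allI impI)
    fix y :: 'a and e :: real assume y: "y \<in> ?S" and e: "0 < e"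
    then have y1: "norm y = 1" by simp
    obtain r where r: "r > 0" "\<And>x' y'. x' \<in> M \<Longrightarrow> y' \<in> M \<Longrightarrow> \<delta> (\<pi> pole) x' < r \<Longrightarrow> \<delta> (\<pi> y) y' < r \<Longrightarrow>
        \<bar>K x' y' - K (\<pi> pole) (\<pi> y)\<bar> < e"
      using cont \<pi>[OF norm_pole] \<pi>[OF y1] e unfolding continuous_kernel_def by metis
    have p0: "\<delta> (\<pi> pole) (\<pi> pole) < r" using r(1) by (simp add: dist norm_pole U_refl)
    have "continuous_on ?S (\<lambda>y'. 2 * arccos (1 - 2 * U y y'))"
      using U_range[OF y1] by (intro continuous_intros) auto
    then obtain d where d: "d > 0" "\<And>y'. y' \<in> ?S \<Longrightarrow> dist y' y < d \<Longrightarrow>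
        dist (2 * arccos (1 - 2 * U y y')) (2 * arccos (1 - 2 * U y y)) < r"
      using y r(1) unfolding continuous_on_iff by metis
    have "dist (F (U pole y')) (F (U pole y)) < e" if y': "y' \<in> ?S" "dist y' y < d" for y'
    proof -
      have "norm y' = 1" using y' by simp
      moreover have "\<delta> (\<pi> y) (\<pi> y') < r"
        using d(2)[OF y'] by (simp add: dist_real_def U_refl y1 dist \<open>norm y' = 1\<close>)
      ultimately show ?thesis
        using r(2)[OF \<pi>[OF norm_pole] \<pi>, of y'] p0
        by (simp add: K norm_pole y1 dist_real_def)
    qed
    then show "\<exists>d>0. \<forall>x'\<in>?S. dist x' y < d \<longrightarrow> dist (F (U pole x')) (F (U pole y)) < e"
      using d(1) by blast
  qed
  have F: "continuous_on {0..1} F"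
    unfolding continuous_on_closed_vimage[OF closed_atLeastAtMost]
  proof (intro allI impI)
    fix B :: "real set" assume B: "closed B"
    have "F -` B \<inter> {0..1} = U pole ` (?S \<inter> (\<lambda>y. F (U pole y)) -` B)"
    proof (intro equalityI subsetI)
      fix u assume u: "u \<in> F -` B \<inter> {0..1}"
      then obtain y where "norm y = 1" "U pole y = u" using U_onto[OF norm_pole] by auto
      with u show "u \<in> U pole ` (?S \<inter> (\<lambda>y. F (U pole y)) -` B)" by auto
    qed (use U_range[OF norm_pole] in auto)
    moreover have "closed (?S \<inter> (\<lambda>y. F (U pole y)) -` B)"
      using continuous_closed_preimage[OF G _ B] by simp
    then have "compact (?S \<inter> (\<lambda>y. F (U pole y)) -` B)"
      by (metis compact_Int_closed compact_sphere inf.left_idem)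
    then have "compact (U pole ` (?S \<inter> (\<lambda>y. F (U pole y)) -` B))"
      by (intro compact_continuous_image continuous_intros)
    ultimately show "closed (F -` B \<inter> {0..1})" by (simp add: compact_imp_closed)
  qed
  have "0 \<le> (\<Sum>i<n. \<Sum>j<n. c i * c j * F (U (x i) (x j)))"
    if x: "\<And>i. i < n \<Longrightarrow> norm (x i) = 1" for n :: nat and x c
  proof -
    have "0 \<le> (\<Sum>i<n. \<Sum>j<n. c i * c j * K (\<pi> (x i)) (\<pi> (x j)))"
      by (rule positive_definite_repeated_points[OF pd]) (use x \<pi> in auto)
    also have "\<dots> = (\<Sum>i<n. \<Sum>j<n. c i * c j * F (U (x i) (x j)))"
      using x by (intro sum.cong refl) (simp add: K)
    finally show ?thesis .
  qed
  from positive_definite_class_C[OF F this m]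
  obtain g where g: "class_C m g {0<..<1}" "\<And>u. u \<in> {0..1} \<Longrightarrow> g u = F u" by blast
  show ?thesis
    by (rule class_C_affine[OF g(1)]) (simp add: g(2) F_def field_simps)
qed

section \<open>Projective spaces over a normed division algebra\<close>

lemma arccos_double:
  assumes "0 \<le> h" "h \<le> 1"
  shows "2 * arccos (2 * h\<^sup>2 - 1) = 4 * arccos h"
proof -
  have "2 * h\<^sup>2 - 1 = cos (2 * arccos h)"
    using assms by (simp add: cos_double_cos cos_arccos)
  moreover have "0 \<le> 2 * arccos h" "2 * arccos h \<le> pi"
    using assms arccos_lbound[of h] arccos_le_pi2[of h] by auto
  ultimately show ?thesis by (simp add: arccos_cos)
qed

definition right_scale :: "('f \<Rightarrow> 'f \<Rightarrow> 'f) \<Rightarrow> 'f ^ 'n \<Rightarrow> 'f \<Rightarrow> 'f ^ 'n" where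
  "right_scale mul v q = (\<chi> i. mul (v $ i) q)"

text \<open>
The properties shared by the real numbers, the complex numbers and the quaternions. The last one says
that left multiplications by conjugate elements are adjoint for the real inner product.
\<close>

locale normed_division_algebra =
  fixes mul :: "'f::euclidean_space \<Rightarrow> 'f \<Rightarrow> 'f" and cj :: "'f \<Rightarrow> 'f" and one :: 'f
  assumes mul_bilinear: "bilinear mul" and cj_linear: "linear cj"
    and mul_assoc: "mul (mul a b) c = mul a (mul b c)"
    and mul_one: "mul a one = a" and one_mul: "mul one a = a"
    and cj_mul: "cj (mul a b) = mul (cj b) (cj a)"
    and cj_cj: "cj (cj a) = a"
    and norm_cj: "norm (cj a) = norm a" and norm_one: "norm one = 1"
    and cj_mul_self: "mul (cj a) a = (norm a)\<^sup>2 *\<^sub>R one"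
    and adjoint: "mul (cj a) b \<bullet> c = b \<bullet> mul a c"
begin

abbreviation herm :: "'f ^ 'n \<Rightarrow> 'f ^ 'n \<Rightarrow> 'f" where "herm \<equiv> herm_form mul cj"
abbreviation rs :: "'f ^ 'n \<Rightarrow> 'f \<Rightarrow> 'f ^ 'n" where "rs \<equiv> right_scale mul"

lemma linear_mul_left: "linear (mul a)" and linear_mul_right: "linear (\<lambda>a. mul a b)"
  using mul_bilinear by (auto simp: bilinear_def)

lemma mul_scaleR [simp]: "mul (c *\<^sub>R a) b = c *\<^sub>R mul a b" "mul a (c *\<^sub>R b) = c *\<^sub>R mul a b"
  using linear_scale[OF linear_mul_left] linear_scale[OF linear_mul_right] by auto

lemma mul_zero [simp]: "mul 0 b = 0" "mul a 0 = 0"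
  using linear_0[OF linear_mul_left] linear_0[OF linear_mul_right] by auto

lemma mul_diff: "mul (a - a') b = mul a b - mul a' b" "mul a (b - b') = mul a b - mul a b'"
  and mul_add: "mul (a + a') b = mul a b + mul a' b" "mul a (b + b') = mul a b + mul a b'"
  using linear_diff[OF linear_mul_left] linear_diff[OF linear_mul_right]
    linear_add[OF linear_mul_left] linear_add[OF linear_mul_right] by auto

lemma mul_self_cj: "mul a (cj a) = (norm a)\<^sup>2 *\<^sub>R one"
  using cj_mul_self[of "cj a"] by (simp add: cj_cj norm_cj)

lemma inner_mul_mul: "mul a b \<bullet> mul a c = (norm a)\<^sup>2 * (b \<bullet> c)"
  using adjoint[of a "mul a b" c] by (simp add: mul_assoc[symmetric] cj_mul_self one_mul)

lemma norm_mul: "norm (mul a b) = norm a * norm b"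
  by (simp add: norm_eq_sqrt_inner[of "mul a b"] inner_mul_mul norm_eq_sqrt_inner[of b] real_sqrt_mult)

lemma herm_right_scale: "herm x (rs y q) = mul (herm x y) q"
  unfolding herm_form_def right_scale_def
  by (simp add: mul_assoc linear_sum[OF linear_mul_right])

lemma herm_left_scale: "herm (rs x q) y = mul (cj q) (herm x y)"
  unfolding herm_form_def right_scale_def
  by (simp add: mul_assoc cj_mul linear_sum[OF linear_mul_left])

lemma cj_herm: "cj (herm x y) = herm y x"
  unfolding herm_form_def by (simp add: linear_sum[OF cj_linear] cj_mul cj_cj)

lemma norm_herm_commute: "norm (herm x y) = norm (herm y x)"
  by (metis cj_herm norm_cj)

lemma inner_herm: "herm x y \<bullet> q = y \<bullet> rs x q"
  unfolding herm_form_def right_scale_def inner_vec_def by (simp add: inner_sum_left adjoint)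

lemma herm_self: "herm x x = (norm x)\<^sup>2 *\<^sub>R one"
  unfolding herm_form_def
  by (simp add: cj_mul_self power2_norm_eq_inner inner_vec_def scaleR_sum_left)

lemma rs_one: "rs x one = x"
  by (simp add: right_scale_def mul_one vec_eq_iff)

lemma inner_rs_rs: "rs x p \<bullet> rs y q = p \<bullet> mul (herm x y) q"
proof -
  have "rs x p \<bullet> rs y q = herm x (rs y q) \<bullet> p"
    using inner_herm[of x "rs y q" p] by (metis inner_commute)
  then show ?thesis by (simp add: herm_right_scale inner_commute)
qed

lemma norm_rs: "norm (rs x q) = norm x * norm q"
proof -
  have "rs x q \<bullet> rs x q = (norm x)\<^sup>2 * (q \<bullet> q)"
    by (simp add: inner_rs_rs herm_self one_mul)
  then show ?thesis
    by (simp add: norm_eq_sqrt_inner[of "rs x q"] norm_eq_sqrt_inner[of q] real_sqrt_mult)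
qed

lemma rs_linear: "linear (\<lambda>x. rs x q)"
  by (rule linearI) (simp_all add: right_scale_def vec_eq_iff mul_add)

lemma herm_diff_right: "herm x (y - z) = herm x y - herm x z"
  and herm_scaleR_right: "herm x (c *\<^sub>R y) = c *\<^sub>R herm x y"
  unfolding herm_form_def by (simp_all add: mul_diff sum_subtractf scaleR_sum_right)

text \<open>
An enumeration of the standard orthonormal basis, to index real frames by natural numbers.
\<close>

definition unit_basis :: "nat \<Rightarrow> 'f" where
  "unit_basis = (SOME \<beta>. bij_betw \<beta> {..<DIM('f)} Basis)"

lemma bij_unit_basis: "bij_betw unit_basis {..<DIM('f)} Basis"
  unfolding unit_basis_def
  using someI_ex[OF ex_bij_betw_nat_finite[of "Basis :: 'f set", OF finite_Basis]] by (simp add: atLeast0LessThan)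

definition J :: "nat \<Rightarrow> 'f ^ 'n \<Rightarrow> 'f ^ 'n" where "J i x = rs x (unit_basis i)"

lemma sum_J: "(\<Sum>i<DIM('f). (y \<bullet> J i x)\<^sup>2) = (norm (herm x y))\<^sup>2"
  unfolding J_def inner_herm[symmetric] sum.reindex_bij_betw[OF bij_unit_basis, of "\<lambda>b. (herm x y \<bullet> b)\<^sup>2"]
  by (rule sum_Basis_squares)

lemma inner_unit_basis:
  "i < DIM('f) \<Longrightarrow> j < DIM('f) \<Longrightarrow> unit_basis i \<bullet> unit_basis j = (if i = j then 1 else 0)"
  using bij_betwE[OF bij_unit_basis] bij_betw_imp_inj_on[OF bij_unit_basis]
  by (auto simp: inner_Basis dest: inj_onD)

lemma exists_herm_orthogonal:
  assumes n: "2 \<le> CARD('n)"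
  shows "\<exists>w :: 'f ^ 'n. norm w = 1 \<and> herm x w = 0"
proof -
  have "DIM('f) < DIM('f ^ 'n)" using n DIM_positive[where 'a='f] by simp
  then obtain w :: "'f ^ 'n" where w: "norm w = 1" "\<forall>i<DIM('f). w \<bullet> J i x = 0"
    using exists_unit_orthogonal[of "DIM('f)" "\<lambda>i. J i x"] by blast
  then have "(\<Sum>i<DIM('f). (w \<bullet> J i x)\<^sup>2) = 0" by simp
  then have "herm x w = 0" by (simp add: sum_J)
  then show ?thesis using w(1) by blast
qed

text \<open>
For the normal form of a pair, scale \<open>e\<close> by the unit scalar that makes its Hermitian product with \<open>x\<close>
the real number \<open>s\<close>, and let \<open>w\<close> be the normalized rest after subtracting \<open>s\<close> times \<open>x\<close>.
\<close>

lemma projective_frame_J: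
  assumes n: "2 \<le> CARD('n)"
  shows "projective_frame (J :: nat \<Rightarrow> 'f ^ 'n \<Rightarrow> 'f ^ 'n) DIM('f)"
proof (rule projective_frame.intro)
  show "1 \<le> DIM('f)" "DIM('f) < DIM('f ^ 'n)"
    using n DIM_positive[where 'a='f] by auto
  show "linear (J i :: 'f ^ 'n \<Rightarrow> 'f ^ 'n)" for i
    unfolding J_def by (rule rs_linear)
  have Jx: "J i x \<bullet> J j x = (if i = j then 1 else 0)"
    if "norm x = 1" "i < DIM('f)" "j < DIM('f)" for x :: "'f ^ 'n" and i j
    using that by (simp add: J_def inner_rs_rs herm_self one_mul inner_unit_basis)
  then show "orthonormal_frame DIM('f) (\<lambda>i. J i x)" if "norm x = 1" for x :: "'f ^ 'n"
    using that by (simp add: orthonormal_frame_def)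
  show "(\<Sum>i<DIM('f). (y \<bullet> J i x)\<^sup>2) = (\<Sum>i<DIM('f). (x \<bullet> J i y)\<^sup>2)" for x y :: "'f ^ 'n"
    unfolding sum_J by (simp add: norm_herm_commute)
  show "(\<Sum>i<DIM('f). (x \<bullet> J i x)\<^sup>2) = 1" if "norm x = 1" for x :: "'f ^ 'n"
    unfolding sum_J using that by (simp add: herm_self norm_one)
  show "\<exists>s c w. s\<^sup>2 = (\<Sum>i<DIM('f). (e \<bullet> J i x)\<^sup>2) \<and> s\<^sup>2 + c\<^sup>2 = 1 \<and>
       orthonormal_frame (2 * DIM('f)) (\<lambda>i. if i < DIM('f) then J i x else J (i - DIM('f)) w) \<and>
       (\<forall>y. (\<Sum>i<DIM('f). (y \<bullet> J i e)\<^sup>2) = (\<Sum>i<DIM('f). (s * (y \<bullet> J i x) + c * (y \<bullet> J i w))\<^sup>2))"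
    if x: "norm x = 1" and e: "norm e = 1" for x e :: "'f ^ 'n"
  proof -
    define s where "s = norm (herm x e)"
    \<comment> \<open>Any unit scalar will do if the two lines are orthogonal.\<close>
    define q where "q = (if s = 0 then one else cj (herm x e) /\<^sub>R s)"
    have q: "norm q = 1" by (auto simp: q_def norm_one norm_cj s_def)
    define e' where "e' = rs e q"
    have e': "norm e' = 1" by (simp add: e'_def norm_rs e q)
    have he': "herm x e' = s *\<^sub>R one"
      unfolding e'_def herm_right_scale by (auto simp: q_def s_def mul_self_cj power2_eq_square)
    define z where "z = e' - s *\<^sub>R x"
    have hz: "herm x z = 0" by (simp add: z_def herm_diff_right herm_scaleR_right he' herm_self x)
    have xz: "x \<bullet> z = 0" using inner_herm[of x z one] by (simp add: hz rs_one inner_commute)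
    have "e' \<bullet> e' = (s *\<^sub>R x + z) \<bullet> (s *\<^sub>R x + z)" by (simp add: z_def)
    also have "\<dots> = s\<^sup>2 + (norm z)\<^sup>2"
      using x by (simp add: inner_add_left inner_add_right xz inner_commute[of z x] norm_eq_1
          power2_norm_eq_inner) (simp add: power2_eq_square)
    finally have sz: "s\<^sup>2 + (norm z)\<^sup>2 = 1" using e' by (simp add: norm_eq_1)
    obtain w :: "'f ^ 'n" where w: "norm w = 1" "herm x w = 0" and zw: "z = norm z *\<^sub>R w"
    proof (cases "z = 0")
      case True
      then show ?thesis using exists_herm_orthogonal[OF n, of x] that by auto
    next
      case False
      then show ?thesis using hz by (intro that[of "z /\<^sub>R norm z"]) (simp_all add: herm_scaleR_right)
    qed
    have ew: "e' = s *\<^sub>R x + norm z *\<^sub>R w" using zw by (simp add: z_def algebra_simps)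
    have Je: "J i e' = s *\<^sub>R J i x + norm z *\<^sub>R J i w" for i
      unfolding ew J_def by (simp add: linear_add[OF rs_linear] linear_scale[OF rs_linear])
    have xw: "J i x \<bullet> J j w = 0" for i j
      by (simp add: J_def inner_rs_rs w)
    then have wx: "J j w \<bullet> J i x = 0" for i j
      by (metis inner_commute)
    have "orthonormal_frame (2 * DIM('f)) (\<lambda>i. if i < DIM('f) then J i x else J (i - DIM('f)) w)"
      unfolding orthonormal_frame_def
    proof (intro allI impI)
      fix i j assume "i < 2 * DIM('f)" "j < 2 * DIM('f)"
      then show "(if i < DIM('f) then J i x else J (i - DIM('f)) w) \<bullet>
          (if j < DIM('f) then J j x else J (j - DIM('f)) w) = (if i = j then 1 else 0)"
        by (cases "i < DIM('f)"; cases "j < DIM('f)") (auto simp: xw wx Jx[OF x] Jx[OF w(1)])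
    qed
    moreover have "(\<Sum>i<DIM('f). (y \<bullet> J i e)\<^sup>2) = (\<Sum>i<DIM('f). (s * (y \<bullet> J i x) + norm z * (y \<bullet> J i w))\<^sup>2)" for y
    proof -
      have "(\<Sum>i<DIM('f). (y \<bullet> J i e)\<^sup>2) = (norm (herm e' y))\<^sup>2"
        unfolding sum_J e'_def herm_left_scale by (simp add: norm_mul norm_cj q)
      then show ?thesis unfolding sum_J[symmetric] Je by (simp add: inner_add_right)
    qed
    moreover have "s\<^sup>2 = (\<Sum>i<DIM('f). (e \<bullet> J i x)\<^sup>2)" by (simp add: sum_J s_def)
    ultimately show ?thesis using sz by blast
  qed
qed

lemma unit_rep_scalar_line:
  assumes x: "norm x = 1"
  shows "\<exists>q. norm q = 1 \<and> unit_rep (scalar_line mul x) = rs x q"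
proof -
  have "scalar_line mul x = range (rs x)" by (simp add: scalar_line_def right_scale_def[abs_def])
  moreover have "\<exists>u. u \<in> range (rs x) \<and> norm u = 1"
    using x rs_one[of x] by (metis rangeI)
  ultimately have "unit_rep (scalar_line mul x) \<in> range (rs x) \<and> norm (unit_rep (scalar_line mul x)) = 1"
    unfolding unit_rep_def using someI_ex[of "\<lambda>u. u \<in> range (rs x) \<and> norm u = 1"] by simp
  then show ?thesis using x by (auto simp: norm_rs)
qed

lemma proj_dist_scalar_line:
  assumes "norm x = 1" "norm y = 1"
  shows "proj_dist mul cj (scalar_line mul x) (scalar_line mul y) = 4 * arccos (norm (herm x y))"
  using unit_rep_scalar_line[OF assms(1)] unit_rep_scalar_line[OF assms(2)]
  by (auto simp: proj_dist_def herm_left_scale herm_right_scale norm_mul norm_cj)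

theorem projective_class_C:
  fixes K :: "('f ^ 'n) set \<Rightarrow> ('f ^ 'n) set \<Rightarrow> real"
  assumes n: "2 \<le> CARD('n)"
    and cont: "continuous_kernel (proj_space mul) (proj_dist mul cj) K"
    and pd: "positive_definite (proj_space mul) K"
    and radial: "radial_part (proj_space mul) (proj_dist mul cj) K f"
    and m: "2 * m + 1 \<le> DIM('f) * (CARD('n) - 1)"
  shows "class_C m f {-1<..<1}"
proof -
  interpret projective_frame "J :: nat \<Rightarrow> 'f ^ 'n \<Rightarrow> 'f ^ 'n" "DIM('f)"
    by (rule projective_frame_J[OF n])
  show ?thesis
  proof (rule radial_part_class_C[where \<pi> = "scalar_line mul", OF _ _ cont pd radial])
    show "scalar_line mul x \<in> proj_space mul" if "norm x = 1" for x :: "'f ^ 'n"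
      using that unfolding proj_space_def by force
    show "proj_dist mul cj (scalar_line mul x) (scalar_line mul y) = 2 * arccos (1 - 2 * U x y)"
      if x: "norm x = 1" and y: "norm y = 1" for x y :: "'f ^ 'n"
    proof -
      have U: "U x y = 1 - (norm (herm x y))\<^sup>2" unfolding U_def by (simp only: sum_J)
      have "(norm (herm x y))\<^sup>2 \<le> 1\<^sup>2" using bessel[OF x y] unfolding sum_J by simp
      then have "norm (herm x y) \<le> 1" by (rule power2_le_imp_le) simp
      then have "2 * arccos (2 * (norm (herm x y))\<^sup>2 - 1) = 4 * arccos (norm (herm x y))"
        by (intro arccos_double) auto
      then show ?thesis unfolding U proj_dist_scalar_line[OF x y] by (simp add: algebra_simps)
    qed
    have "real (2 * m + 1) \<le> real (DIM('f) * (CARD('n) - 1))" using m by (simp only: of_nat_le_iff)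
    then show "2 * real m \<le> 2 * ((real DIM('f ^ 'n) - real DIM('f)) / 2) - 1"
      using n by (simp add: of_nat_diff algebra_simps)
  qed
qed

end

section \<open>Spheres inside a space, and the Cayley plane\<close>

text \<open>
The sphere may have smaller dimension than the space: the kernel stays positive definite on the image
of \<open>\<pi>\<close>, and distances there determine its radial part.
\<close>

theorem sphere_class_C:
  fixes \<pi> :: "'a::euclidean_space \<Rightarrow> 'p"
  assumes D: "2 \<le> DIM('a)"
    and \<pi>: "\<And>x. norm x = 1 \<Longrightarrow> \<pi> x \<in> M"
    and dist: "\<And>x y. norm x = 1 \<Longrightarrow> norm y = 1 \<Longrightarrow> \<delta> (\<pi> x) (\<pi> y) = 2 * arccos (x \<bullet> y)"
    and cont: "continuous_kernel M \<delta> K" and pd: "positive_definite M K"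
    and radial: "radial_part M \<delta> K f" and m: "2 * m + 2 \<le> DIM('a)"
  shows "class_C m f {-1<..<1}"
proof -
  interpret zonal_space "sphere_U :: 'a \<Rightarrow> 'a \<Rightarrow> real" "(real DIM('a) - 1) / 2" "real DIM('a) - 1"
    by (rule sphere_zonal_space[OF D])
  have U: "1 - 2 * sphere_U x y = x \<bullet> y" for x y :: 'a by (simp add: sphere_U_def field_simps)
  show ?thesis
  proof (rule radial_part_class_C[where \<pi> = \<pi>, OF \<pi> _ cont pd radial])
    have "real (2 * m + 2) \<le> real DIM('a)" using m by (simp only: of_nat_le_iff)
    then show "2 * real m \<le> 2 * ((real DIM('a) - 1) / 2) - 1" by (simp add: field_simps)
  qed (simp_all add: U dist)
qed

lemma real_division_algebra: "normed_division_algebra ((*) :: real \<Rightarrow> real \<Rightarrow> real) (\<lambda>a. a) 1"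
  by unfold_locales
     (auto simp: bilinear_conv_bounded_bilinear bounded_bilinear_mult linear_id[unfolded id_def] power2_eq_square)

lemma complex_division_algebra: "normed_division_algebra ((*) :: complex \<Rightarrow> complex \<Rightarrow> complex) cnj 1"
proof (rule normed_division_algebra.intro)
  show "bilinear ((*) :: complex \<Rightarrow> complex \<Rightarrow> complex)"
    by (simp add: bilinear_conv_bounded_bilinear bounded_bilinear_mult)
  show "linear cnj" by (rule linearI) (simp_all add: complex_eq_iff)
  show "cnj a * a = (cmod a)\<^sup>2 *\<^sub>R 1" for a
    unfolding cmod_power2 by (simp add: complex_eq_iff power2_eq_square)
  show "inner (cnj a * b) c = inner b (a * c)" for a b c :: complex
    by (simp add: inner_complex_def algebra_simps)
qed (auto simp: mult_ac)

lemma quat_division_algebra: "normed_division_algebra quat_mult quat_cnj (1, 0)"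
proof (rule normed_division_algebra.intro)
  note defs = quat_mult_def quat_cnj_def cd_mult_def cd_cnj_def
  show "bilinear quat_mult"
    unfolding bilinear_def
    by (intro conjI allI linearI) (simp_all add: defs prod_eq_iff complex_eq_iff algebra_simps)
  show "linear quat_cnj"
    by (rule linearI) (simp_all add: defs prod_eq_iff complex_eq_iff)
  show "quat_mult (quat_mult a b) c = quat_mult a (quat_mult b c)" for a b c
    by (simp add: defs prod_eq_iff algebra_simps)
  show "quat_mult a (1, 0) = a" "quat_mult (1, 0) a = a" for a
    by (simp_all add: defs)
  show "quat_cnj (quat_mult a b) = quat_mult (quat_cnj b) (quat_cnj a)" for a b
    by (simp add: defs prod_eq_iff algebra_simps)
  show "quat_cnj (quat_cnj a) = a" for a by (simp add: defs)
  show "norm (quat_cnj a) = norm a" for a by (simp add: defs norm_prod_def)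
  show "norm (1 :: complex, 0 :: complex) = 1" by (simp add: norm_prod_def)
  show "quat_mult (quat_cnj a) a = (norm a)\<^sup>2 *\<^sub>R (1, 0)" for a
  proof -
    have "(norm a)\<^sup>2 = (cmod (fst a))\<^sup>2 + (cmod (snd a))\<^sup>2" by (simp add: norm_prod_def)
    then show ?thesis unfolding cmod_power2
      by (simp add: defs prod_eq_iff complex_eq_iff power2_eq_square)
  qed
  show "inner (quat_mult (quat_cnj a) b) c = inner b (quat_mult a c)" for a b c
    by (simp add: defs inner_prod_def inner_complex_def algebra_simps)
qed

text \<open>
The projectors of rank one in the upper left 2 by 2 block form a projective line, parametrized by
the unit sphere of dimension 8. Three of the eight real coordinates of the off-diagonal entry are
kept, which leaves a sphere of dimension 3.
\<close>

definition cayley_line_point :: "real ^ 4 \<Rightarrow> oct ^ 3 ^ 3" where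
  "cayley_line_point x = (let z = (((Complex (x $ 2) (x $ 3), Complex (x $ 4) 0), 0) :: oct) in
     \<chi> i j. if i = 1 \<and> j = 1 then ((1 + x $ 1) / 2) *\<^sub>R oct_one
       else if i = 2 \<and> j = 2 then ((1 - x $ 1) / 2) *\<^sub>R oct_one
       else if i = 1 \<and> j = 2 then (1 / 2) *\<^sub>R z
       else if i = 2 \<and> j = 1 then (1 / 2) *\<^sub>R oct_cnj z else 0)"

lemma cayley_line_point_entries:
  fixes x :: "real ^ 4"
  defines "z \<equiv> (((Complex (x $ 2) (x $ 3), Complex (x $ 4) 0), 0) :: oct)"
  shows "cayley_line_point x $ 1 $ 1 = ((1 + x $ 1) / 2) *\<^sub>R oct_one"
    "cayley_line_point x $ 2 $ 2 = ((1 - x $ 1) / 2) *\<^sub>R oct_one"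
    "cayley_line_point x $ 1 $ 2 = (1 / 2) *\<^sub>R z"
    "cayley_line_point x $ 2 $ 1 = (1 / 2) *\<^sub>R oct_cnj z"
    "cayley_line_point x $ 3 $ i = 0" "cayley_line_point x $ i $ 3 = 0"
  by (simp_all add: cayley_line_point_def z_def Let_def)

lemma inner_real_4: "(x :: real ^ 4) \<bullet> y = x $ 1 * y $ 1 + x $ 2 * y $ 2 + x $ 3 * y $ 3 + x $ 4 * y $ 4"
  by (simp add: inner_vec_def sum_4)

lemma cayley_line_point_in_plane:
  assumes "norm x = 1"
  shows "cayley_line_point x \<in> cayley_plane"
proof -
  note defs = quat_mult_def quat_cnj_def cd_mult_def cd_cnj_def oct_mult_def oct_cnj_def oct_one_def
  have sq: "x $ 1 * x $ 1 + x $ 2 * x $ 2 + x $ 3 * x $ 3 + x $ 4 * x $ 4 = 1"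
    using assms by (simp add: norm_eq_1 inner_real_4)
  show ?thesis
    unfolding cayley_plane_def mem_Collect_eq forall_3 sum_3 cayley_line_point_entries
    using sq by (simp add: defs prod_eq_iff complex_eq_iff field_simps)
qed

lemma cayley_dist_line_point:
  assumes "norm x = 1" "norm y = 1"
  shows "cayley_dist (cayley_line_point x) (cayley_line_point y) = 2 * arccos (x \<bullet> y)"
proof -
  note defs = quat_cnj_def cd_cnj_def oct_cnj_def oct_one_def
  have ip: "cayley_line_point x \<bullet> cayley_line_point y = (1 + x \<bullet> y) / 2"
    unfolding inner_vec_def[where 'b=3] sum_3 cayley_line_point_entries inner_real_4
    by (simp add: defs inner_prod_def inner_complex_def field_simps)
  have "\<bar>x \<bullet> y\<bar> \<le> 1" using Cauchy_Schwarz_ineq2[of x y] assms by simp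
  then have "2 * arccos (2 * (sqrt ((1 + x \<bullet> y) / 2))\<^sup>2 - 1) = 4 * arccos (sqrt ((1 + x \<bullet> y) / 2))"
    by (intro arccos_double) (auto simp: abs_le_iff)
  moreover have "2 * (sqrt ((1 + x \<bullet> y) / 2))\<^sup>2 - 1 = x \<bullet> y"
    using \<open>\<bar>x \<bullet> y\<bar> \<le> 1\<close> by (simp add: abs_le_iff field_simps)
  ultimately show ?thesis by (simp add: cayley_dist_def ip)
qed

section \<open>Differentiability of radial parts\<close>

theorem theorem6p1:
  fixes d :: nat
  shows
    "(\<forall>(K :: real ^ 'n \<Rightarrow> real ^ 'n \<Rightarrow> real) f.
        1 \<le> d \<and> CARD('n) = d + 1 \<and>
        continuous_kernel (sphere 0 1) sphere_dist K \<and>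
        positive_definite (sphere 0 1) K \<and>
        zonal (sphere 0 1) sphere_dist K \<and>
        radial_part (sphere 0 1) sphere_dist K f \<longrightarrow>
        class_C ((d - 1) div 2) f {-1<..<1}) \<and>
     (\<forall>(K :: (real ^ 'n) set \<Rightarrow> (real ^ 'n) set \<Rightarrow> real) f.
        2 \<le> d \<and> CARD('n) = d + 1 \<and>
        continuous_kernel (proj_space (*)) (proj_dist (*) (\<lambda>a. a)) K \<and>
        positive_definite (proj_space (*)) K \<and>
        zonal (proj_space (*)) (proj_dist (*) (\<lambda>a. a)) K \<and>
        radial_part (proj_space (*)) (proj_dist (*) (\<lambda>a. a)) K f \<longrightarrow>
        class_C ((d - 1) div 2) f {-1<..<1}) \<and>
     (\<forall>(K :: (complex ^ 'n) set \<Rightarrow> (complex ^ 'n) set \<Rightarrow> real) f.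
        4 \<le> d \<and> even d \<and> CARD('n) = d div 2 + 1 \<and>
        continuous_kernel (proj_space (*)) (proj_dist (*) cnj) K \<and>
        positive_definite (proj_space (*)) K \<and>
        zonal (proj_space (*)) (proj_dist (*) cnj) K \<and>
        radial_part (proj_space (*)) (proj_dist (*) cnj) K f \<longrightarrow>
        class_C ((d - 2) div 2) f {-1<..<1}) \<and>
     (\<forall>(K :: (quat ^ 'n) set \<Rightarrow> (quat ^ 'n) set \<Rightarrow> real) f.
        8 \<le> d \<and> 4 dvd d \<and> CARD('n) = d div 4 + 1 \<and>
        continuous_kernel (proj_space quat_mult) (proj_dist quat_mult quat_cnj) K \<and>
        positive_definite (proj_space quat_mult) K \<and>
        zonal (proj_space quat_mult) (proj_dist quat_mult quat_cnj) K \<and>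
        radial_part (proj_space quat_mult) (proj_dist quat_mult quat_cnj) K f \<longrightarrow>
        ((\<exists>m. d = 8 * m + 8) \<longrightarrow> class_C ((d - 4) div 4) f {-1<..<1}) \<and>
        ((\<exists>m. d = 8 * m + 12) \<longrightarrow> class_C (d div 4) f {-1<..<1})) \<and>
     (\<forall>(K :: oct ^ 3 ^ 3 \<Rightarrow> oct ^ 3 ^ 3 \<Rightarrow> real) f.
        continuous_kernel cayley_plane cayley_dist K \<and>
        positive_definite cayley_plane K \<and>
        zonal cayley_plane cayley_dist K \<and>
        radial_part cayley_plane cayley_dist K f \<longrightarrow>
        class_C 1 f {-1<..<1})"
proof (intro conjI allI impI)
  fix K :: "real ^ 'n \<Rightarrow> real ^ 'n \<Rightarrow> real" and f
  assume *: "1 \<le> d \<and> CARD('n) = d + 1 \<and>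
        continuous_kernel (sphere 0 1) sphere_dist K \<and>
        positive_definite (sphere 0 1) K \<and>
        zonal (sphere 0 1) sphere_dist K \<and>
        radial_part (sphere 0 1) sphere_dist K f"
  show "class_C ((d - 1) div 2) f {-1<..<1}"
    by (rule sphere_class_C[where \<pi> = "\<lambda>x :: real ^ 'n. x" and \<delta> = sphere_dist and K = K and M = "sphere 0 1"])
       (use * in \<open>auto simp: sphere_dist_def\<close>)
next
  fix K :: "(real ^ 'n) set \<Rightarrow> (real ^ 'n) set \<Rightarrow> real" and f
  assume *: "2 \<le> d \<and> CARD('n) = d + 1 \<and>
        continuous_kernel (proj_space (*)) (proj_dist (*) (\<lambda>a. a)) K \<and>
        positive_definite (proj_space (*)) K \<and>
        zonal (proj_space (*)) (proj_dist (*) (\<lambda>a. a)) K \<and>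
        radial_part (proj_space (*)) (proj_dist (*) (\<lambda>a. a)) K f"
  show "class_C ((d - 1) div 2) f {-1<..<1}"
    by (rule normed_division_algebra.projective_class_C[OF real_division_algebra, where K = K])
       (use * in auto)
next
  fix K :: "(complex ^ 'n) set \<Rightarrow> (complex ^ 'n) set \<Rightarrow> real" and f
  assume *: "4 \<le> d \<and> even d \<and> CARD('n) = d div 2 + 1 \<and>
        continuous_kernel (proj_space (*)) (proj_dist (*) cnj) K \<and>
        positive_definite (proj_space (*)) K \<and>
        zonal (proj_space (*)) (proj_dist (*) cnj) K \<and>
        radial_part (proj_space (*)) (proj_dist (*) cnj) K f"
  show "class_C ((d - 2) div 2) f {-1<..<1}"
    by (rule normed_division_algebra.projective_class_C[OF complex_division_algebra, where K = K])
       (use * in auto)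
next
  fix K :: "(quat ^ 'n) set \<Rightarrow> (quat ^ 'n) set \<Rightarrow> real" and f
  assume *: "8 \<le> d \<and> 4 dvd d \<and> CARD('n) = d div 4 + 1 \<and>
        continuous_kernel (proj_space quat_mult) (proj_dist quat_mult quat_cnj) K \<and>
        positive_definite (proj_space quat_mult) K \<and>
        zonal (proj_space quat_mult) (proj_dist quat_mult quat_cnj) K \<and>
        radial_part (proj_space quat_mult) (proj_dist quat_mult quat_cnj) K f"
  \<comment> \<open>Both residue classes of \<open>d\<close> mod 8 fall under one bound on the order of differentiability.\<close>
  have C: "class_C m f {-1<..<1}" if "2 * m + 1 \<le> 4 * (d div 4)" for m
    by (rule normed_division_algebra.projective_class_C[OF quat_division_algebra, where K = K])
       (use * that in auto)
  show "class_C ((d - 4) div 4) f {-1<..<1}" "class_C (d div 4) f {-1<..<1}"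
    by (rule C; use * in auto)+
next
  fix K :: "oct ^ 3 ^ 3 \<Rightarrow> oct ^ 3 ^ 3 \<Rightarrow> real" and f
  assume *: "continuous_kernel cayley_plane cayley_dist K \<and>
        positive_definite cayley_plane K \<and>
        zonal cayley_plane cayley_dist K \<and>
        radial_part cayley_plane cayley_dist K f"
  show "class_C 1 f {-1<..<1}"
    by (rule sphere_class_C[where \<pi> = cayley_line_point and \<delta> = cayley_dist and K = K and M = cayley_plane])
       (use * in \<open>auto simp: cayley_line_point_in_plane cayley_dist_line_point\<close>)
qed

end
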